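(* Let $G$ be a Lie group over $\mathbb{K}$ with Lie algebra $\mathfrak{g}$, $k\ge1$, and let $*^L$, $J^L$, $*^R$ be the left product, left inversion and right product on $E=\bigoplus_{0\ne\alpha\in I_k}\varepsilon^\alpha\mathfrak{g}$. With respect to the left trivialization one has $$\sum_\alpha\varepsilon^\alpha v_\alpha\ *^L\ \sum_\beta\varepsilon^\beta w_\beta=\sum_\gamma\varepsilon^\gamma z_\gamma,\qquad z_\gamma=v_\gamma+w_\gamma+\sum_{m=2}^{|\gamma|}\ \sum_{\lambda\in\mathcal P_m(\gamma)}[\ldots[[v_{\lambda^m},w_{\lambda^1}],w_{\lambda^2}],\ldots,w_{\lambda^{m-1}}].$$ The left inversion is $$J^L\Big(\sum_\alpha\varepsilon^\alpha v_\alpha\Big)=\sum_\gamma\varepsilon^\gamma\Big(-v_\gamma+\sum_{m=2}^{|\gamma|}(-1)^m\sum_{\lambda\in\mathcal P_m(\gamma)}[\ldots[[v_{\lambda^m},v_{\lambda^{m-1}}],v_{\lambda^{m-2}}],\ldots,v_{\lambda^1}]\Big),$$ and the right product is $$(v*^Rw)_\gamma=v_\gamma+w_\gamma+\sum_{m=2}^{|\gamma|}\ \sum_{\lambda\in\mathcal P_m(\gamma)}[v_{\lambda^{m-1}},\ldots,[v_{\lambda^2},[v_{\lambda^1},w_{\lambda^m}]]\ldots].$$ Here partitions are ordered: $\lambda^1<\dots<\lambda^m$.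
   Context: $\mathbb{K}$ is a commutative unital Hausdorff topological ring with open dense unit group and continuous inversion; topological modules are Hausdorff. A map $f:V\supset U\to W$ ($U$ open, $V,W$ topological $\mathbb{K}$-modules) is $C^1$ if there is a continuous $f^{[1]}$ on $\{(x,v,t)\in U\times V\times\mathbb{K}:x+tv\in U\}$ with $f(x+tv)-f(x)=tf^{[1]}(x,v,t)$; $df(x)v=f^{[1]}(x,v,0)$; $C^{j+1}$ means $C^1$ with $f^{[1]}$ of class $C^j$; smooth means $C^j$ for all $j$. Manifolds and tangent bundles are defined by charts; $Tf(x,v)=(f(x),df(x)v)$. A Lie group over $\mathbb{K}$ is a smooth manifold with smooth group multiplication $m$ and inversion. Its Lie algebra is $\mathfrak{g}=T_eG$ with $[v,w]=[v^R,w^R](e)$, where $v^R$ is the right-invariant vector field with value $v$ at $e$, and the bracket of vector fields is $[X,Y](x)=dX(x)Y(x)-dY(x)X(x)$ in charts. Index set: $I_k=\{0,1\}^k$, elements $\alpha=(\alpha_k,\dots,\alpha_1)$ ordered lexicographically, i.e. by the integer $\sum_i\alpha_i2^{i-1}$; $|\alpha|=\sum\alpha_i$; $\varepsilon^\alpha=\prod\varepsilon_i^{\alpha_i}$. $\mathcal P_m(\gamma)$ is the set of partitions of $\gamma$ of length $m$: $\lambda=(\lambda^1,\dots,\lambda^m)$ with $\lambda^i\in I_k$, $0<\lambda^1<\dots<\lambda^m$ and $\sum_i\lambda^i=\gamma$ (componentwise sum of integers). $T^kG=T_{\varepsilon_k}\cdots T_{\varepsilon_1}G$ is a Lie group with multiplication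 $T^km$; $(T^kG)_e$, the fiber over $e$, is a normal subgroup. In a chart around $e$ with $e$ corresponding to $0$, elements of $(T^kG)_e$ are $\sum_{\alpha\ne0}\varepsilon^\alpha v_\alpha$; for $v\in\mathfrak{g}$, $\varepsilon^\alpha v\in(T^kG)_e$ is the element with only nonzero component $v$ at $\alpha$ (chart-independent). Left and right trivialization of $(T^kG)_e$ are the bijections $E\to(T^kG)_e$, $\Psi^L_k(\sum\varepsilon^\alpha v_\alpha)=\prod^{\uparrow}_{\alpha}\varepsilon^\alpha v_\alpha$ and $\Psi^R_k(\sum\varepsilon^\alpha v_\alpha)=\prod^{\downarrow}_{\alpha}\varepsilon^\alpha v_\alpha$, where the products are taken in $(T^kG)_e$ in increasing, resp. decreasing order of the index. The operations are defined by $\Psi^F_k(v)\cdot\Psi^F_k(w)=\Psi^F_k(v*^Fw)$ for $F=L,R$, and $(\Psi^L_k(v))^{-1}=\Psi^L_k(J^Lv)$. *)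

theory Defs
  imports "HOL-Analysis.Analysis" "HOL-Algebra.Module"
begin

section \<open>Base ring and topological modules\<close>

class hausdorff_ring =
  comm_ring_1 + topological_ab_group_add + topological_semigroup_mult + t2_space

definition good_base_ring :: "'k::hausdorff_ring itself \<Rightarrow> bool" where
  "good_base_ring _ \<longleftrightarrow>
     open {u::'k. u dvd 1} \<and>
     closure {u::'k. u dvd 1} = UNIV \<and>
     continuous_on {u::'k. u dvd 1} (\<lambda>u. THE u'. u * u' = 1)"

definition topological_module ::
  "('k::hausdorff_ring \<Rightarrow> 'v::{topological_ab_group_add, t2_space} \<Rightarrow> 'v) \<Rightarrow> bool" where
  "topological_module sc \<longleftrightarrow> Modules.module sc \<and> continuous_on UNIV (\<lambda>(t, x). sc t x)"

text \<open>
  The domains of the iterated difference quotients and the iterated tangent spaces of a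
  \<^emph>\<open>K\<close>-module \<^emph>\<open>V\<close> are finite products of copies of \<^emph>\<open>V\<close> and \<^emph>\<open>K\<close>. To be able to iterate these
  constructions inside the logic, all these products are collected in a single type. For each
  shape \<open>s\<close>, the set \<open>points s\<close> is the product module described by \<open>s\<close>, with
  componentwise operations and the product topology; the points of different shapes form
  different (open) components of the type.
\<close>

datatype shape = Model | Base | Prod shape shape

datatype ('v, 'k) elt =
    Vec (vec: 'v)
  | Scal (scal: 'k)
  | VPair (vfst: "('v, 'k) elt") (vsnd: "('v, 'k) elt")

primrec shape_of :: "('v, 'k) elt \<Rightarrow> shape" where
  "shape_of (Vec x) = Model"
| "shape_of (Scal t) = Base"
| "shape_of (VPair p q) = Prod (shape_of p) (shape_of q)"

definition points :: "shape \<Rightarrow> ('v, 'k) elt set" where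
  "points s = {p. shape_of p = s}"

inductive basic_open :: "('v::topological_space, 'k::topological_space) elt set \<Rightarrow> bool" where
  "open S \<Longrightarrow> basic_open (Vec ` S)"
| "open S \<Longrightarrow> basic_open (Scal ` S)"
| "basic_open A \<Longrightarrow> basic_open B \<Longrightarrow> basic_open ((\<lambda>(p, q). VPair p q) ` (A \<times> B))"

instantiation elt :: (topological_space, topological_space) topological_space
begin

definition open_elt :: "('a, 'b) elt set \<Rightarrow> bool" where
  "open_elt = generate_topology (Collect basic_open)"

instance
  by standard (auto simp: open_elt_def intro: generate_topology.intros)

end

text \<open>Sums are only meaningful for points of the same shape.\<close>

fun vadd :: "('v::plus, 'k::plus) elt \<Rightarrow> ('v, 'k) elt \<Rightarrow> ('v, 'k) elt" where
  "vadd (Vec x) (Vec y) = Vec (x + y)"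
| "vadd (Scal s) (Scal t) = Scal (s + t)"
| "vadd (VPair p q) (VPair p' q') = VPair (vadd p p') (vadd q q')"

primrec vscale :: "('k::times \<Rightarrow> 'v \<Rightarrow> 'v) \<Rightarrow> 'k \<Rightarrow> ('v, 'k) elt \<Rightarrow> ('v, 'k) elt" where
  "vscale sc r (Vec x) = Vec (sc r x)"
| "vscale sc r (Scal t) = Scal (r * t)"
| "vscale sc r (VPair p q) = VPair (vscale sc r p) (vscale sc r q)"

primrec vzero :: "shape \<Rightarrow> ('v::zero, 'k::zero) elt" where
  "vzero Model = Vec 0"
| "vzero Base = Scal 0"
| "vzero (Prod s s') = VPair (vzero s) (vzero s')"

definition vdiff :: "('k::hausdorff_ring \<Rightarrow> 'v \<Rightarrow> 'v) \<Rightarrow>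
    ('v::topological_ab_group_add, 'k) elt \<Rightarrow> ('v, 'k) elt \<Rightarrow> ('v, 'k) elt" where
  "vdiff sc p q = vadd p (vscale sc (- 1) q)"


section \<open>Differential calculus\<close>

text \<open>A triple $(x, v, t)$ is encoded as \<open>VPair x (VPair v (Scal t))\<close>.\<close>

definition slope_dom :: "('k::hausdorff_ring \<Rightarrow> 'v::{topological_ab_group_add, t2_space} \<Rightarrow> 'v) \<Rightarrow>
    shape \<Rightarrow> ('v, 'k) elt set \<Rightarrow> ('v, 'k) elt set" where
  "slope_dom sc s U =
     {VPair x (VPair v (Scal t)) | x v t. x \<in> U \<and> v \<in> points s \<and> vadd x (vscale sc t v) \<in> U}"

definition is_slope :: "('k::hausdorff_ring \<Rightarrow> 'v::{topological_ab_group_add, t2_space} \<Rightarrow> 'v) \<Rightarrow>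
    shape \<Rightarrow> shape \<Rightarrow> ('v, 'k) elt set \<Rightarrow> (('v, 'k) elt \<Rightarrow> ('v, 'k) elt) \<Rightarrow>
    (('v, 'k) elt \<Rightarrow> ('v, 'k) elt) \<Rightarrow> bool" where
  "is_slope sc s s' U f f1 \<longleftrightarrow>
     continuous_on (slope_dom sc s U) f1 \<and>
     f1 \<in> slope_dom sc s U \<rightarrow> points s' \<and>
     (\<forall>x v t. VPair x (VPair v (Scal t)) \<in> slope_dom sc s U \<longrightarrow>
        vdiff sc (f (vadd x (vscale sc t v))) (f x) =
          vscale sc t (f1 (VPair x (VPair v (Scal t)))))"

primrec C_on :: "nat \<Rightarrow> ('k::hausdorff_ring \<Rightarrow> 'v::{topological_ab_group_add, t2_space} \<Rightarrow> 'v) \<Rightarrow>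
    shape \<Rightarrow> shape \<Rightarrow> ('v, 'k) elt set \<Rightarrow> (('v, 'k) elt \<Rightarrow> ('v, 'k) elt) \<Rightarrow> bool" where
  "C_on 0 sc s s' U f \<longleftrightarrow>
     U \<subseteq> points s \<and> open U \<and> f \<in> U \<rightarrow> points s' \<and> continuous_on U f"
| "C_on (Suc j) sc s s' U f \<longleftrightarrow>
     U \<subseteq> points s \<and> open U \<and> f \<in> U \<rightarrow> points s' \<and>
     (\<exists>f1. is_slope sc s s' U f f1 \<and>
           C_on j sc (Prod s (Prod s Base)) s' (slope_dom sc s U) f1)"

definition smooth_on :: "('k::hausdorff_ring \<Rightarrow> 'v::{topological_ab_group_add, t2_space} \<Rightarrow> 'v) \<Rightarrow>
    shape \<Rightarrow> shape \<Rightarrow> ('v, 'k) elt set \<Rightarrow> (('v, 'k) elt \<Rightarrow> ('v, 'k) elt) \<Rightarrow> bool" where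
  "smooth_on sc s s' U f \<longleftrightarrow> (\<forall>j. C_on j sc s s' U f)"

text \<open>
  For \<open>f\<close> of class $C^1$ on an open set, $f^{[1]}$ is unique on its domain \<open>slope_dom\<close>, because
  the units are dense and the modules are Hausdorff.
\<close>

definition slope :: "('k::hausdorff_ring \<Rightarrow> 'v::{topological_ab_group_add, t2_space} \<Rightarrow> 'v) \<Rightarrow>
    shape \<Rightarrow> shape \<Rightarrow> ('v, 'k) elt set \<Rightarrow> (('v, 'k) elt \<Rightarrow> ('v, 'k) elt) \<Rightarrow>
    ('v, 'k) elt \<Rightarrow> ('v, 'k) elt" where
  "slope sc s s' U f = (SOME f1. is_slope sc s s' U f f1)"

definition differential :: "('k::hausdorff_ring \<Rightarrow> 'v::{topological_ab_group_add, t2_space} \<Rightarrow> 'v) \<Rightarrow>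
    shape \<Rightarrow> shape \<Rightarrow> ('v, 'k) elt set \<Rightarrow> (('v, 'k) elt \<Rightarrow> ('v, 'k) elt) \<Rightarrow>
    ('v, 'k) elt \<Rightarrow> ('v, 'k) elt \<Rightarrow> ('v, 'k) elt" where
  "differential sc s s' U f x v = slope sc s s' U f (VPair x (VPair v (Scal 0)))"


section \<open>Iterated tangent maps in linear spaces\<close>

text \<open>
  In $T^{k+1} = T_{\varepsilon_{k+1}} T^k$ the point $x + \varepsilon_{k+1} v$ is
  \<open>VPair x v\<close>, where \<open>x\<close> and \<open>v\<close> are points of the \<open>k\<close>-th iterated tangent space.
\<close>

primrec Tk_shape :: "nat \<Rightarrow> shape \<Rightarrow> shape" where
  "Tk_shape 0 s = s"
| "Tk_shape (Suc k) s = Prod (Tk_shape k s) (Tk_shape k s)"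

primrec Tk_set :: "nat \<Rightarrow> shape \<Rightarrow> ('v, 'k) elt set \<Rightarrow> ('v, 'k) elt set" where
  "Tk_set 0 s U = U"
| "Tk_set (Suc k) s U = {VPair x v | x v. x \<in> Tk_set k s U \<and> v \<in> points (Tk_shape k s)}"

definition T_map :: "('k::hausdorff_ring \<Rightarrow> 'v::{topological_ab_group_add, t2_space} \<Rightarrow> 'v) \<Rightarrow>
    shape \<Rightarrow> shape \<Rightarrow> ('v, 'k) elt set \<Rightarrow> (('v, 'k) elt \<Rightarrow> ('v, 'k) elt) \<Rightarrow>
    ('v, 'k) elt \<Rightarrow> ('v, 'k) elt" where
  "T_map sc s s' U f p =
     VPair (f (vfst p)) (differential sc s s' U f (vfst p) (vsnd p))"

primrec Tk_map :: "nat \<Rightarrow> ('k::hausdorff_ring \<Rightarrow> 'v::{topological_ab_group_add, t2_space} \<Rightarrow> 'v) \<Rightarrow>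
    shape \<Rightarrow> shape \<Rightarrow> ('v, 'k) elt set \<Rightarrow> (('v, 'k) elt \<Rightarrow> ('v, 'k) elt) \<Rightarrow>
    ('v, 'k) elt \<Rightarrow> ('v, 'k) elt" where
  "Tk_map 0 sc s s' U f = f"
| "Tk_map (Suc k) sc s s' U f =
     T_map sc (Tk_shape k s) (Tk_shape k s') (Tk_set k s U) (Tk_map k sc s s' U f)"

text \<open>The projection of the iterated tangent space to the base.\<close>

primrec Tk_foot :: "nat \<Rightarrow> ('v, 'k) elt \<Rightarrow> ('v, 'k) elt" where
  "Tk_foot 0 p = p"
| "Tk_foot (Suc k) p = Tk_foot k (vfst p)"

text \<open>The identification $T^k V \times T^k W = T^k (V \times W)$.\<close>

primrec Tk_zip :: "nat \<Rightarrow> ('v, 'k) elt \<Rightarrow> ('v, 'k) elt \<Rightarrow> ('v, 'k) elt" where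
  "Tk_zip 0 p q = VPair p q"
| "Tk_zip (Suc k) p q = VPair (Tk_zip k (vfst p) (vfst q)) (Tk_zip k (vsnd p) (vsnd q))"


section \<open>Multi-indices\<close>

text \<open>
  A multi-index $\alpha = (\alpha_k, \dots, \alpha_1)$ in $\{0,1\}^k$ is represented by the integer
  $\sum_i \alpha_i 2^{i-1}$, so that the lexicographic order becomes the usual one, and the
  non-zero multi-indices are the elements of \<open>{0<..<2 ^ k}\<close>.
\<close>

definition digit :: "nat \<Rightarrow> nat \<Rightarrow> nat" where
  "digit \<alpha> i = \<alpha> div 2 ^ (i - 1) mod 2"

definition weight :: "nat \<Rightarrow> nat \<Rightarrow> nat" where
  "weight k \<alpha> = (\<Sum>i = 1..k. digit \<alpha> i)"

definition partitions :: "nat \<Rightarrow> nat \<Rightarrow> nat \<Rightarrow> nat list set" where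
  "partitions k m \<gamma> =
     {ls. length ls = m \<and> set ls \<subseteq> {0<..<2 ^ k} \<and> sorted_wrt (<) ls \<and>
          (\<forall>i\<in>{1..k}. (\<Sum>l\<leftarrow>ls. digit l i) = digit \<gamma> i)}"

text \<open>The element $\varepsilon^\alpha v$ of $T^k V$ (with \<open>v\<close> in the module of shape \<open>s\<close>).\<close>

primrec Tk_single :: "shape \<Rightarrow> nat \<Rightarrow> nat \<Rightarrow> ('v::zero, 'k::zero) elt \<Rightarrow> ('v, 'k) elt" where
  "Tk_single s 0 \<alpha> v = v"
| "Tk_single s (Suc k) \<alpha> v =
     (if digit \<alpha> (Suc k) = 0 then VPair (Tk_single s k \<alpha> v) (vzero (Tk_shape k s))
      else VPair (vzero (Tk_shape k s)) (Tk_single s k \<alpha> v))"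


section \<open>Manifolds\<close>

type_synonym ('m, 'v, 'k) chart = "'m set \<times> ('m \<Rightarrow> ('v, 'k) elt)"

record ('m, 'v, 'k) manifold =
  mtop :: "'m topology"
  model :: shape
  atlas :: "('m, 'v, 'k) chart set"

definition cimage :: "('m, 'v, 'k) chart \<Rightarrow> ('v, 'k) elt set" where
  "cimage c = snd c ` fst c"

definition cinv :: "('m, 'v, 'k) chart \<Rightarrow> ('v, 'k) elt \<Rightarrow> 'm" where
  "cinv c = inv_into (fst c) (snd c)"

text \<open>The chart representation of a map \<open>f\<close> with respect to charts \<open>c\<close>, \<open>d\<close>, and its domain.\<close>

definition rep :: "('m, 'v, 'k) chart \<Rightarrow> ('n, 'v, 'k) chart \<Rightarrow> ('m \<Rightarrow> 'n) \<Rightarrow>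
    ('v, 'k) elt \<Rightarrow> ('v, 'k) elt" where
  "rep c d f x = snd d (f (cinv c x))"

definition rep_dom :: "('m, 'v, 'k) chart \<Rightarrow> ('n, 'v, 'k) chart \<Rightarrow> ('m \<Rightarrow> 'n) \<Rightarrow>
    ('v, 'k) elt set" where
  "rep_dom c d f = {x \<in> cimage c. f (cinv c x) \<in> fst d}"

definition smooth_manifold :: "('k::hausdorff_ring \<Rightarrow> 'v::{topological_ab_group_add, t2_space} \<Rightarrow> 'v) \<Rightarrow>
    ('m, 'v, 'k) manifold \<Rightarrow> bool" where
  "smooth_manifold sc M \<longleftrightarrow>
     (\<Union>c\<in>atlas M. fst c) = topspace (mtop M) \<and>
     (\<forall>c\<in>atlas M. openin (mtop M) (fst c) \<and>
        cimage c \<subseteq> points (model M) \<and> open (cimage c) \<and>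
        homeomorphic_map (subtopology (mtop M) (fst c)) (top_of_set (cimage c)) (snd c)) \<and>
     (\<forall>c\<in>atlas M. \<forall>d\<in>atlas M.
        smooth_on sc (model M) (model M) (rep_dom c d id) (rep c d id))"

definition smooth_map :: "('k::hausdorff_ring \<Rightarrow> 'v::{topological_ab_group_add, t2_space} \<Rightarrow> 'v) \<Rightarrow>
    ('m, 'v, 'k) manifold \<Rightarrow> ('n, 'v, 'k) manifold \<Rightarrow> ('m \<Rightarrow> 'n) \<Rightarrow> bool" where
  "smooth_map sc M N f \<longleftrightarrow>
     continuous_map (mtop M) (mtop N) f \<and>
     (\<forall>c\<in>atlas M. \<forall>d\<in>atlas N. smooth_on sc (model M) (model N) (rep_dom c d f) (rep c d f))"

definition prod_chart :: "('m, 'v, 'k) chart \<Rightarrow> ('n, 'v, 'k) chart \<Rightarrow> ('m \<times> 'n, 'v, 'k) chart" where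
  "prod_chart c d = (fst c \<times> fst d, \<lambda>(p, q). VPair (snd c p) (snd d q))"

definition prod_manifold :: "('m, 'v, 'k) manifold \<Rightarrow> ('n, 'v, 'k) manifold \<Rightarrow>
    ('m \<times> 'n, 'v, 'k) manifold" where
  "prod_manifold M N =
     \<lparr>mtop = prod_topology (mtop M) (mtop N),
      model = Prod (model M) (model N),
      atlas = {prod_chart c d | c d. c \<in> atlas M \<and> d \<in> atlas N}\<rparr>"

definition chart_at :: "('m, 'v, 'k) manifold \<Rightarrow> 'm \<Rightarrow> ('m, 'v, 'k) chart" where
  "chart_at M p = (SOME c. c \<in> atlas M \<and> p \<in> fst c)"


section \<open>Iterated tangent bundles\<close>

text \<open>
  $T^k M$ is obtained by gluing the sets $T^k(\varphi(U))$, for the charts $(U, \varphi)$ of \<open>M\<close>,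
  along the $k$-th iterated tangent maps of the transition maps: a point is an equivalence class of
  pairs (chart, coordinates).
\<close>

type_synonym ('m, 'v, 'k) jet = "(('m, 'v, 'k) chart \<times> ('v, 'k) elt) set"

definition Tk_pre :: "nat \<Rightarrow> ('m, 'v, 'k) manifold \<Rightarrow> (('m, 'v, 'k) chart \<times> ('v, 'k) elt) set" where
  "Tk_pre k M = {(c, u). c \<in> atlas M \<and> u \<in> Tk_set k (model M) (cimage c)}"

definition Tk_rel :: "('k::hausdorff_ring \<Rightarrow> 'v::{topological_ab_group_add, t2_space} \<Rightarrow> 'v) \<Rightarrow>
    nat \<Rightarrow> ('m, 'v, 'k) manifold \<Rightarrow>
    ((('m, 'v, 'k) chart \<times> ('v, 'k) elt) \<times> (('m, 'v, 'k) chart \<times> ('v, 'k) elt)) set" where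
  "Tk_rel sc k M =
     {((c, u), (d, w)) | c u d w. c \<in> atlas M \<and> d \<in> atlas M \<and>
        u \<in> Tk_set k (model M) (rep_dom c d id) \<and>
        w = Tk_map k sc (model M) (model M) (rep_dom c d id) (rep c d id) u}"

definition Tk_bundle :: "('k::hausdorff_ring \<Rightarrow> 'v::{topological_ab_group_add, t2_space} \<Rightarrow> 'v) \<Rightarrow>
    nat \<Rightarrow> ('m, 'v, 'k) manifold \<Rightarrow> ('m, 'v, 'k) jet set" where
  "Tk_bundle sc k M = Tk_pre k M // Tk_rel sc k M"

definition Tk_class :: "('k::hausdorff_ring \<Rightarrow> 'v::{topological_ab_group_add, t2_space} \<Rightarrow> 'v) \<Rightarrow>
    nat \<Rightarrow> ('m, 'v, 'k) manifold \<Rightarrow> ('m, 'v, 'k) chart \<Rightarrow> ('v, 'k) elt \<Rightarrow> ('m, 'v, 'k) jet" where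
  "Tk_class sc k M c u = Tk_rel sc k M `` {(c, u)}"

definition coords :: "('m, 'v, 'k) chart \<Rightarrow> ('m, 'v, 'k) jet \<Rightarrow> ('v, 'k) elt" where
  "coords c \<xi> = (THE u. (c, u) \<in> \<xi>)"

definition foot :: "nat \<Rightarrow> ('m, 'v, 'k) jet \<Rightarrow> 'm" where
  "foot k \<xi> = (THE p. \<exists>(c, u)\<in>\<xi>. p = cinv c (Tk_foot k u))"

definition Tk_fun :: "('k::hausdorff_ring \<Rightarrow> 'v::{topological_ab_group_add, t2_space} \<Rightarrow> 'v) \<Rightarrow>
    nat \<Rightarrow> ('m, 'v, 'k) manifold \<Rightarrow> ('n, 'v, 'k) manifold \<Rightarrow> ('m \<Rightarrow> 'n) \<Rightarrow>
    ('m, 'v, 'k) jet \<Rightarrow> ('n, 'v, 'k) jet" where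
  "Tk_fun sc k M N f \<xi> =
     (let c = chart_at M (foot k \<xi>); d = chart_at N (f (foot k \<xi>)) in
        Tk_class sc k N d
          (Tk_map k sc (model M) (model N) (rep_dom c d f) (rep c d f) (coords c \<xi>)))"

text \<open>The identification $T^k M \times T^k N = T^k (M \times N)$.\<close>

definition Tk_pair :: "('k::hausdorff_ring \<Rightarrow> 'v::{topological_ab_group_add, t2_space} \<Rightarrow> 'v) \<Rightarrow>
    nat \<Rightarrow> ('m, 'v, 'k) manifold \<Rightarrow> ('n, 'v, 'k) manifold \<Rightarrow>
    ('m, 'v, 'k) jet \<Rightarrow> ('n, 'v, 'k) jet \<Rightarrow> ('m \<times> 'n, 'v, 'k) jet" where
  "Tk_pair sc k M N \<xi> \<eta> =
     (let c = chart_at M (foot k \<xi>); d = chart_at N (foot k \<eta>) in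
        Tk_class sc k (prod_manifold M N) (prod_chart c d) (Tk_zip k (coords c \<xi>) (coords d \<eta>)))"

text \<open>
  The bracket of vector fields at a point \<open>p\<close>, with \<open>X'\<close> and \<open>Y'\<close> the representations of \<open>X\<close> and
  \<open>Y\<close> in a chart: $[X,Y](x) = dX(x)Y(x) - dY(x)X(x)$.
\<close>

definition vf_bracket :: "('k::hausdorff_ring \<Rightarrow> 'v::{topological_ab_group_add, t2_space} \<Rightarrow> 'v) \<Rightarrow>
    ('m, 'v, 'k) manifold \<Rightarrow> ('m \<Rightarrow> ('m, 'v, 'k) jet) \<Rightarrow> ('m \<Rightarrow> ('m, 'v, 'k) jet) \<Rightarrow>
    'm \<Rightarrow> ('m, 'v, 'k) jet" where
  "vf_bracket sc M X Y p =
     (let c = chart_at M p; x = snd c p;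
          X' = (\<lambda>y. vsnd (coords c (X (cinv c y))));
          Y' = (\<lambda>y. vsnd (coords c (Y (cinv c y))))
      in Tk_class sc 1 M c
           (VPair x (vdiff sc
             (differential sc (model M) (model M) (cimage c) X' x (Y' x))
             (differential sc (model M) (model M) (cimage c) Y' x (X' x)))))"


section \<open>Lie groups and their Lie algebras\<close>

record ('g, 'v, 'k) lie_structure = "'g monoid" +
  mfd :: "('g, 'v, 'k) manifold"

definition lie_group :: "('k::hausdorff_ring \<Rightarrow> 'v::{topological_ab_group_add, t2_space} \<Rightarrow> 'v) \<Rightarrow>
    ('g, 'v, 'k) lie_structure \<Rightarrow> bool" where
  "lie_group sc G \<longleftrightarrow>
     topological_module sc \<and> group G \<and>
     smooth_manifold sc (mfd G) \<and> model (mfd G) = Model \<and> topspace (mtop (mfd G)) = carrier G \<and>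
     smooth_map sc (prod_manifold (mfd G) (mfd G)) (mfd G) (\<lambda>(x, y). x \<otimes>\<^bsub>G\<^esub> y) \<and>
     smooth_map sc (mfd G) (mfd G) (\<lambda>x. m_inv G x)"

definition unit_chart :: "('g, 'v, 'k) lie_structure \<Rightarrow> ('g, 'v, 'k) chart" where
  "unit_chart G = chart_at (mfd G) \<one>\<^bsub>G\<^esub>"

text \<open>
  A tangent vector at the unit is determined by its principal part \<open>v\<close> in the chart \<open>unit_chart G\<close>.
\<close>

definition tangent_at_unit :: "('k::hausdorff_ring \<Rightarrow> 'v::{topological_ab_group_add, t2_space} \<Rightarrow> 'v) \<Rightarrow>
    ('g, 'v, 'k) lie_structure \<Rightarrow> ('v, 'k) elt \<Rightarrow> ('g, 'v, 'k) jet" where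
  "tangent_at_unit sc G v =
     Tk_class sc 1 (mfd G) (unit_chart G) (VPair (snd (unit_chart G) \<one>\<^bsub>G\<^esub>) v)"

definition principal_part :: "('g, 'v, 'k) lie_structure \<Rightarrow> ('g, 'v, 'k) jet \<Rightarrow> ('v, 'k) elt" where
  "principal_part G \<xi> = vsnd (coords (unit_chart G) \<xi>)"

definition right_invariant :: "('k::hausdorff_ring \<Rightarrow> 'v::{topological_ab_group_add, t2_space} \<Rightarrow> 'v) \<Rightarrow>
    ('g, 'v, 'k) lie_structure \<Rightarrow> ('g, 'v, 'k) jet \<Rightarrow> 'g \<Rightarrow> ('g, 'v, 'k) jet" where
  "right_invariant sc G \<xi> g = Tk_fun sc 1 (mfd G) (mfd G) (\<lambda>h. h \<otimes>\<^bsub>G\<^esub> g) \<xi>"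

text \<open>
  The Lie algebra is a \<^emph>\<open>K\<close>-module whose multiplication slot holds the Lie bracket; the slot for a
  multiplicative unit is not used.
\<close>

definition lie_algebra :: "('k::hausdorff_ring \<Rightarrow> 'v::{topological_ab_group_add, t2_space} \<Rightarrow> 'v) \<Rightarrow>
    ('g, 'v, 'k) lie_structure \<Rightarrow> ('k, ('g, 'v, 'k) jet) module" where
  "lie_algebra sc G =
     \<lparr>carrier = {\<xi> \<in> Tk_bundle sc 1 (mfd G). foot 1 \<xi> = \<one>\<^bsub>G\<^esub>},
      mult = (\<lambda>\<xi> \<eta>. vf_bracket sc (mfd G)
                      (right_invariant sc G \<xi>) (right_invariant sc G \<eta>) \<one>\<^bsub>G\<^esub>),
      one = undefined,
      zero = tangent_at_unit sc G (vzero Model),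
      add = (\<lambda>\<xi> \<eta>. tangent_at_unit sc G (vadd (principal_part G \<xi>) (principal_part G \<eta>))),
      smult = (\<lambda>t \<xi>. tangent_at_unit sc G (vscale sc t (principal_part G \<xi>)))\<rparr>"


section \<open>The higher order tangent groups and their trivializations\<close>

definition Tk_group :: "('k::hausdorff_ring \<Rightarrow> 'v::{topological_ab_group_add, t2_space} \<Rightarrow> 'v) \<Rightarrow>
    nat \<Rightarrow> ('g, 'v, 'k) lie_structure \<Rightarrow> ('g, 'v, 'k) jet monoid" where
  "Tk_group sc k G =
     \<lparr>carrier = Tk_bundle sc k (mfd G),
      mult = (\<lambda>\<xi> \<eta>. Tk_fun sc k (prod_manifold (mfd G) (mfd G)) (mfd G) (\<lambda>(x, y). x \<otimes>\<^bsub>G\<^esub> y)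
                      (Tk_pair sc k (mfd G) (mfd G) \<xi> \<eta>)),
      one = Tk_class sc k (mfd G) (unit_chart G)
              (Tk_single Model k 0 (snd (unit_chart G) \<one>\<^bsub>G\<^esub>))\<rparr>"

definition unit_fiber :: "('k::hausdorff_ring \<Rightarrow> 'v::{topological_ab_group_add, t2_space} \<Rightarrow> 'v) \<Rightarrow>
    nat \<Rightarrow> ('g, 'v, 'k) lie_structure \<Rightarrow> ('g, 'v, 'k) jet monoid" where
  "unit_fiber sc k G =
     (Tk_group sc k G)\<lparr>carrier := {\<xi> \<in> Tk_bundle sc k (mfd G). foot k \<xi> = \<one>\<^bsub>G\<^esub>}\<rparr>"

text \<open>
  The element $\varepsilon^\alpha v$ of the fiber over the unit, for \<open>v\<close> in the Lie algebra. The
  chart need not map the unit to \<open>0\<close>, whence the summand \<open>Tk_single Model k 0 _\<close> for the base point.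
\<close>

definition eps :: "('k::hausdorff_ring \<Rightarrow> 'v::{topological_ab_group_add, t2_space} \<Rightarrow> 'v) \<Rightarrow>
    nat \<Rightarrow> ('g, 'v, 'k) lie_structure \<Rightarrow> nat \<Rightarrow> ('g, 'v, 'k) jet \<Rightarrow> ('g, 'v, 'k) jet" where
  "eps sc k G \<alpha> \<xi> =
     Tk_class sc k (mfd G) (unit_chart G)
       (vadd (Tk_single Model k 0 (snd (unit_chart G) \<one>\<^bsub>G\<^esub>))
             (Tk_single Model k \<alpha> (principal_part G \<xi>)))"

definition E_space :: "('k::hausdorff_ring \<Rightarrow> 'v::{topological_ab_group_add, t2_space} \<Rightarrow> 'v) \<Rightarrow>
    nat \<Rightarrow> ('g, 'v, 'k) lie_structure \<Rightarrow> (nat \<Rightarrow> ('g, 'v, 'k) jet) set" where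
  "E_space sc k G = {0<..<2 ^ k} \<rightarrow>\<^sub>E carrier (lie_algebra sc G)"

definition Psi_L :: "('k::hausdorff_ring \<Rightarrow> 'v::{topological_ab_group_add, t2_space} \<Rightarrow> 'v) \<Rightarrow>
    nat \<Rightarrow> ('g, 'v, 'k) lie_structure \<Rightarrow> (nat \<Rightarrow> ('g, 'v, 'k) jet) \<Rightarrow> ('g, 'v, 'k) jet" where
  "Psi_L sc k G v =
     foldr (mult (unit_fiber sc k G)) (map (\<lambda>\<alpha>. eps sc k G \<alpha> (v \<alpha>)) [1..<2 ^ k])
       \<one>\<^bsub>unit_fiber sc k G\<^esub>"

definition Psi_R :: "('k::hausdorff_ring \<Rightarrow> 'v::{topological_ab_group_add, t2_space} \<Rightarrow> 'v) \<Rightarrow>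
    nat \<Rightarrow> ('g, 'v, 'k) lie_structure \<Rightarrow> (nat \<Rightarrow> ('g, 'v, 'k) jet) \<Rightarrow> ('g, 'v, 'k) jet" where
  "Psi_R sc k G v =
     foldr (mult (unit_fiber sc k G)) (map (\<lambda>\<alpha>. eps sc k G \<alpha> (v \<alpha>)) (rev [1..<2 ^ k]))
       \<one>\<^bsub>unit_fiber sc k G\<^esub>"

text \<open>
  The trivializations are bijections from \<open>E_space\<close> onto the fiber over the unit, so that the
  operations are well-defined by the following descriptions.
\<close>

definition left_product :: "('k::hausdorff_ring \<Rightarrow> 'v::{topological_ab_group_add, t2_space} \<Rightarrow> 'v) \<Rightarrow>
    nat \<Rightarrow> ('g, 'v, 'k) lie_structure \<Rightarrow>
    (nat \<Rightarrow> ('g, 'v, 'k) jet) \<Rightarrow> (nat \<Rightarrow> ('g, 'v, 'k) jet) \<Rightarrow> (nat \<Rightarrow> ('g, 'v, 'k) jet)" where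
  "left_product sc k G v w =
     (THE z. z \<in> E_space sc k G \<and>
        Psi_L sc k G v \<otimes>\<^bsub>unit_fiber sc k G\<^esub> Psi_L sc k G w = Psi_L sc k G z)"

definition right_product :: "('k::hausdorff_ring \<Rightarrow> 'v::{topological_ab_group_add, t2_space} \<Rightarrow> 'v) \<Rightarrow>
    nat \<Rightarrow> ('g, 'v, 'k) lie_structure \<Rightarrow>
    (nat \<Rightarrow> ('g, 'v, 'k) jet) \<Rightarrow> (nat \<Rightarrow> ('g, 'v, 'k) jet) \<Rightarrow> (nat \<Rightarrow> ('g, 'v, 'k) jet)" where
  "right_product sc k G v w =
     (THE z. z \<in> E_space sc k G \<and>
        Psi_R sc k G v \<otimes>\<^bsub>unit_fiber sc k G\<^esub> Psi_R sc k G w = Psi_R sc k G z)"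

definition left_inversion :: "('k::hausdorff_ring \<Rightarrow> 'v::{topological_ab_group_add, t2_space} \<Rightarrow> 'v) \<Rightarrow>
    nat \<Rightarrow> ('g, 'v, 'k) lie_structure \<Rightarrow>
    (nat \<Rightarrow> ('g, 'v, 'k) jet) \<Rightarrow> (nat \<Rightarrow> ('g, 'v, 'k) jet)" where
  "left_inversion sc k G v =
     (THE z. z \<in> E_space sc k G \<and>
        m_inv (unit_fiber sc k G) (Psi_L sc k G v) = Psi_L sc k G z)"

end

theory Submission
  imports Defs
begin

text \<open>
  The fiber $(T^kG)_e$ is studied in the chart at the unit, where the multiplication of \<open>G\<close> is a
  smooth map $\mu$ on an open set of pairs, and where the fiber consists of the points
  $e + \sum_\alpha \varepsilon^\alpha v_\alpha$, multiplied by $T^k\mu$. Three facts about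
  $T^k\mu$ determine the operations.

  (1) The elements $\varepsilon^\alpha v$ satisfy
  $\varepsilon^\alpha v \cdot \varepsilon^\alpha w = \varepsilon^\alpha (v + w)$; if the supports of
  \<open>\<alpha>\<close> and \<open>\<beta>\<close> meet, then $\varepsilon^\alpha v$ and $\varepsilon^\beta w$ commute; and if the
  supports are disjoint, then
  $\varepsilon^\alpha v \cdot \varepsilon^\beta w =
  \varepsilon^\beta w \cdot \varepsilon^\alpha v \cdot \varepsilon^{\alpha+\beta} [v,w]$.
  This follows from the expansion
  $T^kf(x + \varepsilon^\alpha u + \varepsilon^\beta w + \varepsilon^{\alpha+\beta} z) =
  f(x) + \varepsilon^\alpha df(x)u + \varepsilon^\beta df(x)w +
  \varepsilon^{\alpha+\beta}(df(x)z + d^2f(x)(u,w))$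
  (\<open>Tk_map_jet_disjoint\<close>, and \<open>Tk_map_jet_meeting\<close> without the second order term). Applied to $\mu$, it
  gives $[v,w] = b(v,w) - b(w,v)$ for the mixed second differential $b$ of $\mu$ at the unit
  (\<open>fmul_single_exchange\<close>). The right invariant vector fields are $y \mapsto d\mu(e,y)(v,0)$, so
  that this is their bracket (\<open>L_bracket\<close>); the symmetry of second differentials
  (\<open>differential2_commute\<close>) is used on both sides.

  (2) The lowest non-zero component of an element is additive (\<open>leaf_fmul\<close>), since the differential
  of $\mu$ at the unit is the addition. Therefore an ordered product
  $\prod \varepsilon^\alpha v_\alpha$ determines its entries (\<open>ordered_prod_inj\<close>), and the trivializations
  are injective.

  (3) $T^k\mu$ is a group law on the fiber. This needs functoriality of $T^k$, that is, the chain rule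
  (\<open>Tk_map_comp\<close>), and the compatibility of $T^k$ with products of maps (\<open>Tk_map_VPair\<close>).

  The rest is a collection process in a group with these properties (the locale
  \<open>filtered_group\<close>). Multiplying an increasing product from the right by $\varepsilon^\beta y$
  replaces $v_\gamma$ by $v_\gamma + [v_{\gamma-\beta}, y]$ whenever \<open>\<beta>\<close> is contained in \<open>\<gamma>\<close> and smaller
  than its complement $\gamma - \beta$, and adds \<open>y\<close> to $v_\beta$ (\<open>ordered_prod_mult_right\<close>). No further
  commutators appear, because disjoint indices are ordered by their highest positions: the new factor
  $\varepsilon^{\alpha+\beta}[v_\alpha,y]$ with $\beta < \alpha$ commutes with all factors between \<open>\<alpha>\<close> and
  its place $\alpha + \beta$. Multiplication with $\varepsilon^1 w_1, \varepsilon^2 w_2, \dots$ in this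
  order builds up the sum over partitions of the left product, with the smallest member of the
  partition in the innermost bracket. The inverse of $\prod^\uparrow \varepsilon^\alpha v_\alpha$ is
  $\prod^\downarrow \varepsilon^\alpha (-v_\alpha)$; collecting it builds up the partitions from the
  largest member downwards. The right product is the left product of the opposite group.
\<close>

section \<open>The topology of the points\<close>

lemma points_iff [simp]: "p \<in> points s \<longleftrightarrow> shape_of p = s"
  by (simp add: points_def)

lemma open_basic: "basic_open A \<Longrightarrow> open A"
  by (simp add: open_elt_def generate_topology.Basis)

lemma basic_open_disjoint: "A \<inter> B = {} \<Longrightarrow> basic_open (A \<inter> B)"
  using basic_open.intros(1)[OF open_empty] by simp

lemma basic_open_Int: "basic_open A \<Longrightarrow> basic_open B \<Longrightarrow> basic_open (A \<inter> B)"
proof (induction A arbitrary: B rule: basic_open.induct)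
  case (1 S)
  from 1(2) show ?case
  proof cases
    case (1 S')
    then have "Vec ` S \<inter> B = Vec ` (S \<inter> S')" by auto
    then show ?thesis using basic_open.intros(1)[OF open_Int] \<open>open S\<close> \<open>open S'\<close> by metis
  qed (rule basic_open_disjoint, force)+
next
  case (2 S)
  from 2(2) show ?case
  proof cases
    case (2 S')
    then have "Scal ` S \<inter> B = Scal ` (S \<inter> S')" by auto
    then show ?thesis using basic_open.intros(2)[OF open_Int] \<open>open S\<close> \<open>open S'\<close> by metis
  qed (rule basic_open_disjoint, force)+
next
  case (3 A1 A2)
  let ?P = "\<lambda>X Y. (\<lambda>(p, q). VPair p q) ` (X \<times> Y)"
  from 3(5) show ?case
  proof cases
    case B: (3 A' B')
    then have *: "?P A1 A2 \<inter> B = ?P (A1 \<inter> A') (A2 \<inter> B')" by auto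
    show ?thesis unfolding * using 3 B by (intro basic_open.intros) auto
  qed (rule basic_open_disjoint, force)+
qed

lemma basic_open_points: "basic_open (points s)"
proof (induction s)
  case Model
  have *: "points Model = Vec ` UNIV" by (auto simp: points_def image_iff) (metis shape_of.simps shape.distinct elt.exhaust)
  show ?case unfolding * by (simp add: basic_open.intros)
next
  case Base
  have *: "points Base = Scal ` UNIV" by (auto simp: points_def image_iff) (metis shape_of.simps shape.distinct elt.exhaust)
  show ?case unfolding * by (simp add: basic_open.intros)
next
  case (Prod s1 s2)
  have *: "points (Prod s1 s2) = (\<lambda>(p, q). VPair p q) ` (points s1 \<times> points s2)"
    apply (auto simp: points_def image_iff)
    subgoal for x by (cases x) auto
    done
  show ?case unfolding * by (intro basic_open.intros Prod)
qed

lemma open_points [simp]: "open (points s)"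
  by (simp add: open_basic basic_open_points)

text \<open>Basic sets of different shapes are disjoint, so the basic sets form a basis, not only a
  subbasis.\<close>

lemma open_elt_basis:
  fixes S :: "('a::topological_space, 'b::topological_space) elt set"
  assumes "open S" "x \<in> S"
  shows "\<exists>B. basic_open B \<and> x \<in> B \<and> B \<subseteq> S"
proof -
  have "generate_topology (Collect basic_open) S" using assms(1) by (simp add: open_elt_def)
  then show ?thesis using assms(2)
  proof (induction arbitrary: x)
    case UNIV
    show ?case using basic_open_points[of "shape_of x"] by (intro exI[of _ "points (shape_of x)"]) auto
  next
    case (Int a b)
    then obtain A B where "basic_open A" "x \<in> A" "A \<subseteq> a" "basic_open B" "x \<in> B" "B \<subseteq> b" by (metis IntE)
    then show ?case using basic_open_Int[of A B] by blast
  next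
    case (UN K)
    then show ?case by blast
  next
    case (Basis s)
    then show ?case by blast
  qed
qed

lemma open_VPair_image:
  assumes "open A" "open B"
  shows "open {VPair p q | p q. p \<in> A \<and> q \<in> B}"
proof (rule topological_space_class.openI)
  fix x assume "x \<in> {VPair p q | p q. p \<in> A \<and> q \<in> B}"
  then obtain p q where x: "x = VPair p q" "p \<in> A" "q \<in> B" by blast
  obtain A' B' where A': "basic_open A'" "p \<in> A'" "A' \<subseteq> A" and B': "basic_open B'" "q \<in> B'" "B' \<subseteq> B"
    using open_elt_basis[OF assms(1) x(2)] open_elt_basis[OF assms(2) x(3)] by auto
  show "\<exists>T. open T \<and> x \<in> T \<and> T \<subseteq> {VPair p q | p q. p \<in> A \<and> q \<in> B}"
    using A' B' x open_basic[OF basic_open.intros(3)[OF A'(1) B'(1)]]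
    by (intro exI[of _ "(\<lambda>(p, q). VPair p q) ` (A' \<times> B')"]) auto
qed

lemma tendsto_Vec:
  fixes a :: "'a::topological_space"
  assumes f: "(f \<longlongrightarrow> a) F" shows "((\<lambda>x. Vec (f x) :: ('a, 'b::topological_space) elt) \<longlongrightarrow> Vec a) F"
proof (rule topological_tendstoI)
  fix S :: "('a, 'b) elt set" assume S: "open S" "Vec a \<in> S"
  obtain B where B: "basic_open B" "Vec a \<in> B" "B \<subseteq> S" using open_elt_basis[OF S] by auto
  from B(1) obtain S' where "open S'" "B = Vec ` S'" using B(2) by cases auto
  then have "\<forall>\<^sub>F x in F. f x \<in> S'" using B topological_tendstoD[OF f, of S'] by auto
  then show "\<forall>\<^sub>F x in F. Vec (f x) \<in> S"
    by eventually_elim (use B \<open>B = Vec ` S'\<close> in blast)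
qed

lemma tendsto_Scal:
  fixes a :: "'b::topological_space"
  assumes f: "(f \<longlongrightarrow> a) F" shows "((\<lambda>x. Scal (f x) :: ('a::topological_space, 'b) elt) \<longlongrightarrow> Scal a) F"
proof (rule topological_tendstoI)
  fix S :: "('a, 'b) elt set" assume S: "open S" "Scal a \<in> S"
  obtain B where B: "basic_open B" "Scal a \<in> B" "B \<subseteq> S" using open_elt_basis[OF S] by auto
  from B(1) obtain S' where "open S'" "B = Scal ` S'" using B(2) by cases auto
  then have "\<forall>\<^sub>F x in F. f x \<in> S'" using B topological_tendstoD[OF f, of S'] by auto
  then show "\<forall>\<^sub>F x in F. Scal (f x) \<in> S"
    by eventually_elim (use B \<open>B = Scal ` S'\<close> in blast)
qed

lemma tendsto_VPair:
  assumes f: "(f \<longlongrightarrow> a) F" and g: "(g \<longlongrightarrow> b) F"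
  shows "((\<lambda>x. VPair (f x) (g x)) \<longlongrightarrow> VPair a b) F"
proof (rule topological_tendstoI)
  fix S assume S: "open S" "VPair a b \<in> S"
  obtain B where B: "basic_open B" "VPair a b \<in> B" "B \<subseteq> S" using open_elt_basis[OF S] by auto
  from B(1) obtain A' B' where AB: "basic_open A'" "basic_open B'" "B = (\<lambda>(p, q). VPair p q) ` (A' \<times> B')"
    using B(2) by cases auto
  have "a \<in> A'" "b \<in> B'" using AB B by auto
  then have "\<forall>\<^sub>F x in F. f x \<in> A'" "\<forall>\<^sub>F x in F. g x \<in> B'"
    using topological_tendstoD[OF f] topological_tendstoD[OF g] AB open_basic by blast+
  then show "\<forall>\<^sub>F x in F. VPair (f x) (g x) \<in> S"
    by eventually_elim (use AB B in auto)
qed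

lemma tendsto_vfst:
  fixes a b :: "('a::topological_space, 'b::topological_space) elt"
  assumes f: "(f \<longlongrightarrow> VPair a b) F" shows "((\<lambda>x. vfst (f x)) \<longlongrightarrow> a) F"
proof (rule topological_tendstoI)
  fix S :: "('a, 'b) elt set" assume S: "open S" "a \<in> S"
  have "\<forall>\<^sub>F x in F. f x \<in> {VPair p q | p q. p \<in> S \<and> q \<in> UNIV}"
    using S by (intro topological_tendstoD[OF f] open_VPair_image) auto
  then show "\<forall>\<^sub>F x in F. vfst (f x) \<in> S" by eventually_elim auto
qed

lemma tendsto_vsnd:
  fixes a b :: "('a::topological_space, 'b::topological_space) elt"
  assumes f: "(f \<longlongrightarrow> VPair a b) F" shows "((\<lambda>x. vsnd (f x)) \<longlongrightarrow> b) F"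
proof (rule topological_tendstoI)
  fix S :: "('a, 'b) elt set" assume S: "open S" "b \<in> S"
  have "\<forall>\<^sub>F x in F. f x \<in> {VPair p q | p q. p \<in> UNIV \<and> q \<in> S}"
    using S by (intro topological_tendstoD[OF f] open_VPair_image) auto
  then show "\<forall>\<^sub>F x in F. vsnd (f x) \<in> S" by eventually_elim auto
qed

lemma tendsto_vec:
  fixes a :: "'a::topological_space"
  assumes f: "(f \<longlongrightarrow> (Vec a :: ('a, 'b::topological_space) elt)) F" shows "((\<lambda>x. vec (f x)) \<longlongrightarrow> a) F"
proof (rule topological_tendstoI)
  fix S :: "'a set" assume S: "open S" "a \<in> S"
  have "\<forall>\<^sub>F x in F. f x \<in> Vec ` S"
    using S by (intro topological_tendstoD[OF f] open_basic basic_open.intros) auto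
  then show "\<forall>\<^sub>F x in F. vec (f x) \<in> S" by eventually_elim auto
qed

lemma tendsto_scal:
  fixes a :: "'b::topological_space"
  assumes f: "(f \<longlongrightarrow> (Scal a :: ('a::topological_space, 'b) elt)) F" shows "((\<lambda>x. scal (f x)) \<longlongrightarrow> a) F"
proof (rule topological_tendstoI)
  fix S :: "'b set" assume S: "open S" "a \<in> S"
  have "\<forall>\<^sub>F x in F. f x \<in> Scal ` S"
    using S by (intro topological_tendstoD[OF f] open_basic basic_open.intros) auto
  then show "\<forall>\<^sub>F x in F. scal (f x) \<in> S" by eventually_elim auto
qed

lemma eventually_shape:
  assumes "(f \<longlongrightarrow> a) F" shows "\<forall>\<^sub>F x in F. shape_of (f x) = shape_of a"
  using topological_tendstoD[OF assms open_points[of "shape_of a"]] by simp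

lemma elt_cases_shape:
  "shape_of p = Model \<Longrightarrow> \<exists>x. p = Vec x"
  "shape_of p = Base \<Longrightarrow> \<exists>t. p = Scal t"
  "shape_of p = Prod s s' \<Longrightarrow> \<exists>q r. p = VPair q r \<and> shape_of q = s \<and> shape_of r = s'"
  by (cases p; auto)+

lemma separation_elt:
  fixes a b :: "('a::t2_space, 'b::t2_space) elt"
  assumes "a \<noteq> b"
  shows "\<exists>U V. open U \<and> open V \<and> a \<in> U \<and> b \<in> V \<and> U \<inter> V = {}"
proof (cases "shape_of a = shape_of b")
  case False
  then show ?thesis
    by (intro exI[of _ "points (shape_of a)"] exI[of _ "points (shape_of b)"]) (auto simp: disjoint_iff)
next
  case True
  then show ?thesis using assms
  proof (induction a arbitrary: b)
    case (Vec x)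
    then obtain y where y: "b = Vec y" "x \<noteq> y" by (metis elt_cases_shape(1) shape_of.simps(1))
    then obtain U V where "open U" "open V" "x \<in> U" "y \<in> V" "U \<inter> V = {}" using hausdorff by metis
    then show ?case
      using y by (intro exI[of _ "Vec ` U"] exI[of _ "Vec ` V"]) (auto intro!: open_basic basic_open.intros)
  next
    case (Scal x)
    then obtain y where y: "b = Scal y" "x \<noteq> y" by (metis elt_cases_shape(2) shape_of.simps(2))
    then obtain U V where "open U" "open V" "x \<in> U" "y \<in> V" "U \<inter> V = {}" using hausdorff by metis
    then show ?case
      using y by (intro exI[of _ "Scal ` U"] exI[of _ "Scal ` V"]) (auto intro!: open_basic basic_open.intros)
  next
    case (VPair a1 a2)
    then obtain b1 b2 where b: "b = VPair b1 b2" "shape_of b1 = shape_of a1" "shape_of b2 = shape_of a2"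
      by (metis elt_cases_shape(3) shape_of.simps(3))
    have UN: "open (UNIV :: ('a, 'b) elt set)" by simp
    show ?case
    proof (cases "a1 = b1")
      case True
      with VPair b obtain U V where UV: "open U" "open V" "a2 \<in> U" "b2 \<in> V" "U \<inter> V = {}" by metis
      show ?thesis
        using b UV open_VPair_image[OF UN UV(1)] open_VPair_image[OF UN UV(2)]
        by (intro exI[of _ "{VPair p q | p q. p \<in> UNIV \<and> q \<in> U}"]
                  exI[of _ "{VPair p q | p q. p \<in> UNIV \<and> q \<in> V}"]) auto
    next
      case False
      with VPair b obtain U V where UV: "open U" "open V" "a1 \<in> U" "b1 \<in> V" "U \<inter> V = {}" by metis
      show ?thesis
        using b UV open_VPair_image[OF UV(1) UN] open_VPair_image[OF UV(2) UN]
        by (intro exI[of _ "{VPair p q | p q. p \<in> U \<and> q \<in> UNIV}"]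
                  exI[of _ "{VPair p q | p q. p \<in> V \<and> q \<in> UNIV}"]) auto
    qed
  qed
qed

instance elt :: (t2_space, t2_space) t2_space
  by standard (rule separation_elt)

lemma tendsto_vadd:
  fixes a b :: "('a::topological_ab_group_add, 'b::hausdorff_ring) elt"
  assumes "(f \<longlongrightarrow> a) F" "(g \<longlongrightarrow> b) F" "shape_of a = shape_of b"
  shows "((\<lambda>x. vadd (f x) (g x)) \<longlongrightarrow> vadd a b) F"
  using assms
proof (induction a arbitrary: b f g)
  case (Vec x)
  then obtain y where y: "b = Vec y" by (metis elt_cases_shape(1) shape_of.simps(1))
  have "((\<lambda>x. Vec (vec (f x) + vec (g x)) :: ('a, 'b) elt) \<longlongrightarrow> Vec (x + y)) F"
    using Vec y by (intro tendsto_Vec tendsto_add tendsto_vec) auto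
  moreover have "\<forall>\<^sub>F x in F. Vec (vec (f x) + vec (g x)) = vadd (f x) (g x)"
    using eventually_shape[OF Vec(1)] eventually_shape[OF Vec(2)]
    by eventually_elim (use y in \<open>auto dest!: elt_cases_shape(1)\<close>)
  ultimately show ?case using y tendsto_cong by force
next
  case (Scal x)
  then obtain y where y: "b = Scal y" by (metis elt_cases_shape(2) shape_of.simps(2))
  have "((\<lambda>x. Scal (scal (f x) + scal (g x)) :: ('a, 'b) elt) \<longlongrightarrow> Scal (x + y)) F"
    using Scal y by (intro tendsto_Scal tendsto_add tendsto_scal) auto
  moreover have "\<forall>\<^sub>F x in F. Scal (scal (f x) + scal (g x)) = vadd (f x) (g x)"
    using eventually_shape[OF Scal(1)] eventually_shape[OF Scal(2)]
    by eventually_elim (use y in \<open>auto dest!: elt_cases_shape(2)\<close>)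
  ultimately show ?case using y tendsto_cong by force
next
  case (VPair a1 a2)
  then obtain b1 b2 where y: "b = VPair b1 b2" "shape_of b1 = shape_of a1" "shape_of b2 = shape_of a2"
    by (metis elt_cases_shape(3) shape_of.simps(3))
  have "((\<lambda>x. VPair (vadd (vfst (f x)) (vfst (g x))) (vadd (vsnd (f x)) (vsnd (g x))))
          \<longlongrightarrow> VPair (vadd a1 b1) (vadd a2 b2)) F"
    using VPair.prems y
    by (intro tendsto_VPair VPair.IH) (auto intro: tendsto_vfst tendsto_vsnd)
  moreover have "\<forall>\<^sub>F x in F. VPair (vadd (vfst (f x)) (vfst (g x))) (vadd (vsnd (f x)) (vsnd (g x)))
       = vadd (f x) (g x)"
    using eventually_shape[OF VPair.prems(1)] eventually_shape[OF VPair.prems(2)]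
    by eventually_elim (use y in \<open>auto dest!: elt_cases_shape(3)\<close>)
  ultimately show ?case using y tendsto_cong by force
qed


section \<open>Linear algebra of points\<close>

notation vadd (infixl "+\<^sub>v" 65)

lemma shape_vadd [simp]: "shape_of q = shape_of p \<Longrightarrow> shape_of (p +\<^sub>v q) = shape_of p"
  by (induction p q rule: vadd.induct) auto

lemma shape_vscale [simp]: "shape_of (vscale sc t p) = shape_of p"
  by (induction p) auto

lemma shape_vzero [simp]: "shape_of (vzero s) = s"
  by (induction s) auto

lemma vadd_commute:
  fixes p q :: "('v::ab_semigroup_add, 'k::ab_semigroup_add) elt"
  shows "shape_of p = shape_of q \<Longrightarrow> p +\<^sub>v q = q +\<^sub>v p"
  by (induction p q rule: vadd.induct) (auto simp: add.commute)

lemma vadd_assoc: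
  fixes p q r :: "('v::ab_semigroup_add, 'k::ab_semigroup_add) elt"
  shows "shape_of p = shape_of q \<Longrightarrow> shape_of q = shape_of r \<Longrightarrow> (p +\<^sub>v q) +\<^sub>v r = p +\<^sub>v (q +\<^sub>v r)"
proof (induction p arbitrary: q r)
  case (Vec x)
  then show ?case by (cases q; cases r) (auto simp: add.assoc)
next
  case (Scal x)
  then show ?case by (cases q; cases r) (auto simp: add.assoc)
next
  case (VPair p1 p2)
  then show ?case by (cases q; cases r) auto
qed

lemma vadd_left_commute:
  fixes p q r :: "('v::ab_semigroup_add, 'k::ab_semigroup_add) elt"
  assumes "shape_of p = shape_of q" "shape_of q = shape_of r"
  shows "p +\<^sub>v (q +\<^sub>v r) = q +\<^sub>v (p +\<^sub>v r)"
  by (metis assms vadd_assoc vadd_commute)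

lemmas vadd_ac = vadd_assoc vadd_commute vadd_left_commute

lemma vadd_0 [simp]:
  fixes p :: "('v::comm_monoid_add, 'k::comm_monoid_add) elt"
  shows "shape_of p = s \<Longrightarrow> p +\<^sub>v vzero s = p" "shape_of p = s \<Longrightarrow> vzero s +\<^sub>v p = p"
  by (induction p arbitrary: s) auto

lemma vadd_left_cancel [simp]:
  fixes p q r :: "('v::cancel_ab_semigroup_add, 'k::cancel_ab_semigroup_add) elt"
  assumes "shape_of p = shape_of q" "shape_of q = shape_of r"
  shows "p +\<^sub>v q = p +\<^sub>v r \<longleftrightarrow> q = r"
  using assms
proof (induction p arbitrary: q r)
  case (Vec x)
  then show ?case by (cases q; cases r) auto
next
  case (Scal x)
  then show ?case by (cases q; cases r) auto
next
  case (VPair p1 p2)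
  then show ?case by (cases q; cases r) auto
qed

locale good_module =
  fixes sc :: "'k::hausdorff_ring \<Rightarrow> 'v::{topological_ab_group_add, t2_space} \<Rightarrow> 'v"
  assumes topmod: "topological_module sc"
    and good: "good_base_ring TYPE('k)"
begin

abbreviation scale (infixr "*\<^sub>v" 75) where "t *\<^sub>v p \<equiv> vscale sc t p"

lemma sc_module: "Modules.module sc"
  using topmod by (simp add: topological_module_def)

lemma sc_simps:
  "sc t (x + y) = sc t x + sc t y" "sc (r + t) x = sc r x + sc t x"
  "sc r (sc t x) = sc (r * t) x" "sc 1 x = x" "sc 0 x = 0" "sc t 0 = 0" "sc (- t) x = - sc t x"
  using sc_module module.scale_right_distrib module.scale_left_distrib module.scale_scale
    module.scale_one module.scale_zero_left module.scale_zero_right module.scale_minus_left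
  by metis+

lemma vscale_vadd: "shape_of p = shape_of q \<Longrightarrow> t *\<^sub>v (p +\<^sub>v q) = t *\<^sub>v p +\<^sub>v t *\<^sub>v q"
  by (induction p q rule: vadd.induct) (auto simp: sc_simps distrib_left)

lemma vscale_add: "(r + t) *\<^sub>v p = r *\<^sub>v p +\<^sub>v t *\<^sub>v p"
  by (induction p) (auto simp: sc_simps distrib_right)

lemma vscale_vscale: "r *\<^sub>v t *\<^sub>v p = (r * t) *\<^sub>v p"
  by (induction p) (auto simp: sc_simps mult.assoc)

lemma vscale_1 [simp]: "1 *\<^sub>v p = p"
  by (induction p) (auto simp: sc_simps)

lemma vscale_0 [simp]: "0 *\<^sub>v p = vzero (shape_of p)"
  by (induction p) (auto simp: sc_simps)

lemma vscale_vzero [simp]: "t *\<^sub>v vzero s = vzero s"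
  by (induction s) (auto simp: sc_simps)

lemma shape_vdiff [simp]: "shape_of q = shape_of p \<Longrightarrow> shape_of (vdiff sc p q) = shape_of p"
  by (simp add: vdiff_def)

lemma vadd_uminus: "p +\<^sub>v (- 1) *\<^sub>v p = vzero (shape_of p)"
  using vscale_add[of 1 "-1" p] by simp

lemma vdiff_eq_iff:
  assumes "shape_of p = shape_of q" "shape_of r = shape_of q"
  shows "vdiff sc p q = r \<longleftrightarrow> p = q +\<^sub>v r"
proof -
  have "q +\<^sub>v vdiff sc p q = p +\<^sub>v (q +\<^sub>v (- 1) *\<^sub>v q)"
    unfolding vdiff_def using assms by (simp add: vadd_left_commute)
  then have "q +\<^sub>v vdiff sc p q = p" using assms by (simp add: vadd_uminus)
  moreover have "q +\<^sub>v vdiff sc p q = q +\<^sub>v r \<longleftrightarrow> vdiff sc p q = r" using assms by simp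
  ultimately show ?thesis by metis
qed

lemma vscale_unit_cancel: "t dvd 1 \<Longrightarrow> t *\<^sub>v p = t *\<^sub>v q \<Longrightarrow> p = q"
  by (metis dvd_def mult.commute vscale_1 vscale_vscale)

lemma tendsto_vscale:
  assumes "(r \<longlongrightarrow> c) F" "(f \<longlongrightarrow> a) F"
  shows "((\<lambda>x. r x *\<^sub>v f x) \<longlongrightarrow> c *\<^sub>v a) F"
  using assms(2)
proof (induction a arbitrary: f)
  case (Vec a)
  have "isCont (\<lambda>(t, x). sc t x) (c, a)"
    using topmod by (simp add: topological_module_def continuous_on_eq_continuous_at)
  moreover have "((\<lambda>x. (r x, vec (f x))) \<longlongrightarrow> (c, a)) F"
    by (intro tendsto_Pair assms tendsto_vec Vec)
  ultimately have "((\<lambda>x. case (r x, vec (f x)) of (t, x) \<Rightarrow> sc t x) \<longlongrightarrow> (case (c, a) of (t, x) \<Rightarrow> sc t x)) F"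
    by (rule isCont_tendsto_compose)
  then have "((\<lambda>x. Vec (sc (r x) (vec (f x))) :: ('v, 'k) elt) \<longlongrightarrow> Vec (sc c a)) F"
    by (intro tendsto_Vec) simp
  moreover have "\<forall>\<^sub>F x in F. Vec (sc (r x) (vec (f x))) = r x *\<^sub>v f x"
    using eventually_shape[OF Vec] by eventually_elim (auto dest!: elt_cases_shape(1))
  ultimately show ?case using tendsto_cong by force
next
  case (Scal a)
  have "((\<lambda>x. Scal (r x * scal (f x)) :: ('v, 'k) elt) \<longlongrightarrow> Scal (c * a)) F"
    by (intro tendsto_Scal tendsto_mult assms tendsto_scal Scal)
  moreover have "\<forall>\<^sub>F x in F. Scal (r x * scal (f x)) = r x *\<^sub>v f x"
    using eventually_shape[OF Scal] by eventually_elim (auto dest!: elt_cases_shape(2))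
  ultimately show ?case using tendsto_cong by force
next
  case (VPair a1 a2)
  have "((\<lambda>x. VPair (r x *\<^sub>v vfst (f x)) (r x *\<^sub>v vsnd (f x))) \<longlongrightarrow> VPair (c *\<^sub>v a1) (c *\<^sub>v a2)) F"
    using VPair.prems by (intro tendsto_VPair VPair.IH) (auto intro: tendsto_vfst tendsto_vsnd)
  moreover have "\<forall>\<^sub>F x in F. VPair (r x *\<^sub>v vfst (f x)) (r x *\<^sub>v vsnd (f x)) = r x *\<^sub>v f x"
    using eventually_shape[OF VPair.prems] by eventually_elim (auto dest!: elt_cases_shape(3))
  ultimately show ?case using tendsto_cong by force
qed

lemma continuous_on_VPair [continuous_intros]:
  fixes f g :: "'z::topological_space \<Rightarrow> ('v, 'k) elt"
  shows "continuous_on S f \<Longrightarrow> continuous_on S g \<Longrightarrow> continuous_on S (\<lambda>x. VPair (f x) (g x))"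
  by (auto simp: continuous_on_def intro: tendsto_VPair)

lemma continuous_on_Scal [continuous_intros]:
  fixes f :: "'z::topological_space \<Rightarrow> 'k"
  shows "continuous_on S f \<Longrightarrow> continuous_on S (\<lambda>x. Scal (f x) :: ('v, 'k) elt)"
  by (auto simp: continuous_on_def intro: tendsto_Scal)

lemma continuous_on_vfst:
  fixes f :: "'z::topological_space \<Rightarrow> ('v, 'k) elt"
  assumes "continuous_on S f" "\<And>x. x \<in> S \<Longrightarrow> shape_of (f x) = Prod a b"
  shows "continuous_on S (\<lambda>x. vfst (f x))"
proof -
  have "f x = VPair (vfst (f x)) (vsnd (f x))" if "x \<in> S" for x
    using elt_cases_shape(3)[OF assms(2)[OF that]] by auto
  then show ?thesis using assms(1) by (auto simp: continuous_on_def) (metis tendsto_vfst)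
qed

lemma continuous_on_vsnd:
  fixes f :: "'z::topological_space \<Rightarrow> ('v, 'k) elt"
  assumes "continuous_on S f" "\<And>x. x \<in> S \<Longrightarrow> shape_of (f x) = Prod a b"
  shows "continuous_on S (\<lambda>x. vsnd (f x))"
proof -
  have "f x = VPair (vfst (f x)) (vsnd (f x))" if "x \<in> S" for x
    using elt_cases_shape(3)[OF assms(2)[OF that]] by auto
  then show ?thesis using assms(1) by (auto simp: continuous_on_def) (metis tendsto_vsnd)
qed

lemma continuous_on_scal:
  fixes f :: "'z::topological_space \<Rightarrow> ('v, 'k) elt"
  assumes "continuous_on S f" "\<And>x. x \<in> S \<Longrightarrow> shape_of (f x) = Base"
  shows "continuous_on S (\<lambda>x. scal (f x))"
proof -
  have "f x = Scal (scal (f x))" if "x \<in> S" for x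
    using elt_cases_shape(2)[OF assms(2)[OF that]] by auto
  then show ?thesis using assms(1) by (auto simp: continuous_on_def) (metis tendsto_scal)
qed

lemma continuous_on_vadd [continuous_intros]:
  fixes f g :: "'z::topological_space \<Rightarrow> ('v, 'k) elt"
  shows "continuous_on S f \<Longrightarrow> continuous_on S g \<Longrightarrow> (\<And>x. x \<in> S \<Longrightarrow> shape_of (f x) = shape_of (g x)) \<Longrightarrow>
    continuous_on S (\<lambda>x. f x +\<^sub>v g x)"
  by (auto simp: continuous_on_def intro: tendsto_vadd)

lemma continuous_on_vscale [continuous_intros]:
  fixes f :: "'z::topological_space \<Rightarrow> ('v, 'k) elt"
  shows "continuous_on S r \<Longrightarrow> continuous_on S f \<Longrightarrow> continuous_on S (\<lambda>x. r x *\<^sub>v f x)"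
  by (auto simp: continuous_on_def intro: tendsto_vscale)

lemma continuous_on_vdiff [continuous_intros]:
  fixes f g :: "'z::topological_space \<Rightarrow> ('v, 'k) elt"
  shows "continuous_on S f \<Longrightarrow> continuous_on S g \<Longrightarrow> (\<And>x. x \<in> S \<Longrightarrow> shape_of (f x) = shape_of (g x)) \<Longrightarrow>
    continuous_on S (\<lambda>x. vdiff sc (f x) (g x))"
  unfolding vdiff_def by (intro continuous_intros) auto

text \<open>This is where the density of the units enters: \<open>0\<close> is a limit of units, and limits in a
  Hausdorff space are unique.\<close>

lemma unit_limit:
  fixes f g :: "'k \<Rightarrow> 'z::t2_space"
  assumes T: "open T" "0 \<in> T" and f: "continuous_on T f" and g: "continuous_on T g"
    and eq: "\<And>t. t \<in> T \<Longrightarrow> t dvd 1 \<Longrightarrow> f t = g t"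
  shows "f 0 = g 0"
proof -
  define F where "F = inf (nhds (0::'k)) (principal {u. u dvd 1})"
  have "0 \<in> closure {u::'k. u dvd 1}" using good by (simp add: good_base_ring_def)
  have "F \<noteq> bot"
  proof
    assume "F = bot"
    then have "eventually (\<lambda>_. False) F" by simp
    then obtain S :: "'k set" where S: "open S" "0 \<in> S" "\<And>x. x \<in> S \<Longrightarrow> \<not> x dvd 1"
      by (auto simp: F_def eventually_inf_principal eventually_nhds)
    then have "S \<inter> {u. u dvd 1} = {}" by auto
    with S \<open>0 \<in> closure {u::'k. u dvd 1}\<close> show False
      using open_Int_closure_eq_empty[OF S(1)] by blast
  qed
  have lim: "(h \<longlongrightarrow> h 0) F" if "continuous_on T h" for h :: "'k \<Rightarrow> 'z"
  proof -
    have "isCont h 0" using that T continuous_on_eq_continuous_at by blast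
    then have "(h \<longlongrightarrow> h 0) (nhds 0)"
      by (simp add: isCont_def tendsto_at_iff_tendsto_nhds)
    then show ?thesis by (rule tendsto_mono[rotated]) (simp add: F_def)
  qed
  have "eventually (\<lambda>t. f t = g t) F"
    using T eq by (auto simp: F_def eventually_inf_principal eventually_nhds)
  then have "(g \<longlongrightarrow> f 0) F" using lim[OF f] tendsto_cong by metis
  then show ?thesis using tendsto_unique[OF \<open>F \<noteq> bot\<close>] lim[OF g] by blast
qed

section \<open>Difference quotients\<close>

lemma slope_dom_iff [simp]:
  "VPair x (VPair v (Scal t)) \<in> slope_dom sc s U \<longleftrightarrow> x \<in> U \<and> shape_of v = s \<and> x +\<^sub>v t *\<^sub>v v \<in> U"
  by (auto simp: slope_dom_def)

lemma slope_domE: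
  assumes "z \<in> slope_dom sc s U"
  obtains x v t where "z = VPair x (VPair v (Scal t))" "x \<in> U" "shape_of v = s" "x +\<^sub>v t *\<^sub>v v \<in> U"
  using assms by (auto simp: slope_dom_def)

lemma slope_dom_points: "U \<subseteq> points s \<Longrightarrow> slope_dom sc s U \<subseteq> points (Prod s (Prod s Base))"
  by (auto simp: slope_dom_def)

lemma slope_dom_mono: "U' \<subseteq> U \<Longrightarrow> slope_dom sc s U' \<subseteq> slope_dom sc s U"
  by (auto simp: slope_dom_def)

lemma open_preimage:
  assumes "open W" "continuous_on W h" "open U"
  shows "open {x \<in> W. h x \<in> U}"
proof -
  have "{x \<in> W. h x \<in> U} = h -` U \<inter> W" by auto
  then show ?thesis using assms continuous_on_open_vimage by metis
qed

lemma open_slope_dom: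
  assumes "U \<subseteq> points s" "open U"
  shows "open (slope_dom sc s U)"
proof -
  define W where "W = {VPair x y | x y. x \<in> U \<and> y \<in> points (Prod s Base)}"
  have W: "open W" unfolding W_def by (intro open_VPair_image assms open_points)
  have shapes: "z \<in> W \<Longrightarrow> shape_of z = Prod s (Prod s Base)" for z
    using assms by (auto simp: W_def)
  have shapes': "z \<in> W \<Longrightarrow> shape_of (vfst z) = s \<and> shape_of (vsnd z) = Prod s Base
     \<and> shape_of (vfst (vsnd z)) = s \<and> shape_of (vsnd (vsnd z)) = Base" for z
    using shapes[of z] by (auto dest!: elt_cases_shape(3))
  have "slope_dom sc s U = {z \<in> W. vfst z +\<^sub>v scal (vsnd (vsnd z)) *\<^sub>v vfst (vsnd z) \<in> U}"
    by (force simp: slope_dom_def W_def dest!: elt_cases_shape(2,3))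
  moreover have "continuous_on W (\<lambda>z. vfst z +\<^sub>v scal (vsnd (vsnd z)) *\<^sub>v vfst (vsnd z))"
    using shapes shapes'
    by (intro continuous_intros continuous_on_scal) (auto intro!: continuous_on_vfst continuous_on_vsnd continuous_on_id)
  ultimately show ?thesis using open_preimage[OF W _ assms(2)] by simp
qed

lemma open_line:
  assumes "U \<subseteq> points s" "open U" "x \<in> U" "shape_of v = s"
  shows "open {t. x +\<^sub>v t *\<^sub>v v \<in> U}"
proof -
  have "continuous_on UNIV (\<lambda>t. x +\<^sub>v t *\<^sub>v v)"
    using assms by (intro continuous_intros) auto
  from open_preimage[OF open_UNIV this assms(2)] show ?thesis by simp
qed

lemma is_slope_eq:
  assumes "is_slope sc s s' U f f1" "f \<in> U \<rightarrow> points s'" "x \<in> U" "shape_of v = s" "x +\<^sub>v t *\<^sub>v v \<in> U"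
  shows "f (x +\<^sub>v t *\<^sub>v v) = f x +\<^sub>v t *\<^sub>v f1 (VPair x (VPair v (Scal t)))"
proof -
  have "VPair x (VPair v (Scal t)) \<in> slope_dom sc s U" using assms by simp
  then have "shape_of (f1 (VPair x (VPair v (Scal t)))) = s'"
    and "vdiff sc (f (x +\<^sub>v t *\<^sub>v v)) (f x) = t *\<^sub>v f1 (VPair x (VPair v (Scal t)))"
    using assms unfolding is_slope_def points_def by blast+
  moreover have "shape_of (f x) = s'" "shape_of (f (x +\<^sub>v t *\<^sub>v v)) = s'"
    using assms(2,3,5) by (auto simp: Pi_iff)
  ultimately show ?thesis by (subst (asm) vdiff_eq_iff) auto
qed

lemma is_slopeI:
  assumes "continuous_on (slope_dom sc s U) f1" "\<And>z. z \<in> slope_dom sc s U \<Longrightarrow> shape_of (f1 z) = s'"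
    and "f \<in> U \<rightarrow> points s'"
    and "\<And>x v t. x \<in> U \<Longrightarrow> shape_of v = s \<Longrightarrow> x +\<^sub>v t *\<^sub>v v \<in> U \<Longrightarrow>
      f (x +\<^sub>v t *\<^sub>v v) = f x +\<^sub>v t *\<^sub>v f1 (VPair x (VPair v (Scal t)))"
  shows "is_slope sc s s' U f f1"
  unfolding is_slope_def
proof (intro conjI allI impI)
  fix x v t assume z: "VPair x (VPair v (Scal t)) \<in> slope_dom sc s U"
  then have "shape_of (f x) = s'" "shape_of (f (x +\<^sub>v t *\<^sub>v v)) = s'" using assms(3) by (auto simp: Pi_iff)
  with z assms(2)[OF z] assms(4)[of x v t]
  show "vdiff sc (f (x +\<^sub>v t *\<^sub>v v)) (f x) = t *\<^sub>v f1 (VPair x (VPair v (Scal t)))"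
    by (subst vdiff_eq_iff) auto
qed (use assms in auto)

lemma continuous_slope_line:
  assumes "is_slope sc s s' U f f1" "x \<in> U" "shape_of v = s"
  shows "continuous_on {t. x +\<^sub>v t *\<^sub>v v \<in> U} (\<lambda>t. f1 (VPair x (VPair v (Scal t))))"
proof (rule continuous_on_compose2[where t = "slope_dom sc s U" and g = f1])
  show "continuous_on (slope_dom sc s U) f1" using assms by (simp add: is_slope_def)
qed (use assms in \<open>auto intro!: continuous_intros\<close>)

text \<open>Division by units determines a slope at all units \<open>t\<close>, hence, by continuity, at \<open>t = 0\<close>.\<close>

lemma is_slope_zero_unique:
  assumes "is_slope sc s s' U f f1" "f \<in> U \<rightarrow> points s'" "U \<subseteq> points s" "open U" "x \<in> U" "shape_of v = s"
    and T: "open T" "0 \<in> T" "continuous_on T G"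
    and G: "\<And>t. t \<in> T \<Longrightarrow> x +\<^sub>v t *\<^sub>v v \<in> U \<Longrightarrow> shape_of (G t) = s' \<and> f (x +\<^sub>v t *\<^sub>v v) = f x +\<^sub>v t *\<^sub>v G t"
  shows "f1 (VPair x (VPair v (Scal 0))) = G 0"
proof -
  define T' where "T' = T \<inter> {t. x +\<^sub>v t *\<^sub>v v \<in> U}"
  have x: "x +\<^sub>v 0 *\<^sub>v v = x" "shape_of (f x) = s'" using assms by auto
  show ?thesis
  proof (rule unit_limit[where T = T' and f = "\<lambda>t. f1 (VPair x (VPair v (Scal t)))" and g = G])
    show "open T'" unfolding T'_def using T open_line assms by auto
    show "0 \<in> T'" using x T assms by (auto simp: T'_def)
    show "continuous_on T' (\<lambda>t. f1 (VPair x (VPair v (Scal t))))"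
      using continuous_slope_line[OF assms(1,5,6)] by (rule continuous_on_subset) (auto simp: T'_def)
    show "continuous_on T' G" using T(3) by (rule continuous_on_subset) (auto simp: T'_def)
    fix t assume t: "t \<in> T'" "t dvd 1"
    then have "VPair x (VPair v (Scal t)) \<in> slope_dom sc s U" using assms by (simp add: T'_def)
    then have sh: "shape_of (f1 (VPair x (VPair v (Scal t)))) = s'"
      using assms(1) unfolding is_slope_def points_def by blast
    have "f x +\<^sub>v t *\<^sub>v f1 (VPair x (VPair v (Scal t))) = f x +\<^sub>v t *\<^sub>v G t"
      using is_slope_eq[OF assms(1,2,5,6)] G t by (metis Int_iff T'_def mem_Collect_eq)
    moreover have "shape_of (G t) = s'" using G t by (auto simp: T'_def)
    ultimately have "t *\<^sub>v f1 (VPair x (VPair v (Scal t))) = t *\<^sub>v G t"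
      using x sh by (subst (asm) vadd_left_cancel) auto
    then show "f1 (VPair x (VPair v (Scal t))) = G t" using t vscale_unit_cancel by blast
  qed
qed

end

section \<open>Maps of class $C^j$\<close>

context good_module
begin

lemma C_onD:
  assumes "C_on j sc s s' U f"
  shows "U \<subseteq> points s" "open U" "f \<in> U \<rightarrow> points s'"
  using assms by (cases j; simp)+

lemma C_on_shape: "C_on j sc s s' U f \<Longrightarrow> x \<in> U \<Longrightarrow> shape_of (f x) = s'"
  using C_onD(3) by (fastforce simp: Pi_iff)

text \<open>Every \<open>y\<close> is $x + 1 \cdot (y - x)$, and therefore $f(y) = f(x) + f^{[1]}(x, y - x, 1)$.\<close>

lemma C_on_continuous:
  assumes "C_on j sc s s' U f"
  shows "continuous_on U f"
proof (cases j)
  case 0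
  then show ?thesis using assms by simp
next
  case (Suc i)
  with assms obtain f1 where f1: "is_slope sc s s' U f f1" by auto
  have f: "U \<subseteq> points s" "f \<in> U \<rightarrow> points s'" using C_onD[OF assms] by auto
  show ?thesis
  proof (cases "U = {}")
    case False
    then obtain x where x: "x \<in> U" by auto
    have sh: "y \<in> U \<Longrightarrow> shape_of y = s" for y using f by auto
    have eq: "x +\<^sub>v 1 *\<^sub>v vdiff sc y x = y" if "y \<in> U" for y
      using vdiff_eq_iff[of y x "vdiff sc y x"] sh[OF x] sh[OF that] by simp
    have z: "VPair x (VPair (vdiff sc y x) (Scal 1)) \<in> slope_dom sc s U" if "y \<in> U" for y
      using eq[OF that] sh[OF x] sh[OF that] x that by simp
    have "continuous_on U (\<lambda>y. f1 (VPair x (VPair (vdiff sc y x) (Scal 1))))"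
    proof (rule continuous_on_compose2[where t = "slope_dom sc s U" and g = f1])
      show "continuous_on (slope_dom sc s U) f1" using f1 by (simp add: is_slope_def)
    qed (use z sh x in \<open>auto intro!: continuous_intros\<close>)
    moreover have sh1: "shape_of (f1 (VPair x (VPair (vdiff sc y x) (Scal 1)))) = s'" if "y \<in> U" for y
      using f1 z[OF that] unfolding is_slope_def points_def by blast
    ultimately have "continuous_on U (\<lambda>y. f x +\<^sub>v f1 (VPair x (VPair (vdiff sc y x) (Scal 1))))"
      using f x by (intro continuous_intros) (auto simp: Pi_iff)
    moreover have "f y = f x +\<^sub>v f1 (VPair x (VPair (vdiff sc y x) (Scal 1)))" if "y \<in> U" for y
      using is_slope_eq[OF f1 f(2) x, of "vdiff sc y x" 1] eq[OF that] sh[OF x] sh[OF that] that by simp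
    ultimately show ?thesis using continuous_on_cong by force
  qed auto
qed

lemma C_on_Suc_imp: "C_on (Suc j) sc s s' U f \<Longrightarrow> C_on j sc s s' U f"
proof (induction j arbitrary: s U f)
  case 0
  then show ?case using C_on_continuous[OF 0] by simp
next
  case (Suc j)
  from Suc.prems obtain f1 where f1: "is_slope sc s s' U f f1"
    "C_on (Suc j) sc (Prod s (Prod s Base)) s' (slope_dom sc s U) f1"
    unfolding C_on.simps(2)[of "Suc j"] by blast
  show ?case using C_onD[OF Suc.prems] f1(1) Suc.IH[OF f1(2)]
    unfolding C_on.simps(2)[of j] by blast
qed

lemma C_on_cong:
  assumes "C_on j sc s s' U f" "\<And>x. x \<in> U \<Longrightarrow> f x = g x"
  shows "C_on j sc s s' U g"
proof -
  have *: "f \<in> U \<rightarrow> points s' \<longleftrightarrow> g \<in> U \<rightarrow> points s'" "continuous_on U f \<longleftrightarrow> continuous_on U g"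
    "is_slope sc s s' U f = is_slope sc s s' U g"
    using assms(2) by (auto simp: Pi_iff is_slope_def fun_eq_iff cong: continuous_on_cong)
  show ?thesis using assms(1) by (cases j) (simp_all add: *)
qed

lemma is_slope_subset:
  assumes "is_slope sc s s' U f f1" "U' \<subseteq> U"
  shows "is_slope sc s s' U' f f1"
  using assms slope_dom_mono[OF assms(2), of s]
  unfolding is_slope_def by (blast intro: continuous_on_subset)

lemma C_on_subset:
  "C_on j sc s s' U f \<Longrightarrow> U' \<subseteq> U \<Longrightarrow> open U' \<Longrightarrow> C_on j sc s s' U' f"
proof (induction j arbitrary: s U U' f)
  case 0
  then show ?case by (auto intro: continuous_on_subset)
next
  case (Suc j)
  then obtain f1 where f1: "is_slope sc s s' U f f1"
    "C_on j sc (Prod s (Prod s Base)) s' (slope_dom sc s U) f1"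
    by auto
  have U: "U' \<subseteq> points s" using C_onD(1)[OF Suc.prems(1)] Suc.prems(2) by auto
  have "C_on j sc (Prod s (Prod s Base)) s' (slope_dom sc s U') f1"
    using Suc.IH[OF f1(2)] slope_dom_mono[OF Suc.prems(2)] open_slope_dom[OF U] Suc.prems(3) by blast
  then show ?case
    using is_slope_subset[OF f1(1)] C_onD[OF Suc.prems(1)] Suc.prems by auto
qed

definition continuous_linear :: "shape \<Rightarrow> shape \<Rightarrow> (('v, 'k) elt \<Rightarrow> ('v, 'k) elt) \<Rightarrow> bool" where
  "continuous_linear s s' f \<longleftrightarrow> f \<in> points s \<rightarrow> points s' \<and> continuous_on (points s) f \<and>
     (\<forall>p q. shape_of p = s \<longrightarrow> shape_of q = s \<longrightarrow> f (p +\<^sub>v q) = f p +\<^sub>v f q) \<and>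
     (\<forall>t p. shape_of p = s \<longrightarrow> f (t *\<^sub>v p) = t *\<^sub>v f p)"

lemma continuous_linear_comp:
  assumes "continuous_linear s s' f" "continuous_linear s' s'' g"
  shows "continuous_linear s s'' (\<lambda>x. g (f x))"
proof -
  have "continuous_on (points s) (\<lambda>x. g (f x))"
    using assms by (auto simp: continuous_linear_def intro: continuous_on_compose2)
  then show ?thesis using assms by (auto simp: continuous_linear_def Pi_iff)
qed

lemma continuous_linear_id [simp]: "continuous_linear s s (\<lambda>x. x)"
  by (auto simp: continuous_linear_def)

lemma continuous_linear_vfst [simp]: "continuous_linear (Prod s s') s vfst"
  by (auto simp: continuous_linear_def dest!: elt_cases_shape(3) intro!: continuous_on_vfst continuous_on_id)

lemma continuous_linear_vsnd [simp]: "continuous_linear (Prod s s') s' vsnd"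
  by (auto simp: continuous_linear_def dest!: elt_cases_shape(3) intro!: continuous_on_vsnd continuous_on_id)

lemma continuous_linear_VPair:
  "continuous_linear s s' f \<Longrightarrow> continuous_linear s s'' g \<Longrightarrow>
     continuous_linear s (Prod s' s'') (\<lambda>x. VPair (f x) (g x))"
  by (auto simp: continuous_linear_def Pi_iff intro!: continuous_intros)

lemma continuous_linear_Scal_0: "continuous_linear s Base (\<lambda>_. Scal 0)"
  by (auto simp: continuous_linear_def)

text \<open>The slope of a linear map \<open>f\<close> at $(x,v,t)$ is \<open>f v\<close>, which is again linear
  in $(x,v,t)$; so the induction on the order of differentiability closes.\<close>

lemma C_on_linear:
  "continuous_linear s s' f \<Longrightarrow> U \<subseteq> points s \<Longrightarrow> open U \<Longrightarrow> C_on j sc s s' U f"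
proof (induction j arbitrary: s U f)
  case 0
  then show ?case by (auto simp: continuous_linear_def intro: continuous_on_subset)
next
  case (Suc j)
  define f1 where "f1 = (\<lambda>z. f (vfst (vsnd z)))"
  have lin1: "continuous_linear (Prod s (Prod s Base)) s' f1"
    unfolding f1_def
    by (rule continuous_linear_comp[OF continuous_linear_comp[OF continuous_linear_vsnd continuous_linear_vfst] Suc.prems(1)])
  have C1: "C_on j sc (Prod s (Prod s Base)) s' (slope_dom sc s U) f1"
    by (intro Suc.IH lin1 slope_dom_points open_slope_dom Suc.prems)
  have "is_slope sc s s' U f f1"
  proof (rule is_slopeI)
    show "continuous_on (slope_dom sc s U) f1" by (rule C_on_continuous[OF C1])
    show "f \<in> U \<rightarrow> points s'" using Suc.prems by (auto simp: continuous_linear_def)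
    fix x v :: "('v, 'k) elt" and t assume xv: "x \<in> U" "shape_of v = s"
    then have "shape_of x = s" using Suc.prems(2) by auto
    then show "f (x +\<^sub>v t *\<^sub>v v) = f x +\<^sub>v t *\<^sub>v f1 (VPair x (VPair v (Scal t)))"
      using Suc.prems(1) xv by (simp add: continuous_linear_def f1_def)
  qed (rule C_on_shape[OF C1])
  then show ?case using C1 Suc.prems by (auto simp: continuous_linear_def)
qed

lemma C_on_const:
  assumes "U \<subseteq> points s" "open U" "shape_of c = s'"
  shows "C_on j sc s s' U (\<lambda>_. c)"
  using assms
proof (induction j arbitrary: s U c)
  case 0
  then show ?case by auto
next
  case (Suc j)
  have "is_slope sc s s' U (\<lambda>_. c) (\<lambda>_. vzero s')"
    using Suc.prems by (intro is_slopeI) auto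
  moreover have "C_on j sc (Prod s (Prod s Base)) s' (slope_dom sc s U) (\<lambda>_. vzero s')"
    by (intro Suc.IH slope_dom_points open_slope_dom Suc.prems) simp
  ultimately show ?case using Suc.prems by auto
qed

lemma C_on_VPair:
  "C_on j sc s s' U f \<Longrightarrow> C_on j sc s s'' U g \<Longrightarrow> C_on j sc s (Prod s' s'') U (\<lambda>x. VPair (f x) (g x))"
proof (induction j arbitrary: s U f g)
  case 0
  then show ?case by (auto simp: Pi_iff intro!: continuous_intros)
next
  case (Suc j)
  then obtain f1 g1 where f1: "is_slope sc s s' U f f1"
    "C_on j sc (Prod s (Prod s Base)) s' (slope_dom sc s U) f1"
    and g1: "is_slope sc s s'' U g g1"
    "C_on j sc (Prod s (Prod s Base)) s'' (slope_dom sc s U) g1"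
    by auto
  have C1: "C_on j sc (Prod s (Prod s Base)) (Prod s' s'') (slope_dom sc s U) (\<lambda>x. VPair (f1 x) (g1 x))"
    by (rule Suc.IH[OF f1(2) g1(2)])
  have fg: "f \<in> U \<rightarrow> points s'" "g \<in> U \<rightarrow> points s''" using C_onD Suc.prems by blast+
  have "is_slope sc s (Prod s' s'') U (\<lambda>x. VPair (f x) (g x)) (\<lambda>x. VPair (f1 x) (g1 x))"
    using is_slope_eq[OF f1(1) fg(1)] is_slope_eq[OF g1(1) fg(2)] fg
    by (intro is_slopeI C_on_continuous[OF C1] C_on_shape[OF C1]) (auto simp: Pi_iff)
  then show ?case using C1 fg C_onD[OF Suc.prems(1)] by (auto simp: Pi_iff)
qed

lemma is_slope_comp:
  fixes f g :: "('v, 'k) elt \<Rightarrow> ('v, 'k) elt"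
  assumes f1: "is_slope sc s s' U f f1" "f \<in> U \<rightarrow> points s'" "U \<subseteq> points s"
    and g1: "is_slope sc s' s'' W g g1" "g \<in> W \<rightarrow> points s''"
    and fU: "f ` U \<subseteq> W" and z: "x \<in> U" "shape_of v = s" "x +\<^sub>v t *\<^sub>v v \<in> U"
  shows "VPair (f x) (VPair (f1 (VPair x (VPair v (Scal t)))) (Scal t)) \<in> slope_dom sc s' W"
    and "g (f (x +\<^sub>v t *\<^sub>v v)) = g (f x) +\<^sub>v
      t *\<^sub>v g1 (VPair (f x) (VPair (f1 (VPair x (VPair v (Scal t)))) (Scal t)))"
proof -
  have eq: "f (x +\<^sub>v t *\<^sub>v v) = f x +\<^sub>v t *\<^sub>v f1 (VPair x (VPair v (Scal t)))"
    by (rule is_slope_eq[OF f1(1,2) z])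
  have "VPair x (VPair v (Scal t)) \<in> slope_dom sc s U" using z by simp
  then have sh: "shape_of (f1 (VPair x (VPair v (Scal t)))) = s'"
    using f1(1) unfolding is_slope_def points_def by blast
  show "VPair (f x) (VPair (f1 (VPair x (VPair v (Scal t)))) (Scal t)) \<in> slope_dom sc s' W"
    using sh eq fU z by auto
  show "g (f (x +\<^sub>v t *\<^sub>v v)) = g (f x) +\<^sub>v
      t *\<^sub>v g1 (VPair (f x) (VPair (f1 (VPair x (VPair v (Scal t)))) (Scal t)))"
    unfolding eq
    by (rule is_slope_eq[OF g1 _ sh]) (use eq fU z in auto)
qed

text \<open>The slope of $g \circ f$ at $(x,v,t)$ is $g^{[1]}(f(x), f^{[1]}(x,v,t), t)$. This is itself a
  composition of maps of one order less, built from \<open>f\<close>, the two slopes and projections, so the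
  induction has to range over all shapes and domains.\<close>

lemma C_on_comp:
  "C_on j sc s s' U f \<Longrightarrow> C_on j sc s' s'' W g \<Longrightarrow> f ` U \<subseteq> W \<Longrightarrow> C_on j sc s s'' U (\<lambda>x. g (f x))"
proof (induction j arbitrary: s s' s'' U f W g)
  case 0
  then show ?case by (auto simp: Pi_iff intro: continuous_on_compose2)
next
  case (Suc j)
  then obtain f1 g1 where f1: "is_slope sc s s' U f f1"
    "C_on j sc (Prod s (Prod s Base)) s' (slope_dom sc s U) f1"
    and g1: "is_slope sc s' s'' W g g1"
    "C_on j sc (Prod s' (Prod s' Base)) s'' (slope_dom sc s' W) g1"
    by auto
  have fg: "U \<subseteq> points s" "open U" "f \<in> U \<rightarrow> points s'" "g \<in> W \<rightarrow> points s''"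
    using C_onD Suc.prems by blast+
  let ?S = "slope_dom sc s U"
  let ?P = "Prod s (Prod s Base)"
  note S = slope_dom_points[OF fg(1)] open_slope_dom[OF fg(1,2)]
  define h where "h = (\<lambda>z. VPair (f (vfst z)) (VPair (f1 z) (vsnd (vsnd z))))"
  have vfstS: "vfst ` ?S \<subseteq> U" by (auto simp: slope_dom_def)
  have "C_on j sc ?P s' ?S (\<lambda>z. f (vfst z))"
    by (rule Suc.IH[OF C_on_linear[OF continuous_linear_vfst] C_on_Suc_imp[OF Suc.prems(1)] vfstS])
      (use S in auto)
  moreover have "C_on j sc ?P Base ?S (\<lambda>z. vsnd (vsnd z))"
    by (rule C_on_linear[OF continuous_linear_comp[OF continuous_linear_vsnd continuous_linear_vsnd] S])
  ultimately have "C_on j sc ?P (Prod s' (Prod s' Base)) ?S h"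
    unfolding h_def using f1(2) by (intro C_on_VPair)
  moreover have "h ` ?S \<subseteq> slope_dom sc s' W"
  proof
    fix y assume "y \<in> h ` ?S"
    then obtain x v t where "y = VPair (f x) (VPair (f1 (VPair x (VPair v (Scal t)))) (Scal t))"
      "x \<in> U" "shape_of v = s" "x +\<^sub>v t *\<^sub>v v \<in> U"
      by (auto simp: h_def elim!: slope_domE)
    with is_slope_comp(1)[OF f1(1) fg(3,1) g1(1) fg(4) Suc.prems(3)]
    show "y \<in> slope_dom sc s' W" by simp
  qed
  ultimately have C1: "C_on j sc ?P s'' ?S (\<lambda>z. g1 (h z))"
    by (rule Suc.IH[OF _ g1(2)])
  have "is_slope sc s s'' U (\<lambda>x. g (f x)) (\<lambda>z. g1 (h z))"
  proof (rule is_slopeI)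
    show "(\<lambda>x. g (f x)) \<in> U \<rightarrow> points s''" using fg Suc.prems(3) by (auto simp: Pi_iff)
  qed (use is_slope_comp(2)[OF f1(1) fg(3,1) g1(1) fg(4) Suc.prems(3)] C_on_continuous[OF C1]
        C_on_shape[OF C1] in \<open>auto simp: h_def\<close>)
  then show ?case using C1 fg Suc.prems(3) by (auto simp: Pi_iff)
qed

section \<open>Smooth maps and their differentials\<close>

lemma smooth_onD:
  assumes "smooth_on sc s s' U f"
  shows "U \<subseteq> points s" "open U" "f \<in> U \<rightarrow> points s'" "continuous_on U f"
proof -
  have "C_on 0 sc s s' U f" using assms unfolding smooth_on_def by blast
  then show "U \<subseteq> points s" "open U" "f \<in> U \<rightarrow> points s'" "continuous_on U f"
    by (simp_all only: C_on.simps)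
qed

lemma smooth_on_shape: "smooth_on sc s s' U f \<Longrightarrow> x \<in> U \<Longrightarrow> shape_of (f x) = s'"
  using smooth_onD(3) by (fastforce simp: Pi_iff)

lemma smooth_on_dom_shape: "smooth_on sc s s' U f \<Longrightarrow> x \<in> U \<Longrightarrow> shape_of x = s"
  using smooth_onD(1) by fastforce

lemma smooth_on_subset: "smooth_on sc s s' U f \<Longrightarrow> U' \<subseteq> U \<Longrightarrow> open U' \<Longrightarrow> smooth_on sc s s' U' f"
  unfolding smooth_on_def using C_on_subset by blast

lemma smooth_on_cong: "smooth_on sc s s' U f \<Longrightarrow> (\<And>x. x \<in> U \<Longrightarrow> f x = g x) \<Longrightarrow> smooth_on sc s s' U g"
  unfolding smooth_on_def using C_on_cong by blast

lemma smooth_on_linear: "continuous_linear s s' f \<Longrightarrow> U \<subseteq> points s \<Longrightarrow> open U \<Longrightarrow> smooth_on sc s s' U f"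
  unfolding smooth_on_def using C_on_linear by blast

lemma smooth_on_const: "U \<subseteq> points s \<Longrightarrow> open U \<Longrightarrow> shape_of c = s' \<Longrightarrow> smooth_on sc s s' U (\<lambda>_. c)"
  unfolding smooth_on_def using C_on_const by blast

lemma smooth_on_VPair:
  "smooth_on sc s s' U f \<Longrightarrow> smooth_on sc s s'' U g \<Longrightarrow> smooth_on sc s (Prod s' s'') U (\<lambda>x. VPair (f x) (g x))"
  unfolding smooth_on_def using C_on_VPair by blast

lemma smooth_on_comp:
  assumes "smooth_on sc s s' U f" "smooth_on sc s' s'' W g" "f ` U \<subseteq> W"
  shows "smooth_on sc s s'' U (\<lambda>x. g (f x))"
proof (unfold smooth_on_def, rule allI)
  fix j
  have "C_on j sc s s' U f" "C_on j sc s' s'' W g" using assms(1,2) by (simp_all add: smooth_on_def)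
  then show "C_on j sc s s'' U (\<lambda>x. g (f x))" by (rule C_on_comp[OF _ _ assms(3)])
qed

lemma is_slope_slope:
  assumes "smooth_on sc s s' U f" shows "is_slope sc s s' U f (slope sc s s' U f)"
proof -
  have "C_on (Suc 0) sc s s' U f" using assms smooth_on_def by blast
  then obtain f1 where "is_slope sc s s' U f f1" by auto
  then show ?thesis unfolding slope_def by (rule someI[of "is_slope sc s s' U f"])
qed

lemma shape_differential:
  assumes "smooth_on sc s s' U f" "x \<in> U" "shape_of v = s"
  shows "shape_of (differential sc s s' U f x v) = s'"
proof -
  have "VPair x (VPair v (Scal 0)) \<in> slope_dom sc s U"
    using assms smooth_on_dom_shape[OF assms(1)] by simp
  then show ?thesis
    using is_slope_slope[OF assms(1)] unfolding is_slope_def differential_def points_def by blast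
qed

text \<open>All differentials below are computed by this principle: if $f(x+tv) = f(x) + t G(t)$ with
  \<open>G\<close> continuous, then $df(x)v = G(0)$. So the differential can be read off from the restriction of
  \<open>f\<close> to a line.\<close>

lemma differential_eqI:
  assumes "smooth_on sc s s' U f" "x \<in> U" "shape_of v = s"
    and "open T" "0 \<in> T" "continuous_on T G"
    and "\<And>t. t \<in> T \<Longrightarrow> x +\<^sub>v t *\<^sub>v v \<in> U \<Longrightarrow> shape_of (G t) = s' \<and> f (x +\<^sub>v t *\<^sub>v v) = f x +\<^sub>v t *\<^sub>v G t"
  shows "differential sc s s' U f x v = G 0"
  unfolding differential_def
  by (rule is_slope_zero_unique[OF is_slope_slope[OF assms(1)]]) (use assms smooth_onD[OF assms(1)] in auto)

text \<open>The differential does not depend on the slope chosen by \<open>slope\<close>.\<close>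

lemma differential_eq_slope:
  assumes "smooth_on sc s s' U f" "is_slope sc s s' U f f1" "x \<in> U" "shape_of v = s"
  shows "differential sc s s' U f x v = f1 (VPair x (VPair v (Scal 0)))"
proof (rule differential_eqI[OF assms(1,3,4), where T = "{t. x +\<^sub>v t *\<^sub>v v \<in> U}"])
  show "open {t. x +\<^sub>v t *\<^sub>v v \<in> U}" using open_line smooth_onD[OF assms(1)] assms by blast
  show "0 \<in> {t. x +\<^sub>v t *\<^sub>v v \<in> U}" using assms smooth_on_dom_shape[OF assms(1)] by simp
  show "continuous_on {t. x +\<^sub>v t *\<^sub>v v \<in> U} (\<lambda>t. f1 (VPair x (VPair v (Scal t))))"
    using continuous_slope_line assms by blast
  fix t assume t: "x +\<^sub>v t *\<^sub>v v \<in> U"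
  then have "VPair x (VPair v (Scal t)) \<in> slope_dom sc s U" using assms by simp
  then have "shape_of (f1 (VPair x (VPair v (Scal t)))) = s'"
    using assms(2) unfolding is_slope_def points_def by blast
  then show "shape_of (f1 (VPair x (VPair v (Scal t)))) = s' \<and>
      f (x +\<^sub>v t *\<^sub>v v) = f x +\<^sub>v t *\<^sub>v f1 (VPair x (VPair v (Scal t)))"
    using is_slope_eq[OF assms(2) smooth_onD(3)[OF assms(1)] assms(3,4) t] by simp
qed

lemma slope_line:
  assumes "smooth_on sc s s' U f" "x \<in> U" "shape_of v = s"
  defines "T \<equiv> {t. x +\<^sub>v t *\<^sub>v v \<in> U}"
  shows "\<exists>G. continuous_on T G \<and> G 0 = differential sc s s' U f x v \<and> open T \<and> 0 \<in> T \<and>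
     (\<forall>t\<in>T. shape_of (G t) = s' \<and> f (x +\<^sub>v t *\<^sub>v v) = f x +\<^sub>v t *\<^sub>v G t)"
proof (intro exI conjI ballI)
  let ?G = "\<lambda>t. slope sc s s' U f (VPair x (VPair v (Scal t)))"
  note sl = is_slope_slope[OF assms(1)]
  show "continuous_on T ?G" unfolding T_def by (rule continuous_slope_line[OF sl assms(2,3)])
  show "?G 0 = differential sc s s' U f x v" by (simp add: differential_def)
  show "open T" unfolding T_def using open_line smooth_onD[OF assms(1)] assms by blast
  show "0 \<in> T" using assms smooth_on_dom_shape[OF assms(1)] by (simp add: T_def)
  fix t assume t: "t \<in> T"
  show "f (x +\<^sub>v t *\<^sub>v v) = f x +\<^sub>v t *\<^sub>v ?G t"
    by (rule is_slope_eq[OF sl smooth_onD(3)[OF assms(1)] assms(2,3)]) (use t T_def in auto)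
  have "VPair x (VPair v (Scal t)) \<in> slope_dom sc s U" using assms t by (simp add: T_def)
  then show "shape_of (?G t) = s'" using sl unfolding is_slope_def points_def by blast
qed

lemma differential_local:
  assumes "smooth_on sc s s' U f" "smooth_on sc s s' U' g" "U' \<subseteq> U" "\<And>x. x \<in> U' \<Longrightarrow> f x = g x"
    and "x \<in> U'" "shape_of v = s"
  shows "differential sc s s' U f x v = differential sc s s' U' g x v"
proof -
  have "is_slope sc s s' U' f (slope sc s s' U f)"
    by (rule is_slope_subset[OF is_slope_slope[OF assms(1)] assms(3)])
  moreover have "is_slope sc s s' U' f = is_slope sc s s' U' g"
    using assms(4) by (auto simp: Pi_iff is_slope_def fun_eq_iff)
  ultimately show ?thesis
    using differential_eq_slope[OF assms(2) _ assms(5,6), of "slope sc s s' U f"]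
    by (simp add: differential_def)
qed

lemma differential_comp:
  assumes f: "smooth_on sc s s' U f" and g: "smooth_on sc s' s'' W g" and fU: "f ` U \<subseteq> W"
    and x: "x \<in> U" "shape_of v = s"
  shows "differential sc s s'' U (\<lambda>x. g (f x)) x v =
    differential sc s' s'' W g (f x) (differential sc s s' U f x v)"
proof -
  note f1 = is_slope_slope[OF f] and g1 = is_slope_slope[OF g]
  let ?f1 = "slope sc s s' U f" and ?g1 = "slope sc s' s'' W g"
  let ?T = "{t. x +\<^sub>v t *\<^sub>v v \<in> U}"
  let ?h = "\<lambda>t. VPair (f x) (VPair (?f1 (VPair x (VPair v (Scal t)))) (Scal t))"
  note comp = is_slope_comp[OF f1 smooth_onD(3,1)[OF f] g1 smooth_onD(3)[OF g] fU x]
  have "differential sc s s'' U (\<lambda>x. g (f x)) x v = ?g1 (?h 0)"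
  proof (rule differential_eqI[OF smooth_on_comp[OF f g fU] x, where T = ?T])
    show "open ?T" using open_line smooth_onD[OF f] x by blast
    show "0 \<in> ?T" using x smooth_on_dom_shape[OF f] by simp
    show "continuous_on ?T (\<lambda>t. ?g1 (?h t))"
    proof (rule continuous_on_compose2[where t = "slope_dom sc s' W" and g = ?g1])
      show "continuous_on (slope_dom sc s' W) ?g1" using g1 by (simp add: is_slope_def)
      show "continuous_on ?T ?h"
        by (intro continuous_intros continuous_slope_line[OF f1 x])
      show "?h ` ?T \<subseteq> slope_dom sc s' W" using comp(1) by blast
    qed
    fix t assume t: "x +\<^sub>v t *\<^sub>v v \<in> U"
    have "shape_of (?g1 (?h t)) = s''" using comp(1)[OF t] g1 unfolding is_slope_def points_def by blast
    then show "shape_of (?g1 (?h t)) = s'' \<and> g (f (x +\<^sub>v t *\<^sub>v v)) = g (f x) +\<^sub>v t *\<^sub>v ?g1 (?h t)"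
      using comp(2)[OF t] by blast
  qed
  then show ?thesis by (simp add: differential_def)
qed

lemma differential_linear:
  assumes "continuous_linear s s' f" "U \<subseteq> points s" "open U" "x \<in> U" "shape_of v = s"
  shows "differential sc s s' U f x v = f v"
  by (rule differential_eqI[OF smooth_on_linear[OF assms(1-3)] assms(4,5) open_UNIV UNIV_I continuous_on_const])
    (use assms in \<open>auto simp: continuous_linear_def Pi_iff\<close>)

lemma differential_const:
  assumes "U \<subseteq> points s" "open U" "x \<in> U" "shape_of v = s" "shape_of c = s'"
  shows "differential sc s s' U (\<lambda>_. c) x v = vzero s'"
  by (rule differential_eqI[OF smooth_on_const[OF assms(1,2,5)] assms(3,4) open_UNIV UNIV_I continuous_on_const])
    (use assms in auto)

lemma differential_VPair:
  assumes f: "smooth_on sc s s' U f" and g: "smooth_on sc s s'' U g" and x: "x \<in> U" "shape_of v = s"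
  shows "differential sc s (Prod s' s'') U (\<lambda>x. VPair (f x) (g x)) x v =
     VPair (differential sc s s' U f x v) (differential sc s s'' U g x v)"
proof -
  obtain F where F: "continuous_on {t. x +\<^sub>v t *\<^sub>v v \<in> U} F" "F 0 = differential sc s s' U f x v"
    "open {t. x +\<^sub>v t *\<^sub>v v \<in> U}" "0 \<in> {t. x +\<^sub>v t *\<^sub>v v \<in> U}"
    "\<forall>t\<in>{t. x +\<^sub>v t *\<^sub>v v \<in> U}. shape_of (F t) = s' \<and> f (x +\<^sub>v t *\<^sub>v v) = f x +\<^sub>v t *\<^sub>v F t"
    using slope_line[OF f x] by metis
  obtain G where G: "continuous_on {t. x +\<^sub>v t *\<^sub>v v \<in> U} G" "G 0 = differential sc s s'' U g x v"
    "\<forall>t\<in>{t. x +\<^sub>v t *\<^sub>v v \<in> U}. shape_of (G t) = s'' \<and> g (x +\<^sub>v t *\<^sub>v v) = g x +\<^sub>v t *\<^sub>v G t"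
    using slope_line[OF g x] by metis
  have "differential sc s (Prod s' s'') U (\<lambda>x. VPair (f x) (g x)) x v = VPair (F 0) (G 0)"
    by (rule differential_eqI[OF smooth_on_VPair[OF f g] x F(3,4) continuous_on_VPair[OF F(1) G(1)]])
      (use F(5) G(3) in auto)
  then show ?thesis by (simp add: F(2) G(2))
qed

text \<open>The increment $t(v+w)$ is performed in two steps:
  $f(x+tv+tw) = f(x) + t f^{[1]}(x,v,t) + t f^{[1]}(x+tv,w,t)$.\<close>

lemma differential_vadd:
  assumes f: "smooth_on sc s s' U f" and x: "x \<in> U" "shape_of v = s" "shape_of w = s"
  shows "differential sc s s' U f x (v +\<^sub>v w) = differential sc s s' U f x v +\<^sub>v differential sc s s' U f x w"
proof -
  note sl = is_slope_slope[OF f]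
  let ?f1 = "slope sc s s' U f"
  define T where "T = {t. x +\<^sub>v t *\<^sub>v v \<in> U} \<inter> {t. x +\<^sub>v t *\<^sub>v (v +\<^sub>v w) \<in> U}"
  have sx: "shape_of x = s" using smooth_on_dom_shape[OF f x(1)] .
  have eq: "(x +\<^sub>v t *\<^sub>v v) +\<^sub>v t *\<^sub>v w = x +\<^sub>v t *\<^sub>v (v +\<^sub>v w)" for t
    using sx x by (simp add: vscale_vadd vadd_assoc)
  let ?F = "\<lambda>t. ?f1 (VPair x (VPair v (Scal t)))" and ?G = "\<lambda>t. ?f1 (VPair (x +\<^sub>v t *\<^sub>v v) (VPair w (Scal t)))"
  have z: "VPair x (VPair v (Scal t)) \<in> slope_dom sc s U"
      "VPair (x +\<^sub>v t *\<^sub>v v) (VPair w (Scal t)) \<in> slope_dom sc s U" if "t \<in> T" for t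
    using that x eq[of t] by (auto simp: T_def)
  have shF: "shape_of (?F t) = s'" "shape_of (?G t) = s'" if "t \<in> T" for t
    using z[OF that] sl unfolding is_slope_def points_def by blast+
  have T: "open T" "0 \<in> T"
    using open_line[OF smooth_onD(1,2)[OF f] x(1)] x sx by (auto simp: T_def)
  have cont: "continuous_on T (\<lambda>t. ?F t +\<^sub>v ?G t)"
  proof (intro continuous_intros)
    show "continuous_on T ?F"
      using continuous_slope_line[OF sl x(1,2)] by (rule continuous_on_subset) (auto simp: T_def)
    show "continuous_on T ?G"
    proof (rule continuous_on_compose2[where t = "slope_dom sc s U" and g = ?f1])
      show "continuous_on (slope_dom sc s U) ?f1" using sl by (simp add: is_slope_def)
    qed (use z sx x in \<open>auto intro!: continuous_intros\<close>)
  qed (use shF in auto)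
  have "differential sc s s' U f x (v +\<^sub>v w) = ?F 0 +\<^sub>v ?G 0"
  proof (rule differential_eqI[OF f x(1) _ T cont])
    show "shape_of (v +\<^sub>v w) = s" using x by simp
    fix t assume t: "t \<in> T"
    have U: "x +\<^sub>v t *\<^sub>v v \<in> U" "x +\<^sub>v t *\<^sub>v v +\<^sub>v t *\<^sub>v w \<in> U" using t eq[of t] by (auto simp: T_def)
    have "f (x +\<^sub>v t *\<^sub>v v +\<^sub>v t *\<^sub>v w) = f (x +\<^sub>v t *\<^sub>v v) +\<^sub>v t *\<^sub>v ?G t"
      by (rule is_slope_eq[OF sl smooth_onD(3)[OF f] U(1) x(3) U(2)])
    also have "f (x +\<^sub>v t *\<^sub>v v) = f x +\<^sub>v t *\<^sub>v ?F t"
      by (rule is_slope_eq[OF sl smooth_onD(3)[OF f] x(1,2) U(1)])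
    finally have "f (x +\<^sub>v t *\<^sub>v (v +\<^sub>v w)) = f x +\<^sub>v t *\<^sub>v (?F t +\<^sub>v ?G t)"
      using shF[OF t] smooth_on_shape[OF f x(1)] eq[of t] by (simp add: vscale_vadd vadd_assoc)
    then show "shape_of (?F t +\<^sub>v ?G t) = s' \<and> f (x +\<^sub>v t *\<^sub>v (v +\<^sub>v w)) = f x +\<^sub>v t *\<^sub>v (?F t +\<^sub>v ?G t)"
      using shF[OF t] by simp
  qed
  then show ?thesis using sx x by (simp add: differential_def)
qed

lemma differential_vscale:
  assumes f: "smooth_on sc s s' U f" and x: "x \<in> U" "shape_of v = s"
  shows "differential sc s s' U f x (r *\<^sub>v v) = r *\<^sub>v differential sc s s' U f x v"
proof -
  obtain F where F: "continuous_on {t. x +\<^sub>v t *\<^sub>v v \<in> U} F" "F 0 = differential sc s s' U f x v"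
    "open {t. x +\<^sub>v t *\<^sub>v v \<in> U}" "0 \<in> {t. x +\<^sub>v t *\<^sub>v v \<in> U}"
    "\<forall>t\<in>{t. x +\<^sub>v t *\<^sub>v v \<in> U}. shape_of (F t) = s' \<and> f (x +\<^sub>v t *\<^sub>v v) = f x +\<^sub>v t *\<^sub>v F t"
    using slope_line[OF f x] by metis
  let ?T = "{t. x +\<^sub>v t *\<^sub>v r *\<^sub>v v \<in> U}"
  have "differential sc s s' U f x (r *\<^sub>v v) = r *\<^sub>v F (0 * r)"
  proof (rule differential_eqI[OF f x(1), where T = ?T])
    show "shape_of (r *\<^sub>v v) = s" "open ?T"
      using x open_line[OF smooth_onD(1,2)[OF f] x(1), of "r *\<^sub>v v"] by auto
    show "0 \<in> ?T" using x smooth_on_dom_shape[OF f] by simp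
    show "continuous_on ?T (\<lambda>t. r *\<^sub>v F (t * r))"
      by (intro continuous_intros continuous_on_compose2[OF F(1)]) (auto simp: vscale_vscale)
    fix t assume "t \<in> ?T"
    then show "shape_of (r *\<^sub>v F (t * r)) = s' \<and> f (x +\<^sub>v t *\<^sub>v r *\<^sub>v v) = f x +\<^sub>v t *\<^sub>v r *\<^sub>v F (t * r)"
      using F(5) by (simp add: vscale_vscale)
  qed
  then show ?thesis by (simp add: F(2))
qed

lemma differential_vzero:
  assumes f: "smooth_on sc s s' U f" and x: "x \<in> U"
  shows "differential sc s s' U f x (vzero s) = vzero s'"
  using differential_vscale[OF f x, of "vzero s" 0] shape_differential[OF f x, of "vzero s"] by simp

end

section \<open>Functoriality of the iterated tangent maps\<close>

lemma Tk_set_Suc [simp]: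
  "VPair x v \<in> Tk_set (Suc k) s U \<longleftrightarrow> x \<in> Tk_set k s U \<and> shape_of v = Tk_shape k s"
  by simp

declare Tk_set.simps(2) [simp del]

lemma Tk_set_SucE:
  assumes "p \<in> Tk_set (Suc k) s U"
  obtains x v where "p = VPair x v" "x \<in> Tk_set k s U" "shape_of v = Tk_shape k s"
  using assms by (auto simp: Tk_set.simps)

lemma Tk_set_iff:
  "U \<subseteq> points s \<Longrightarrow> p \<in> Tk_set k s U \<longleftrightarrow> shape_of p = Tk_shape k s \<and> Tk_foot k p \<in> U"
proof (induction k arbitrary: p)
  case (Suc k)
  then show ?case by (cases p) (auto elim: Tk_set_SucE)
qed auto

lemma Tk_set_shape: "U \<subseteq> points s \<Longrightarrow> p \<in> Tk_set k s U \<Longrightarrow> shape_of p = Tk_shape k s"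
  by (simp add: Tk_set_iff)

lemma Tk_set_mono: "U' \<subseteq> U \<Longrightarrow> Tk_set k s U' \<subseteq> Tk_set k s U"
  by (induction k) (auto elim!: Tk_set_SucE)

lemma Tk_foot_Tk_map: "p \<in> Tk_set k s U \<Longrightarrow> Tk_foot k (Tk_map k sc s s' U f p) = f (Tk_foot k p)"
  by (induction k arbitrary: p) (auto simp: T_map_def elim!: Tk_set_SucE)

lemma shape_Tk_zip [simp]:
  "shape_of p = Tk_shape k s \<Longrightarrow> shape_of q = Tk_shape k s' \<Longrightarrow>
    shape_of (Tk_zip k p q) = Tk_shape k (Prod s s')"
  by (induction k arbitrary: p q) (auto dest!: elt_cases_shape(3))

lemma Tk_foot_Tk_zip [simp]: "Tk_foot k (Tk_zip k p q) = VPair (Tk_foot k p) (Tk_foot k q)"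
  by (induction k arbitrary: p q) auto

text \<open>Application of a map to all components of a point of an iterated tangent space; this is
  the iterated tangent map of a linear map.\<close>

primrec Tk_leafwise :: "nat \<Rightarrow> (('v, 'k) elt \<Rightarrow> ('v, 'k) elt) \<Rightarrow> ('v, 'k) elt \<Rightarrow> ('v, 'k) elt" where
  "Tk_leafwise 0 f p = f p"
| "Tk_leafwise (Suc k) f p = VPair (Tk_leafwise k f (vfst p)) (Tk_leafwise k f (vsnd p))"

lemma Tk_leafwise_vfst_zip [simp]:
  "shape_of p = Tk_shape k s \<Longrightarrow> shape_of q = Tk_shape k s' \<Longrightarrow> Tk_leafwise k vfst (Tk_zip k p q) = p"
  by (induction k arbitrary: p q) (auto dest!: elt_cases_shape(3))

lemma Tk_leafwise_vsnd_zip [simp]: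
  "shape_of p = Tk_shape k s \<Longrightarrow> shape_of q = Tk_shape k s' \<Longrightarrow> Tk_leafwise k vsnd (Tk_zip k p q) = q"
  by (induction k arbitrary: p q) (auto dest!: elt_cases_shape(3))

lemma Tk_leafwise_id: "shape_of p = Tk_shape k s \<Longrightarrow> Tk_leafwise k (\<lambda>x. x) p = p"
  by (induction k arbitrary: p) (auto dest!: elt_cases_shape(3))

lemma digit_0 [simp]: "digit 0 i = 0"
  by (simp add: digit_def)

lemma shape_Tk_single [simp]: "shape_of v = s \<Longrightarrow> shape_of (Tk_single s k \<alpha> v) = Tk_shape k s"
  by (induction k) auto

context good_module
begin

lemma smooth_on_differential:
  assumes f: "smooth_on sc s s' U f"
  shows "smooth_on sc (Prod s s) s' {VPair x v | x v. x \<in> U \<and> v \<in> points s}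
    (\<lambda>p. differential sc s s' U f (vfst p) (vsnd p))"
  unfolding smooth_on_def
proof
  fix j
  let ?TU = "{VPair x v | x v. x \<in> U \<and> v \<in> points s}"
  let ?l = "\<lambda>p. VPair (vfst p) (VPair (vsnd p) (Scal 0))"
  have "C_on (Suc j) sc s s' U f" using f smooth_on_def by blast
  then obtain f1 where f1: "is_slope sc s s' U f f1"
    "C_on j sc (Prod s (Prod s Base)) s' (slope_dom sc s U) f1" by auto
  have TU: "?TU \<subseteq> points (Prod s s)" "open ?TU"
    using smooth_onD(1)[OF f] open_VPair_image[OF smooth_onD(2)[OF f] open_points] by auto
  have "C_on j sc (Prod s s) s' ?TU (\<lambda>p. f1 (?l p))"
  proof (rule C_on_comp[OF _ f1(2)])
    show "C_on j sc (Prod s s) (Prod s (Prod s Base)) ?TU ?l"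
      by (intro C_on_linear TU continuous_linear_VPair continuous_linear_vfst continuous_linear_vsnd
          continuous_linear_Scal_0)
    show "?l ` ?TU \<subseteq> slope_dom sc s U"
      using smooth_on_dom_shape[OF f] by auto
  qed
  then show "C_on j sc (Prod s s) s' ?TU (\<lambda>p. differential sc s s' U f (vfst p) (vsnd p))"
    by (rule C_on_cong) (use differential_eq_slope[OF f f1(1)] in auto)
qed

lemma smooth_on_T_map:
  assumes f: "smooth_on sc s s' U f"
  shows "smooth_on sc (Prod s s) (Prod s' s') {VPair x v | x v. x \<in> U \<and> v \<in> points s} (T_map sc s s' U f)"
proof -
  let ?TU = "{VPair x v | x v. x \<in> U \<and> v \<in> points s}"
  have TU: "?TU \<subseteq> points (Prod s s)" "open ?TU"
    using smooth_onD(1)[OF f] open_VPair_image[OF smooth_onD(2)[OF f] open_points] by auto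
  have "smooth_on sc (Prod s s) s' ?TU (\<lambda>p. f (vfst p))"
    by (rule smooth_on_comp[OF smooth_on_linear[OF continuous_linear_vfst TU] f]) auto
  from smooth_on_VPair[OF this smooth_on_differential[OF f]]
  show ?thesis by (rule smooth_on_cong) (simp add: T_map_def)
qed

lemma smooth_on_Tk_map:
  assumes "smooth_on sc s s' U f"
  shows "smooth_on sc (Tk_shape k s) (Tk_shape k s') (Tk_set k s U) (Tk_map k sc s s' U f)"
proof (induction k)
  case 0
  then show ?case using assms by simp
next
  case (Suc k)
  show ?case using smooth_on_T_map[OF Suc] by (simp add: Tk_set.simps(2))
qed

lemma Tk_map_Suc [simp]:
  "Tk_map (Suc k) sc s s' U f (VPair x v) = VPair (Tk_map k sc s s' U f x)
     (differential sc (Tk_shape k s) (Tk_shape k s') (Tk_set k s U) (Tk_map k sc s s' U f) x v)"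
  by (simp add: T_map_def)

declare Tk_map.simps(2) [simp del]

lemma shape_Tk_map [simp]:
  assumes "smooth_on sc s s' U f" "p \<in> Tk_set k s U"
  shows "shape_of (Tk_map k sc s s' U f p) = Tk_shape k s'"
  using smooth_on_shape[OF smooth_on_Tk_map[OF assms(1)] assms(2)] .

lemma Tk_map_Tk_set:
  assumes "smooth_on sc s s' U f" "p \<in> Tk_set k s U" "f ` U \<subseteq> W" "W \<subseteq> points s'"
  shows "Tk_map k sc s s' U f p \<in> Tk_set k s' W"
  using assms Tk_set_iff[OF smooth_onD(1)[OF assms(1)]] by (auto simp: Tk_set_iff Tk_foot_Tk_map)

lemma Tk_map_local:
  assumes "smooth_on sc s s' U f" "smooth_on sc s s' U' g" "U' \<subseteq> U" "\<And>x. x \<in> U' \<Longrightarrow> f x = g x"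
  shows "p \<in> Tk_set k s U' \<Longrightarrow> Tk_map k sc s s' U f p = Tk_map k sc s s' U' g p"
proof (induction k arbitrary: p)
  case 0
  then show ?case using assms by simp
next
  case (Suc k)
  from Suc.prems show ?case
    by (auto simp: Suc.IH intro!: differential_local[OF smooth_on_Tk_map[OF assms(1)] smooth_on_Tk_map[OF assms(2)]
        Tk_set_mono[OF assms(3)]] elim!: Tk_set_SucE)
qed

lemma Tk_map_cong:
  assumes "smooth_on sc s s' U f" "\<And>x. x \<in> U \<Longrightarrow> f x = g x" "p \<in> Tk_set k s U"
  shows "Tk_map k sc s s' U f p = Tk_map k sc s s' U g p"
  by (rule Tk_map_local[OF assms(1) smooth_on_cong[OF assms(1,2)]]) (use assms in auto)

lemma differential_cong:
  assumes "smooth_on sc s s' U f" "\<And>x. x \<in> U \<Longrightarrow> f x = g x" "x \<in> U" "shape_of v = s"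
  shows "differential sc s s' U f x v = differential sc s s' U g x v"
  by (rule differential_local[OF assms(1) smooth_on_cong[OF assms(1,2)]]) (use assms in auto)

text \<open>The functor $T$ is applied to $T^k g \circ T^k f$; the differential only sees germs, so
  that $T^k(g \circ f)$ may be replaced by $T^k g \circ T^k f$ under it.\<close>

lemma Tk_map_comp:
  assumes f: "smooth_on sc s s' U f" and g: "smooth_on sc s' s'' W g" and fU: "f ` U \<subseteq> W"
  shows "p \<in> Tk_set k s U \<Longrightarrow> Tk_map k sc s s'' U (\<lambda>x. g (f x)) p = Tk_map k sc s' s'' W g (Tk_map k sc s s' U f p)"
proof (induction k arbitrary: p)
  case 0
  then show ?case by simp
next
  case (Suc k)
  from Suc.prems obtain x v where p: "p = VPair x v" "x \<in> Tk_set k s U" "shape_of v = Tk_shape k s"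
    by (rule Tk_set_SucE)
  let ?D = "differential sc (Tk_shape k s) (Tk_shape k s'') (Tk_set k s U)"
  have "?D (Tk_map k sc s s'' U (\<lambda>x. g (f x))) x v
      = ?D (\<lambda>x. Tk_map k sc s' s'' W g (Tk_map k sc s s' U f x)) x v"
    by (rule differential_cong[OF smooth_on_Tk_map[OF smooth_on_comp[OF f g fU]] Suc.IH p(2,3)])
  also have "\<dots> = differential sc (Tk_shape k s') (Tk_shape k s'') (Tk_set k s' W) (Tk_map k sc s' s'' W g)
      (Tk_map k sc s s' U f x)
      (differential sc (Tk_shape k s) (Tk_shape k s') (Tk_set k s U) (Tk_map k sc s s' U f) x v)"
    using Tk_map_Tk_set[OF f _ fU] smooth_onD(1)[OF g]
    by (intro differential_comp[OF smooth_on_Tk_map[OF f] smooth_on_Tk_map[OF g]] p) auto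
  finally show ?case using p Suc.IH[OF p(2)] by simp
qed

lemma continuous_linear_Tk_leafwise:
  assumes "continuous_linear s s' f"
  shows "continuous_linear (Tk_shape k s) (Tk_shape k s') (Tk_leafwise k f)"
proof (induction k)
  case 0
  then show ?case using assms by (simp add: continuous_linear_def)
next
  case (Suc k)
  have "continuous_linear (Tk_shape (Suc k) s) (Tk_shape (Suc k) s')
      (\<lambda>p. VPair (Tk_leafwise k f (vfst p)) (Tk_leafwise k f (vsnd p)))"
    by (simp, intro continuous_linear_VPair continuous_linear_comp[OF continuous_linear_vfst Suc]
        continuous_linear_comp[OF continuous_linear_vsnd Suc])
  moreover have "(\<lambda>p. VPair (Tk_leafwise k f (vfst p)) (Tk_leafwise k f (vsnd p))) = Tk_leafwise (Suc k) f"
    by auto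
  ultimately show ?case by simp
qed

lemma Tk_map_linear:
  assumes f: "continuous_linear s s' f" and U: "U \<subseteq> points s" "open U"
  shows "p \<in> Tk_set k s U \<Longrightarrow> Tk_map k sc s s' U f p = Tk_leafwise k f p"
proof (induction k arbitrary: p)
  case 0
  then show ?case by simp
next
  case (Suc k)
  from Suc.prems obtain x v where p: "p = VPair x v" "x \<in> Tk_set k s U" "shape_of v = Tk_shape k s"
    by (rule Tk_set_SucE)
  note sm = smooth_on_Tk_map[OF smooth_on_linear[OF f U]]
  have "differential sc (Tk_shape k s) (Tk_shape k s') (Tk_set k s U) (Tk_map k sc s s' U f) x v =
      differential sc (Tk_shape k s) (Tk_shape k s') (Tk_set k s U) (Tk_leafwise k f) x v"
    by (rule differential_cong[OF sm Suc.IH p(2,3)])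
  also have "\<dots> = Tk_leafwise k f v"
    by (rule differential_linear[OF continuous_linear_Tk_leafwise[OF f] smooth_onD(1,2)[OF sm] p(2,3)])
  finally show ?case using p Suc.IH[OF p(2)] by simp
qed

lemma Tk_map_id:
  assumes "U \<subseteq> points s" "open U" "p \<in> Tk_set k s U" "\<And>x. x \<in> U \<Longrightarrow> f x = x"
  shows "Tk_map k sc s s U f p = p"
proof -
  have "Tk_map k sc s s U (\<lambda>x. x) p = Tk_map k sc s s U f p"
    by (rule Tk_map_cong[OF smooth_on_linear[OF continuous_linear_id assms(1,2)]]) (use assms in auto)
  then show ?thesis
    using Tk_map_linear[OF continuous_linear_id assms(1-3)] Tk_leafwise_id[OF Tk_set_shape[OF assms(1,3)]] by simp
qed

lemma Tk_map_const:
  assumes U: "U \<subseteq> points s" "open U" and c: "shape_of c = s'"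
  shows "p \<in> Tk_set k s U \<Longrightarrow> Tk_map k sc s s' U (\<lambda>_. c) p = Tk_single s' k 0 c"
proof (induction k arbitrary: p)
  case 0
  then show ?case by simp
next
  case (Suc k)
  from Suc.prems obtain x v where p: "p = VPair x v" "x \<in> Tk_set k s U" "shape_of v = Tk_shape k s"
    by (rule Tk_set_SucE)
  note sm = smooth_on_Tk_map[OF smooth_on_const[OF U c]]
  have "differential sc (Tk_shape k s) (Tk_shape k s') (Tk_set k s U) (Tk_map k sc s s' U (\<lambda>_. c)) x v =
      differential sc (Tk_shape k s) (Tk_shape k s') (Tk_set k s U) (\<lambda>_. Tk_single s' k 0 c) x v"
    by (rule differential_cong[OF sm Suc.IH p(2,3)])
  also have "\<dots> = vzero (Tk_shape k s')"
    by (rule differential_const[OF smooth_onD(1,2)[OF sm] p(2,3)]) (simp add: c)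
  finally show ?case using p Suc.IH[OF p(2)] by simp
qed

lemma continuous_linear_Tk_zip:
  "continuous_linear (Prod (Tk_shape k s) (Tk_shape k s')) (Tk_shape k (Prod s s')) (\<lambda>p. Tk_zip k (vfst p) (vsnd p))"
proof (induction k)
  case 0
  then show ?case
    using continuous_linear_VPair[OF continuous_linear_vfst continuous_linear_vsnd] by simp
next
  case (Suc k)
  note fs = continuous_linear_vfst and sn = continuous_linear_vsnd
  have "continuous_linear (Prod (Tk_shape (Suc k) s) (Tk_shape (Suc k) s')) (Tk_shape k (Prod s s'))
     (\<lambda>p. Tk_zip k (vfst (VPair (vfst (vfst p)) (vfst (vsnd p)))) (vsnd (VPair (vfst (vfst p)) (vfst (vsnd p)))))"
    unfolding Tk_shape.simps
    by (rule continuous_linear_comp[OF continuous_linear_VPair[OF continuous_linear_comp[OF fs fs]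
          continuous_linear_comp[OF sn fs]] Suc])
  moreover have "continuous_linear (Prod (Tk_shape (Suc k) s) (Tk_shape (Suc k) s')) (Tk_shape k (Prod s s'))
     (\<lambda>p. Tk_zip k (vfst (VPair (vsnd (vfst p)) (vsnd (vsnd p)))) (vsnd (VPair (vsnd (vfst p)) (vsnd (vsnd p)))))"
    unfolding Tk_shape.simps
    by (rule continuous_linear_comp[OF continuous_linear_VPair[OF continuous_linear_comp[OF fs sn]
          continuous_linear_comp[OF sn sn]] Suc])
  ultimately show ?case using continuous_linear_VPair by fastforce
qed

text \<open>$T^k$ commutes with products of maps; \<open>Tk_zip\<close> being linear, it can be taken out of the
  differential.\<close>

lemma Tk_map_VPair:
  assumes f: "smooth_on sc s s' U f" and g: "smooth_on sc s s'' U g"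
  shows "p \<in> Tk_set k s U \<Longrightarrow> Tk_map k sc s (Prod s' s'') U (\<lambda>x. VPair (f x) (g x)) p =
     Tk_zip k (Tk_map k sc s s' U f p) (Tk_map k sc s s'' U g p)"
proof (induction k arbitrary: p)
  case 0
  then show ?case by simp
next
  case (Suc k)
  from Suc.prems obtain x v where p: "p = VPair x v" "x \<in> Tk_set k s U" "shape_of v = Tk_shape k s"
    by (rule Tk_set_SucE)
  note sm = smooth_on_Tk_map[OF smooth_on_VPair[OF f g]]
  let ?D = "differential sc (Tk_shape k s) (Tk_shape k (Prod s' s'')) (Tk_set k s U)"
  let ?F = "Tk_map k sc s s' U f" and ?G = "Tk_map k sc s s'' U g"
  let ?Z = "\<lambda>p. Tk_zip k (vfst p) (vsnd p)"
  note FG = smooth_on_VPair[OF smooth_on_Tk_map[OF f, of k] smooth_on_Tk_map[OF g, of k]]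
  have "?D (Tk_map k sc s (Prod s' s'') U (\<lambda>x. VPair (f x) (g x))) x v = ?D (\<lambda>x. ?Z (VPair (?F x) (?G x))) x v"
    by (rule differential_cong[OF sm _ p(2,3)]) (simp add: Suc.IH)
  also have "\<dots> = differential sc (Prod (Tk_shape k s') (Tk_shape k s'')) (Tk_shape k (Prod s' s''))
      (points (Prod (Tk_shape k s') (Tk_shape k s''))) ?Z (VPair (?F x) (?G x))
      (differential sc (Tk_shape k s) (Prod (Tk_shape k s') (Tk_shape k s'')) (Tk_set k s U) (\<lambda>x. VPair (?F x) (?G x)) x v)"
    by (rule differential_comp[OF FG smooth_on_linear[OF continuous_linear_Tk_zip subset_refl open_points] _ p(2,3)])
      (use f g in auto)
  also have "\<dots> = ?Z (differential sc (Tk_shape k s) (Prod (Tk_shape k s') (Tk_shape k s'')) (Tk_set k s U) (\<lambda>x. VPair (?F x) (?G x)) x v)"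
    by (rule differential_linear[OF continuous_linear_Tk_zip subset_refl open_points])
      (use f g p shape_differential[OF FG p(2,3)] in auto)
  also have "differential sc (Tk_shape k s) (Prod (Tk_shape k s') (Tk_shape k s'')) (Tk_set k s U) (\<lambda>x. VPair (?F x) (?G x)) x v =
      VPair (differential sc (Tk_shape k s) (Tk_shape k s') (Tk_set k s U) ?F x v)
        (differential sc (Tk_shape k s) (Tk_shape k s'') (Tk_set k s U) ?G x v)"
    by (rule differential_VPair[OF smooth_on_Tk_map[OF f] smooth_on_Tk_map[OF g] p(2,3)])
  finally show ?case using p Suc.IH[OF p(2)] by simp
qed

section \<open>Symmetry of the second differential\<close>

text \<open>The derivative in the direction \<open>u\<close> of $y \mapsto df(y)w$.\<close>

definition differential2 :: "shape \<Rightarrow> shape \<Rightarrow> ('v, 'k) elt set \<Rightarrow> (('v, 'k) elt \<Rightarrow> ('v, 'k) elt) \<Rightarrow>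
    ('v, 'k) elt \<Rightarrow> ('v, 'k) elt \<Rightarrow> ('v, 'k) elt \<Rightarrow> ('v, 'k) elt" where
  "differential2 s s' U f x u w = differential sc s s' U (\<lambda>y. differential sc s s' U f y w) x u"

lemma smooth_on_differential_dir:
  assumes f: "smooth_on sc s s' U f" and w: "shape_of w = s"
  shows "smooth_on sc s s' U (\<lambda>y. differential sc s s' U f y w)"
proof -
  have U: "U \<subseteq> points s" "open U" using smooth_onD[OF f] by auto
  have "smooth_on sc s (Prod s s) U (\<lambda>y. VPair y w)"
    by (intro smooth_on_VPair smooth_on_linear[OF continuous_linear_id U] smooth_on_const U w)
  from smooth_on_comp[OF this smooth_on_differential[OF f]] show ?thesis using w by auto
qed

text \<open>For units \<open>r\<close> and \<open>t\<close>, the iterated slope of \<open>f\<close> in the directions \<open>u\<close> and \<open>w\<close> is the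
  quotient of $f(x+ru+tw) - f(x+ru) - f(x+tw) + f(x)$ by $rt$, in which the order of the
  directions does not matter. The equality survives the limits $r \to 0$ and then $t \to 0$.\<close>

lemma differential2_commute:
  assumes f: "smooth_on sc s s' U f" and x: "x \<in> U" and u: "shape_of u = s" and w: "shape_of w = s"
  shows "differential2 s s' U f x u w = differential2 s s' U f x w u"
proof -
  have "C_on (Suc (Suc 0)) sc s s' U f" using f smooth_on_def by blast
  then obtain f1 where f1: "is_slope sc s s' U f f1"
    and "C_on (Suc 0) sc (Prod s (Prod s Base)) s' (slope_dom sc s U) f1" unfolding C_on.simps(2)[of "Suc 0"] by blast
  then obtain f2 where f2: "is_slope sc (Prod s (Prod s Base)) s' (slope_dom sc s U) f1 f2"
    by auto
  let ?P = "Prod s (Prod s Base)"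
  let ?SU = "slope_dom sc s U"
  have U: "U \<subseteq> points s" "open U" "f \<in> U \<rightarrow> points s'" using smooth_onD[OF f] by auto
  have fsh: "y \<in> U \<Longrightarrow> shape_of (f y) = s'" "y \<in> U \<Longrightarrow> shape_of y = s" for y
    using U by (auto simp: Pi_iff)
  have f1sh: "z \<in> ?SU \<Longrightarrow> shape_of (f1 z) = s'" for z
    using f1 unfolding is_slope_def points_def by blast
  have f1P: "f1 \<in> ?SU \<rightarrow> points s'" using f1 unfolding is_slope_def by blast
  have f2sh: "z \<in> slope_dom sc ?P ?SU \<Longrightarrow> shape_of (f2 z) = s'" for z
    using f2 unfolding is_slope_def points_def by blast
  \<comment> \<open>the slope of \<open>f1\<close> at $(x,b,t)$ in the direction $(a,0,0)$\<close>
  define q where "q = (\<lambda>a b r t. VPair (VPair x (VPair b (Scal t))) (VPair (VPair a (VPair (vzero s) (Scal 0))) (Scal r)))"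
  have add: "VPair x (VPair b (Scal t)) +\<^sub>v r *\<^sub>v VPair a (VPair (vzero s) (Scal 0)) =
      VPair (x +\<^sub>v r *\<^sub>v a) (VPair b (Scal t))" if "shape_of b = s" for a b r t
    using that by simp
  have q_dom: "q a b r t \<in> slope_dom sc ?P ?SU"
    if "shape_of a = s" "shape_of b = s" "x +\<^sub>v r *\<^sub>v a \<in> U" "x +\<^sub>v t *\<^sub>v b \<in> U" "x +\<^sub>v r *\<^sub>v a +\<^sub>v t *\<^sub>v b \<in> U" for a b r t
    unfolding q_def slope_dom_iff add[OF that(2)] using that x by simp
  have quot: "f (x +\<^sub>v r *\<^sub>v a +\<^sub>v t *\<^sub>v b) +\<^sub>v f x = (f (x +\<^sub>v r *\<^sub>v a) +\<^sub>v f (x +\<^sub>v t *\<^sub>v b)) +\<^sub>v (r * t) *\<^sub>v f2 (q a b r t)"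
    if d: "shape_of a = s" "shape_of b = s" "x +\<^sub>v r *\<^sub>v a \<in> U" "x +\<^sub>v t *\<^sub>v b \<in> U" "x +\<^sub>v r *\<^sub>v a +\<^sub>v t *\<^sub>v b \<in> U" for a b r t
  proof -
    let ?a = "VPair x (VPair b (Scal t))" and ?b = "VPair (x +\<^sub>v r *\<^sub>v a) (VPair b (Scal t))"
    have 1: "f (x +\<^sub>v r *\<^sub>v a +\<^sub>v t *\<^sub>v b) = f (x +\<^sub>v r *\<^sub>v a) +\<^sub>v t *\<^sub>v f1 ?b"
      by (rule is_slope_eq[OF f1 U(3) d(3,2,5)])
    have 2: "f (x +\<^sub>v t *\<^sub>v b) = f x +\<^sub>v t *\<^sub>v f1 ?a"
      by (rule is_slope_eq[OF f1 U(3) x d(2,4)])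
    have ab: "?a \<in> ?SU" "?b \<in> ?SU" using d x by auto
    have 3: "f1 ?b = f1 ?a +\<^sub>v r *\<^sub>v f2 (q a b r t)"
      using is_slope_eq[OF f2 f1P ab(1), of "VPair a (VPair (vzero s) (Scal 0))" r]
      using d ab add[OF d(2)] unfolding q_def by simp
    show ?thesis unfolding 1 2 3
      using f1sh[OF ab(1)] f2sh[OF q_dom[OF d]] fsh[OF x] fsh[OF d(3)]
      by (simp add: vscale_vadd vscale_vscale vadd_ac mult.commute)
  qed
  have cont: "continuous_on T (\<lambda>t. f2 (q a b (r t) (t' t)))"
    if "shape_of a = s" "shape_of b = s" "continuous_on T r" "continuous_on T t'"
      "\<And>t. t \<in> T \<Longrightarrow> x +\<^sub>v r t *\<^sub>v a \<in> U \<and> x +\<^sub>v t' t *\<^sub>v b \<in> U \<and> x +\<^sub>v r t *\<^sub>v a +\<^sub>v t' t *\<^sub>v b \<in> U"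
    for T :: "'k set" and r t' a b
  proof (rule continuous_on_compose2[where t = "slope_dom sc ?P ?SU" and g = f2])
    show "continuous_on (slope_dom sc ?P ?SU) f2" using f2 by (simp add: is_slope_def)
    show "continuous_on T (\<lambda>t. q a b (r t) (t' t))" unfolding q_def
      by (intro continuous_intros that(3,4))
    show "(\<lambda>t. q a b (r t) (t' t)) ` T \<subseteq> slope_dom sc ?P ?SU" using that q_dom by blast
  qed
  have D2: "differential2 s s' U f x a b = f2 (q a b 0 0)" if ab: "shape_of a = s" "shape_of b = s" for a b
    unfolding differential2_def
  proof (rule differential_eqI[OF smooth_on_differential_dir[OF f ab(2)] x ab(1), where T = "{t. x +\<^sub>v t *\<^sub>v a \<in> U}"
        and G = "\<lambda>t. f2 (q a b t 0)"])
    show "open {t. x +\<^sub>v t *\<^sub>v a \<in> U}" using open_line[OF U(1,2) x ab(1)] .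
    show "0 \<in> {t. x +\<^sub>v t *\<^sub>v a \<in> U}" using x fsh[OF x] ab by simp
    show "continuous_on {t. x +\<^sub>v t *\<^sub>v a \<in> U} (\<lambda>t. f2 (q a b t 0))"
      by (intro cont ab continuous_intros) (use x fsh ab in auto)
    fix t assume t: "x +\<^sub>v t *\<^sub>v a \<in> U"
    have d: "q a b t 0 \<in> slope_dom sc ?P ?SU" using t x fsh ab by (intro q_dom) auto
    have "f1 (VPair (x +\<^sub>v t *\<^sub>v a) (VPair b (Scal 0))) = f1 (VPair x (VPair b (Scal 0))) +\<^sub>v t *\<^sub>v f2 (q a b t 0)"
      using is_slope_eq[OF f2 f1P, of "VPair x (VPair b (Scal 0))" "VPair a (VPair (vzero s) (Scal 0))" t]
      using add[OF ab(2)] t x fsh ab unfolding q_def by simp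
    then show "shape_of (f2 (q a b t 0)) = s' \<and> differential sc s s' U f (x +\<^sub>v t *\<^sub>v a) b =
        differential sc s s' U f x b +\<^sub>v t *\<^sub>v f2 (q a b t 0)"
      using f2sh[OF d] differential_eq_slope[OF f f1 t ab(2)] differential_eq_slope[OF f f1 x ab(2)] by simp
  qed
  have eq_units: "f2 (q u w r t) = f2 (q w u t r)" if rt: "r dvd 1" "t dvd 1"
    "x +\<^sub>v r *\<^sub>v u \<in> U" "x +\<^sub>v t *\<^sub>v w \<in> U" "x +\<^sub>v r *\<^sub>v u +\<^sub>v t *\<^sub>v w \<in> U" for r t
  proof -
    have c: "x +\<^sub>v t *\<^sub>v w +\<^sub>v r *\<^sub>v u = x +\<^sub>v r *\<^sub>v u +\<^sub>v t *\<^sub>v w"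
      using fsh[OF x] u w by (simp add: vadd_ac)
    have "(f (x +\<^sub>v t *\<^sub>v w) +\<^sub>v f (x +\<^sub>v r *\<^sub>v u)) +\<^sub>v (r * t) *\<^sub>v f2 (q u w r t) =
        (f (x +\<^sub>v t *\<^sub>v w) +\<^sub>v f (x +\<^sub>v r *\<^sub>v u)) +\<^sub>v (r * t) *\<^sub>v f2 (q w u t r)"
      using quot[OF u w rt(3-5)] quot[OF w u rt(4,3)] c rt
        vadd_commute[of "f (x +\<^sub>v t *\<^sub>v w)" "f (x +\<^sub>v r *\<^sub>v u)"] fsh(1)[OF rt(3)] fsh(1)[OF rt(4)]
      by (simp add: mult.commute)
    then have "(r * t) *\<^sub>v f2 (q u w r t) = (r * t) *\<^sub>v f2 (q w u t r)"
      using fsh(1)[OF rt(3)] fsh(1)[OF rt(4)] f2sh[OF q_dom[OF u w rt(3-5)]] f2sh[OF q_dom[OF w u rt(4,3)]] rt c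
      by (subst (asm) vadd_left_cancel) auto
    moreover have "r * t dvd 1" using mult_dvd_mono[OF rt(1,2)] by simp
    ultimately show ?thesis using vscale_unit_cancel by blast
  qed
  have line: "open {t. y +\<^sub>v t *\<^sub>v a \<in> U}" if "shape_of a = s" "y \<in> U" for a y
    using open_line[OF U(1,2) that(2,1)] .
  \<comment> \<open>the limit $r \to 0$, for a fixed unit \<open>t\<close>\<close>
  have eq_unit: "f2 (q u w 0 t) = f2 (q w u t 0)" if t: "t dvd 1" "x +\<^sub>v t *\<^sub>v w \<in> U" for t
  proof (rule unit_limit[where T = "{r. x +\<^sub>v r *\<^sub>v u \<in> U} \<inter> {r. (x +\<^sub>v t *\<^sub>v w) +\<^sub>v r *\<^sub>v u \<in> U}"
        and f = "\<lambda>r. f2 (q u w r t)" and g = "\<lambda>r. f2 (q w u t r)"])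
    let ?T = "{r. x +\<^sub>v r *\<^sub>v u \<in> U} \<inter> {r. (x +\<^sub>v t *\<^sub>v w) +\<^sub>v r *\<^sub>v u \<in> U}"
    have c: "x +\<^sub>v t *\<^sub>v w +\<^sub>v r *\<^sub>v u = x +\<^sub>v r *\<^sub>v u +\<^sub>v t *\<^sub>v w" for r
      using fsh[OF x] u w by (simp add: vadd_ac)
    show "open ?T" using line[OF u x] line[OF u t(2)] by blast
    show "0 \<in> ?T" using x t fsh u w by auto
    show "continuous_on ?T (\<lambda>r. f2 (q u w r t))"
      by (intro cont u w continuous_intros) (use t c in auto)
    show "continuous_on ?T (\<lambda>r. f2 (q w u t r))"
      by (intro cont u w continuous_intros) (use t c in auto)
    show "f2 (q u w r t) = f2 (q w u t r)" if "r \<in> ?T" "r dvd 1" for r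
      by (rule eq_units) (use that t c in auto)
  qed
  \<comment> \<open>the limit $t \to 0$\<close>
  have "f2 (q u w 0 0) = f2 (q w u 0 0)"
  proof (rule unit_limit[where T = "{t. x +\<^sub>v t *\<^sub>v w \<in> U}"
        and f = "\<lambda>t. f2 (q u w 0 t)" and g = "\<lambda>t. f2 (q w u t 0)"])
    let ?T = "{t. x +\<^sub>v t *\<^sub>v w \<in> U}"
    show "open ?T" using line[OF w x] .
    show "0 \<in> ?T" using x fsh w by auto
    show "continuous_on ?T (\<lambda>t. f2 (q u w 0 t))"
      by (intro cont u w continuous_intros) (use x fsh u w in auto)
    show "continuous_on ?T (\<lambda>t. f2 (q w u t 0))"
      by (intro cont u w continuous_intros) (use x fsh u w in auto)
    show "f2 (q u w 0 t) = f2 (q w u t 0)" if "t \<in> ?T" "t dvd 1" for t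
      using eq_unit that by auto
  qed
  then show ?thesis by (simp add: D2 u w)
qed

end

section \<open>Iterated tangent maps at sparse points\<close>

text \<open>The point $x + \varepsilon^A u + \varepsilon^B w + \varepsilon^{A \cup B} z$, where
  multi-indices are given by the sets of their non-zero positions; the last summand only occurs if
  \<open>A\<close> and \<open>B\<close> are disjoint. Positions above \<open>k\<close> are ignored, and if \<open>A\<close> or \<open>B\<close> has no other
  positions, then the summands with the same exponent are added.\<close>

primrec jet :: "shape \<Rightarrow> nat set \<Rightarrow> nat set \<Rightarrow> nat \<Rightarrow> ('v::{zero,plus}, 'k::{zero,plus}) elt \<Rightarrow> ('v, 'k) elt \<Rightarrow>
    ('v, 'k) elt \<Rightarrow> ('v, 'k) elt \<Rightarrow> ('v, 'k) elt" where
  "jet s A B 0 x u w z = (x +\<^sub>v u) +\<^sub>v (w +\<^sub>v z)"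
| "jet s A B (Suc k) x u w z = (let o0 = vzero s in
     if Suc k \<in> A then
       if Suc k \<in> B then VPair (jet s A B k x o0 o0 o0) (jet s A B k o0 u w o0)
       else VPair (jet s A B k x o0 w o0) (jet s A B k o0 u o0 z)
     else if Suc k \<in> B then VPair (jet s A B k x u o0 o0) (jet s A B k o0 o0 w z)
     else VPair (jet s A B k x u w z) (jet s A B k o0 o0 o0 o0))"

lemma shape_jet [simp]:
  "shape_of x = s \<Longrightarrow> shape_of u = s \<Longrightarrow> shape_of w = s \<Longrightarrow> shape_of z = s \<Longrightarrow>
    shape_of (jet s A B k x u w z) = Tk_shape k s"
  by (induction k arbitrary: x u w z) (auto simp: Let_def)

lemma jet_0 [simp]:
  "jet s A B k (vzero s) (vzero s) (vzero s) (vzero s) =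
     (vzero (Tk_shape k s) :: ('v::comm_monoid_add, 'k::comm_monoid_add) elt)"
  by (induction k) (auto simp: Let_def)

lemma jet_swap:
  fixes x u w z :: "('v::comm_monoid_add, 'k::comm_monoid_add) elt"
  shows "shape_of x = s \<Longrightarrow> shape_of u = s \<Longrightarrow> shape_of w = s \<Longrightarrow> shape_of z = s \<Longrightarrow>
    jet s A B k x u w z = jet s B A k x w u z"
  by (induction k arbitrary: x u w z) (auto simp: Let_def vadd_ac)

text \<open>If \<open>A\<close> is empty below \<open>k\<close>, then $\varepsilon^A = 1$ and the summands merge in pairs.\<close>

lemma jet_collapse:
  fixes x u w z :: "('v::comm_monoid_add, 'k::comm_monoid_add) elt"
  shows "A \<inter> {1..k} = {} \<Longrightarrow> shape_of x = s \<Longrightarrow> shape_of u = s \<Longrightarrow> shape_of w = s \<Longrightarrow> shape_of z = s \<Longrightarrow>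
    jet s A B k x u w z = jet s A B k (x +\<^sub>v u) (vzero s) (w +\<^sub>v z) (vzero s)"
proof (induction k arbitrary: x u w z)
  case (Suc k)
  have A: "A \<inter> {1..k} = {}" "Suc k \<notin> A" using Suc.prems(1) by auto
  have IH: "jet s A B k x u w z = jet s A B k (x +\<^sub>v u) (vzero s) (w +\<^sub>v z) (vzero s)"
    if "shape_of x = s" "shape_of u = s" "shape_of w = s" "shape_of z = s" for x u w z :: "('v, 'k) elt"
    using Suc.IH[OF A(1) that] .
  show ?case using A(2) Suc.prems(2-)
    by (auto simp: Let_def IH[of x u "vzero s" "vzero s"] IH[of "vzero s" "vzero s" w z] IH[of x u w z])
qed (auto simp: vadd_ac)

lemma jet_vadd:
  fixes x u w z :: "('v::comm_monoid_add, 'k::comm_monoid_add) elt"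
  shows "shape_of x = s \<Longrightarrow> shape_of u = s \<Longrightarrow> shape_of w = s \<Longrightarrow> shape_of z = s \<Longrightarrow>
    shape_of x' = s \<Longrightarrow> shape_of u' = s \<Longrightarrow> shape_of w' = s \<Longrightarrow> shape_of z' = s \<Longrightarrow>
    jet s A B k x u w z +\<^sub>v jet s A B k x' u' w' z' = jet s A B k (x +\<^sub>v x') (u +\<^sub>v u') (w +\<^sub>v w') (z +\<^sub>v z')"
proof (induction k arbitrary: x u w z x' u' w' z')
  case 0
  then show ?case by (simp add: vadd_ac)
next
  case (Suc k)
  then show ?case by (simp add: Let_def)
qed

lemma Tk_single_eq_jet:
  fixes x v :: "('v::comm_monoid_add, 'k::comm_monoid_add) elt"
  assumes v: "shape_of v = s" and A: "\<And>i. i \<in> {1..k} \<Longrightarrow> i \<in> A \<longleftrightarrow> digit \<alpha> i \<noteq> 0"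
  shows "Tk_single s k \<alpha> v = jet s A B k (vzero s) v (vzero s) (vzero s)"
  using A
proof (induction k)
  case 0
  then show ?case using v by simp
next
  case (Suc k)
  then have "Suc k \<in> A \<longleftrightarrow> digit \<alpha> (Suc k) \<noteq> 0" "Tk_single s k \<alpha> v = jet s A B k (vzero s) v (vzero s) (vzero s)"
    by simp_all
  then show ?case by (simp add: Let_def)
qed

lemma Tk_single_0_eq_jet:
  fixes x :: "('v::comm_monoid_add, 'k::comm_monoid_add) elt"
  assumes "shape_of x = s"
  shows "Tk_single s k 0 x = jet s A B k x (vzero s) (vzero s) (vzero s)"
  using assms by (induction k) (auto simp: Let_def digit_0)

lemma Tk_single_union_eq_jet:
  fixes x z :: "('v::comm_monoid_add, 'k::comm_monoid_add) elt"
  assumes z: "shape_of z = s" and AB: "A \<inter> B = {}"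
    and d: "\<And>i. i \<in> {1..k} \<Longrightarrow> i \<in> A \<union> B \<longleftrightarrow> digit \<gamma> i \<noteq> 0"
  shows "Tk_single s k \<gamma> z = jet s A B k (vzero s) (vzero s) (vzero s) z"
  using d
proof (induction k)
  case 0
  then show ?case using z by simp
next
  case (Suc k)
  then have "Suc k \<in> A \<union> B \<longleftrightarrow> digit \<gamma> (Suc k) \<noteq> 0"
    "Tk_single s k \<gamma> z = jet s A B k (vzero s) (vzero s) (vzero s) z"
    by simp_all
  then show ?case using AB by (auto simp: Let_def)
qed

lemma jet_0_Prod [simp]:
  "jet (Prod s s') A B k (VPair (vzero s) (vzero s')) (VPair (vzero s) (vzero s'))
     (VPair (vzero s) (vzero s')) (VPair (vzero s) (vzero s')) =
     (vzero (Tk_shape k (Prod s s')) :: ('v::comm_monoid_add, 'k::comm_monoid_add) elt)"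
  using jet_0[of "Prod s s'" A B k] by simp

lemma Tk_zip_vzero [simp]:
  "Tk_zip k (vzero (Tk_shape k s)) (vzero (Tk_shape k s')) = vzero (Tk_shape k (Prod s s'))"
  by (induction k) auto

lemma Tk_zip_jet:
  fixes x u w z :: "('v::comm_monoid_add, 'k::comm_monoid_add) elt"
  shows "shape_of x = s \<Longrightarrow> shape_of u = s \<Longrightarrow> shape_of w = s \<Longrightarrow> shape_of z = s \<Longrightarrow>
    shape_of x' = s' \<Longrightarrow> shape_of u' = s' \<Longrightarrow> shape_of w' = s' \<Longrightarrow> shape_of z' = s' \<Longrightarrow>
    Tk_zip k (jet s A B k x u w z) (jet s' A B k x' u' w' z') =
      jet (Prod s s') A B k (VPair x x') (VPair u u') (VPair w w') (VPair z z')"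
proof (induction k arbitrary: x u w z x' u' w' z')
  case (Suc k)
  then show ?case by (auto simp: Let_def)
qed auto

lemma Int_atLeastAtMost_Suc: "A \<inter> {1..Suc k} = {} \<longleftrightarrow> Suc k \<notin> A \<and> A \<inter> {1..k} = {}"
  by (auto simp: atLeastAtMostSuc_conv)

context good_module
begin

lemma jet_vscale:
  "shape_of x = s \<Longrightarrow> shape_of u = s \<Longrightarrow> shape_of w = s \<Longrightarrow> shape_of z = s \<Longrightarrow>
    t *\<^sub>v jet s A B k x u w z = jet s A B k (t *\<^sub>v x) (t *\<^sub>v u) (t *\<^sub>v w) (t *\<^sub>v z)"
  by (induction k arbitrary: x u w z) (auto simp: Let_def vscale_vadd)

lemma jet_line:
  assumes "shape_of x = s" "shape_of u = s" "shape_of w = s" "shape_of z = s"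
    "shape_of x' = s" "shape_of u' = s" "shape_of w' = s" "shape_of z' = s"
  shows "jet s A B k x u w z +\<^sub>v t *\<^sub>v jet s A B k x' u' w' z' =
    jet s A B k (x +\<^sub>v t *\<^sub>v x') (u +\<^sub>v t *\<^sub>v u') (w +\<^sub>v t *\<^sub>v w') (z +\<^sub>v t *\<^sub>v z')"
  using assms by (simp add: jet_vscale jet_vadd)


lemma continuous_on_jet:
  fixes x u w z :: "'z::topological_space \<Rightarrow> ('v, 'k) elt"
  shows "continuous_on T x \<Longrightarrow> continuous_on T u \<Longrightarrow> continuous_on T w \<Longrightarrow> continuous_on T z \<Longrightarrow>
    (\<And>t. t \<in> T \<Longrightarrow> shape_of (x t) = s \<and> shape_of (u t) = s \<and> shape_of (w t) = s \<and> shape_of (z t) = s) \<Longrightarrow>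
    continuous_on T (\<lambda>t. jet s A B k (x t) (u t) (w t) (z t))"
proof (induction k arbitrary: x u w z)
  case 0
  then show ?case by (auto intro!: continuous_intros)
next
  case (Suc k)
  then show ?case
    by (cases "Suc k \<in> A"; cases "Suc k \<in> B") (auto simp: Let_def intro!: continuous_on_VPair Suc.IH continuous_on_const)
qed

lemma Tk_foot_base_jet:
  "shape_of (x :: ('v,'k) elt) = s \<Longrightarrow> Tk_foot k (jet s A B k x (vzero s) (vzero s) (vzero s)) = x"
  by (induction k) (auto simp: Let_def)

lemma Tk_foot_jet1:
  "shape_of (x :: ('v,'k) elt) = s \<Longrightarrow> shape_of u = s \<Longrightarrow>
    Tk_foot k (jet s A B k x u (vzero s) (vzero s)) = (if A \<inter> {1..k} = {} then x +\<^sub>v u else x)"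
proof (induction k)
  case (Suc k)
  show ?case using Suc by (auto simp: Let_def Tk_foot_base_jet Int_atLeastAtMost_Suc simp del: One_nat_def)
qed auto

context
  fixes s s' :: shape and U :: "('v, 'k) elt set" and f :: "('v, 'k) elt \<Rightarrow> ('v, 'k) elt"
  assumes f: "smooth_on sc s s' U f"
begin

abbreviation "D \<equiv> differential sc s s' U f"
abbreviation "F k \<equiv> Tk_map k sc s s' U f"
abbreviation "DF k \<equiv> differential sc (Tk_shape k s) (Tk_shape k s') (Tk_set k s U) (F k)"
abbreviation O1 :: "('v, 'k) elt" where "O1 \<equiv> vzero s"
abbreviation O2 :: "('v, 'k) elt" where "O2 \<equiv> vzero s'"

lemma Tk_set_jet1:
  assumes "x \<in> U" "shape_of u = s" "A \<inter> {1..k} = {} \<Longrightarrow> x +\<^sub>v u \<in> U"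
  shows "jet s A B k x u O1 O1 \<in> Tk_set k s U"
  using assms smooth_on_dom_shape[OF f assms(1)] by (simp add: Tk_set_iff[OF smooth_onD(1)[OF f]] Tk_foot_jet1)

lemma shape_values:
  "y \<in> U \<Longrightarrow> shape_of y = s" "y \<in> U \<Longrightarrow> shape_of (f y) = s'"
  "y \<in> U \<Longrightarrow> shape_of u = s \<Longrightarrow> shape_of (D y u) = s'" "y \<in> U \<Longrightarrow> D y O1 = O2"
  using smooth_on_dom_shape[OF f] smooth_on_shape[OF f] shape_differential[OF f] differential_vzero[OF f] by auto

text \<open>For one tangent direction, $T^kf(x + \varepsilon^A u) = f(x) + \varepsilon^A df(x)u$.
  Along the line $t \mapsto x + \varepsilon^A tu$ this gives the differential of $T^kf$ in the
  direction $\varepsilon^A u$, which is what the next tangent functor needs. If \<open>A\<close> is empty below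
  \<open>k\<close>, the line runs in the base, and the slope of \<open>f\<close> itself appears.\<close>

lemma differential_Tk_map_jet1_aux:
  assumes F: "\<And>u. shape_of u = s \<Longrightarrow> (A \<inter> {1..k} = {} \<Longrightarrow> x +\<^sub>v u \<in> U) \<Longrightarrow>
      F k (jet s A B k x u O1 O1) =
      (if A \<inter> {1..k} = {} then jet s' A B k (f (x +\<^sub>v u)) O2 O2 O2 else jet s' A B k (f x) (D x u) O2 O2)"
    and x: "x \<in> U" and u: "shape_of u = s"
  shows "DF k (jet s A B k x O1 O1 O1) (jet s A B k O1 u O1 O1) = jet s' A B k O2 (D x u) O2 O2"
proof -
  let ?p = "jet s A B k x O1 O1 O1" and ?q = "jet s A B k O1 u O1 O1"
  note sh = shape_values
  have p: "?p \<in> Tk_set k s U"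
    using Tk_set_jet1[OF x, of O1] sh(1)[OF x] x by simp
  have line: "?p +\<^sub>v t *\<^sub>v ?q = jet s A B k x (t *\<^sub>v u) O1 O1" for t
    using jet_line[of x s O1 O1 O1 O1 u O1 O1] u sh(1)[OF x] by simp
  have fp: "F k ?p = jet s' A B k (f x) O2 O2 O2"
    using F[of O1] x sh by (simp split: if_splits)
  have q: "shape_of ?q = Tk_shape k s" using u by simp
  show ?thesis
  proof (cases "A \<inter> {1..k} = {}")
    case True
    obtain G where G: "continuous_on {t. x +\<^sub>v t *\<^sub>v u \<in> U} G" "G 0 = D x u"
      "open {t. x +\<^sub>v t *\<^sub>v u \<in> U}" "0 \<in> {t. x +\<^sub>v t *\<^sub>v u \<in> U}"
      "\<forall>t\<in>{t. x +\<^sub>v t *\<^sub>v u \<in> U}. shape_of (G t) = s' \<and> f (x +\<^sub>v t *\<^sub>v u) = f x +\<^sub>v t *\<^sub>v G t"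
      using slope_line[OF f x u] by metis
    have "DF k ?p ?q = jet s' A B k (G 0) O2 O2 O2"
    proof (rule differential_eqI[OF smooth_on_Tk_map[OF f] p q G(3,4), where G = "\<lambda>t. jet s' A B k (G t) O2 O2 O2"])
      show "continuous_on {t. x +\<^sub>v t *\<^sub>v u \<in> U} (\<lambda>t. jet s' A B k (G t) O2 O2 O2)"
        by (intro continuous_on_jet G(1) continuous_on_const) (use G(5) in auto)
      fix t assume t: "t \<in> {t. x +\<^sub>v t *\<^sub>v u \<in> U}"
      have "F k (?p +\<^sub>v t *\<^sub>v ?q) = jet s' A B k (f (x +\<^sub>v t *\<^sub>v u)) O2 O2 O2"
        unfolding line using F[of "t *\<^sub>v u"] True t u by simp
      also have "\<dots> = F k ?p +\<^sub>v t *\<^sub>v jet s' A B k (G t) O2 O2 O2"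
        unfolding fp using G(5) t x sh by (subst jet_line) auto
      finally show "shape_of (jet s' A B k (G t) O2 O2 O2) = Tk_shape k s' \<and>
        F k (?p +\<^sub>v t *\<^sub>v ?q) = F k ?p +\<^sub>v t *\<^sub>v jet s' A B k (G t) O2 O2 O2"
        using G(5) t by simp
    qed
    then show ?thesis using jet_collapse[OF True, of O2 s' "D x u" O2 O2] sh(3)[OF x u] G(2) by simp
  next
    case False
    show ?thesis
    proof (rule differential_eqI[OF smooth_on_Tk_map[OF f] p q open_UNIV UNIV_I continuous_on_const])
      fix t
      have "F k (?p +\<^sub>v t *\<^sub>v ?q) = jet s' A B k (f x) (D x (t *\<^sub>v u)) O2 O2"
        unfolding line using F[of "t *\<^sub>v u"] False u by simp
      also have "\<dots> = F k ?p +\<^sub>v t *\<^sub>v jet s' A B k O2 (D x u) O2 O2"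
        unfolding fp using x u sh by (subst jet_line) (auto simp: differential_vscale[OF f])
      finally show "shape_of (jet s' A B k O2 (D x u) O2 O2) = Tk_shape k s' \<and>
        F k (?p +\<^sub>v t *\<^sub>v ?q) = F k ?p +\<^sub>v t *\<^sub>v jet s' A B k O2 (D x u) O2 O2"
        using sh(3)[OF x u] by simp
    qed
  qed
qed

lemma Tk_map_jet1:
  "x \<in> U \<Longrightarrow> shape_of u = s \<Longrightarrow> (A \<inter> {1..k} = {} \<Longrightarrow> x +\<^sub>v u \<in> U) \<Longrightarrow>
    F k (jet s A B k x u O1 O1) =
      (if A \<inter> {1..k} = {} then jet s' A B k (f (x +\<^sub>v u)) O2 O2 O2 else jet s' A B k (f x) (D x u) O2 O2)"
proof (induction k arbitrary: u)
  case 0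
  then show ?case using shape_values by simp
next
  case (Suc k)
  note sh = shape_values and x = Suc.prems(1)
  have *: "A \<inter> {1..Suc k} = {} \<longleftrightarrow> Suc k \<notin> A \<and> A \<inter> {1..k} = {}" by (rule Int_atLeastAtMost_Suc)
  have base: "F k (jet s A B k x O1 O1 O1) = jet s' A B k (f x) O2 O2 O2"
    using Suc.IH[of O1] x sh by (simp split: if_splits)
  show ?case
  proof (cases "Suc k \<in> A")
    case True
    have "jet s A B (Suc k) x u O1 O1 = VPair (jet s A B k x O1 O1 O1) (jet s A B k O1 u O1 O1)"
      using True by (simp add: Let_def)
    then have "F (Suc k) (jet s A B (Suc k) x u O1 O1) = VPair (jet s' A B k (f x) O2 O2 O2) (jet s' A B k O2 (D x u) O2 O2)"
      using base differential_Tk_map_jet1_aux[OF Suc.IH[OF x] x Suc.prems(2)] by simp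
    then show ?thesis using True * by (simp add: Let_def)
  next
    case False
    have "jet s A B (Suc k) x u O1 O1 = VPair (jet s A B k x u O1 O1) (vzero (Tk_shape k s))"
      using False by (simp add: Let_def)
    moreover have "jet s A B k x u O1 O1 \<in> Tk_set k s U"
      using Tk_set_jet1[OF x Suc.prems(2)] Suc.prems(3) False * by blast
    ultimately have "F (Suc k) (jet s A B (Suc k) x u O1 O1) = VPair (F k (jet s A B k x u O1 O1)) (vzero (Tk_shape k s'))"
      by (simp add: differential_vzero[OF smooth_on_Tk_map[OF f]])
    moreover have "F k (jet s A B k x u O1 O1) =
      (if A \<inter> {1..k} = {} then jet s' A B k (f (x +\<^sub>v u)) O2 O2 O2 else jet s' A B k (f x) (D x u) O2 O2)"
      using Suc.IH[OF x Suc.prems(2)] Suc.prems(3) False * by blast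
    ultimately show ?thesis using False * by (simp add: Let_def)
  qed
qed

lemma differential_Tk_map_jet1:
  assumes "x \<in> U" "shape_of u = s"
  shows "DF k (jet s A B k x O1 O1 O1) (jet s A B k O1 u O1 O1) = jet s' A B k O2 (D x u) O2 O2"
  using differential_Tk_map_jet1_aux[OF Tk_map_jet1[OF assms(1)] assms] .

lemma Tk_map_base_jet:
  assumes "x \<in> U" shows "F k (jet s A B k x O1 O1 O1) = jet s' A B k (f x) O2 O2 O2"
  using Tk_map_jet1[OF assms, of O1] assms shape_values by (simp split: if_splits)

lemma Tk_map_jet1':
  assumes "x \<in> U" "shape_of w = s" "B \<inter> {1..k} = {} \<Longrightarrow> x +\<^sub>v w \<in> U"
  shows "F k (jet s A B k x O1 w O1) =
      (if B \<inter> {1..k} = {} then jet s' A B k (f (x +\<^sub>v w)) O2 O2 O2 else jet s' A B k (f x) O2 (D x w) O2)"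
proof -
  have "jet s A B k x O1 w O1 = jet s B A k x w O1 O1" using assms shape_values by (simp add: jet_swap[of x s])
  moreover have "jet s' A B k (f x) O2 (D x w) O2 = jet s' B A k (f x) (D x w) O2 O2"
    using assms shape_values by (simp add: jet_swap[of "f x" s'])
  moreover have "B \<inter> {1..k} = {} \<Longrightarrow> jet s' A B k (f (x +\<^sub>v w)) O2 O2 O2 = jet s' B A k (f (x +\<^sub>v w)) O2 O2 O2"
    using assms(3) shape_values by (simp add: jet_swap[of "f (x +\<^sub>v w)" s'])
  ultimately show ?thesis using Tk_map_jet1[of x w B k A] assms by auto
qed

lemma Tk_foot_jet2:
  fixes x u w z :: "('v, 'k) elt"
  assumes "A \<inter> {1..k} \<noteq> {}" "B \<inter> {1..k} \<noteq> {}" "shape_of x = s" "shape_of u = s" "shape_of w = s" "shape_of z = s"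
  shows "Tk_foot k (jet s A B k x u w z) = x"
  using assms
proof (induction k arbitrary: u w z)
  case (Suc k)
  have 1: "Tk_foot k (jet s A B k x u O1 O1) = x" if "Suc k \<notin> A"
    using that Suc.prems Int_atLeastAtMost_Suc[of A k] by (simp add: Tk_foot_jet1 del: One_nat_def)
  have "Tk_foot k (jet s A B k x O1 w O1) = Tk_foot k (jet s B A k x w O1 O1)"
    using Suc.prems by (simp add: jet_swap[of x s])
  then have 2: "Tk_foot k (jet s A B k x O1 w O1) = x" if "Suc k \<notin> B"
    using that Suc.prems Int_atLeastAtMost_Suc[of B k] by (simp add: Tk_foot_jet1 del: One_nat_def)
  show ?case using Suc 1 2
    by (auto simp: Let_def Tk_foot_base_jet Int_atLeastAtMost_Suc simp del: One_nat_def)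
qed auto

lemma Tk_set_jet2:
  assumes "A \<inter> {1..k} \<noteq> {}" "B \<inter> {1..k} \<noteq> {}" "x \<in> U" "shape_of u = s" "shape_of w = s" "shape_of z = s"
  shows "jet s A B k x u w z \<in> Tk_set k s U"
  using assms shape_values(1) by (simp add: Tk_set_iff[OF smooth_onD(1)[OF f]] Tk_foot_jet2)

lemma Tk_map_Suc_vzero:
  assumes "p \<in> Tk_set k s U"
  shows "F (Suc k) (VPair p (vzero (Tk_shape k s))) = VPair (F k p) (vzero (Tk_shape k s'))"
  using assms by (simp add: differential_vzero[OF smooth_on_Tk_map[OF f]])

lemma Tk_map_jet_meeting_step:
  assumes A: "Suc k \<in> A" "Suc k \<notin> B" and AB: "A \<inter> B \<inter> {1..k} \<noteq> {}"
    and x: "x \<in> U" "shape_of u = s" "shape_of w = s"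
    and IH: "\<And>u. shape_of u = s \<Longrightarrow> F k (jet s A B k x u w O1) = jet s' A B k (f x) (D x u) (D x w) O2"
  shows "F (Suc k) (jet s A B (Suc k) x u w O1) = jet s' A B (Suc k) (f x) (D x u) (D x w) O2"
proof -
  note sh = shape_values
  have ne: "A \<inter> {1..k} \<noteq> {}" "B \<inter> {1..k} \<noteq> {}" using AB by auto
  have eq: "jet s A B (Suc k) x u w O1 = VPair (jet s A B k x O1 w O1) (jet s A B k O1 u O1 O1)"
    using A by (simp add: Let_def)
  have p: "jet s A B k x O1 w O1 \<in> Tk_set k s U" using Tk_set_jet2[OF ne x(1)] x by simp
  have fp: "F k (jet s A B k x O1 w O1) = jet s' A B k (f x) O2 (D x w) O2"
    using IH[of O1] sh x by simp
  have "DF k (jet s A B k x O1 w O1) (jet s A B k O1 u O1 O1) = jet s' A B k O2 (D x u) O2 O2"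
  proof (rule differential_eqI[OF smooth_on_Tk_map[OF f] p _ open_UNIV UNIV_I continuous_on_const])
    show "shape_of (jet s A B k O1 u O1 O1) = Tk_shape k s" using x by simp
    fix t
    have "jet s A B k x O1 w O1 +\<^sub>v t *\<^sub>v jet s A B k O1 u O1 O1 = jet s A B k x (t *\<^sub>v u) w O1"
      using x sh by (subst jet_line) auto
    then have "F k (jet s A B k x O1 w O1 +\<^sub>v t *\<^sub>v jet s A B k O1 u O1 O1) = jet s' A B k (f x) (D x (t *\<^sub>v u)) (D x w) O2"
      using IH[of "t *\<^sub>v u"] x by simp
    also have "\<dots> = F k (jet s A B k x O1 w O1) +\<^sub>v t *\<^sub>v jet s' A B k O2 (D x u) O2 O2"
      unfolding fp using x sh by (subst jet_line) (auto simp: differential_vscale[OF f])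
    finally show "shape_of (jet s' A B k O2 (D x u) O2 O2) = Tk_shape k s' \<and>
      F k (jet s A B k x O1 w O1 +\<^sub>v t *\<^sub>v jet s A B k O1 u O1 O1) =
      F k (jet s A B k x O1 w O1) +\<^sub>v t *\<^sub>v jet s' A B k O2 (D x u) O2 O2"
      using sh x by simp
  qed
  with eq fp A show ?thesis by (simp add: Let_def)
qed

text \<open>If \<open>A\<close> and \<open>B\<close> meet, then $\varepsilon^A \varepsilon^B = 0$, and the two directions do not
  interact: at the outermost common position, the differential of $T^kf$ is applied to the sum
  of the two directions, and it is additive.\<close>

lemma Tk_map_jet_meeting:
  "x \<in> U \<Longrightarrow> shape_of u = s \<Longrightarrow> shape_of w = s \<Longrightarrow> A \<inter> B \<inter> {1..k} \<noteq> {} \<Longrightarrow>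
    F k (jet s A B k x u w O1) = jet s' A B k (f x) (D x u) (D x w) O2"
proof (induction k arbitrary: u w A B)
  case (Suc k)
  note sh = shape_values and x = Suc.prems(1-3)
  consider "Suc k \<in> A" "Suc k \<in> B" | "Suc k \<in> A" "Suc k \<notin> B" "A \<inter> B \<inter> {1..k} \<noteq> {}"
    | "Suc k \<notin> A" "Suc k \<in> B" "A \<inter> B \<inter> {1..k} \<noteq> {}" | "Suc k \<notin> A" "Suc k \<notin> B" "A \<inter> B \<inter> {1..k} \<noteq> {}"
    using Suc.prems(4) by (auto simp: Int_atLeastAtMost_Suc simp del: One_nat_def)
  then show ?case
  proof cases
    case 1
    have eq: "jet s A B k O1 u w O1 = jet s A B k O1 u O1 O1 +\<^sub>v jet s A B k O1 O1 w O1"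
      using x by (simp add: jet_vadd)
    have p: "jet s A B k x O1 O1 O1 \<in> Tk_set k s U" using Tk_set_jet1[OF x(1), of O1] sh x by simp
    have "DF k (jet s A B k x O1 O1 O1) (jet s A B k O1 O1 w O1) = DF k (jet s B A k x O1 O1 O1) (jet s B A k O1 w O1 O1)"
      using x sh by (simp add: jet_swap[of x s] jet_swap[of O1 s])
    also have "\<dots> = jet s' B A k O2 (D x w) O2 O2" using differential_Tk_map_jet1[OF x(1,3)] .
    also have "\<dots> = jet s' A B k O2 O2 (D x w) O2" using x sh by (simp add: jet_swap[of O2 s'])
    finally have "DF k (jet s A B k x O1 O1 O1) (jet s A B k O1 u w O1) = jet s' A B k O2 (D x u) (D x w) O2"
      unfolding eq
      by (subst differential_vadd[OF smooth_on_Tk_map[OF f] p])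
        (use differential_Tk_map_jet1[OF x(1,2), of k A B] x sh in \<open>simp_all add: jet_vadd\<close>)
    then show ?thesis using 1 Tk_map_base_jet[OF x(1)] by (simp add: Let_def)
  next
    case 2
    show ?thesis by (rule Tk_map_jet_meeting_step[OF 2 x]) (use Suc.IH x 2 in auto)
  next
    case 3
    have "F (Suc k) (jet s B A (Suc k) x w u O1) = jet s' B A (Suc k) (f x) (D x w) (D x u) O2"
      by (rule Tk_map_jet_meeting_step) (use Suc.IH x 3 in \<open>auto simp: Int_commute\<close>)
    then show ?thesis using x sh jet_swap[of x s u w O1 A B "Suc k"] jet_swap[of "f x" s' "D x u" "D x w" O2 A B "Suc k"]
      by (simp del: jet.simps)
  next
    case 4
    have "A \<inter> {1..k} \<noteq> {}" "B \<inter> {1..k} \<noteq> {}" using 4(3) by auto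
    then have "jet s A B k x u w O1 \<in> Tk_set k s U" using Tk_set_jet2 x by simp
    then show ?thesis using Tk_map_Suc_vzero Suc.IH[OF x 4(3)] 4(1,2) by (simp add: Let_def)
  qed
qed auto

abbreviation "D2 \<equiv> differential2 s s' U f"

lemma shape_D2: "x \<in> U \<Longrightarrow> shape_of u = s \<Longrightarrow> shape_of w = s \<Longrightarrow> shape_of (D2 x u w) = s'"
  unfolding differential2_def using shape_differential[OF smooth_on_differential_dir[OF f]] .

lemma D2_vscale: "x \<in> U \<Longrightarrow> shape_of u = s \<Longrightarrow> shape_of w = s \<Longrightarrow> D2 x (t *\<^sub>v u) w = t *\<^sub>v D2 x u w"
  unfolding differential2_def using differential_vscale[OF smooth_on_differential_dir[OF f]] .

text \<open>If \<open>A\<close> and \<open>B\<close> are disjoint, the second differential enters at the innermost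
  position of one of them, if the other has positions further inside: there $df(x+tu)w$ is differentiated with respect to \<open>t\<close>. This
  lemma treats an outermost position that belongs to \<open>A\<close>; the other case follows by exchanging the
  roles of \<open>A\<close> and \<open>B\<close>, which is possible because the second differential is symmetric.\<close>

lemma Tk_map_jet_disjoint_step:
  assumes A: "Suc k \<in> A" "Suc k \<notin> B" and B: "B \<inter> {1..k} \<noteq> {}"
    and x: "x \<in> U" "shape_of u = s" "shape_of w = s" "shape_of z = s"
    and IH: "\<And>u z. A \<inter> {1..k} \<noteq> {} \<Longrightarrow> shape_of u = s \<Longrightarrow> shape_of z = s \<Longrightarrow>
       F k (jet s A B k x u w z) = jet s' A B k (f x) (D x u) (D x w) (D x z +\<^sub>v D2 x u w)"
  shows "F (Suc k) (jet s A B (Suc k) x u w z) = jet s' A B (Suc k) (f x) (D x u) (D x w) (D x z +\<^sub>v D2 x u w)"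
proof -
  note sh = shape_values and sh2 = shape_D2
  let ?p = "jet s A B k x O1 w O1" and ?q = "jet s A B k O1 u O1 z"
  have eq: "jet s A B (Suc k) x u w z = VPair ?p ?q" using A by (simp add: Let_def)
  have fp: "F k ?p = jet s' A B k (f x) O2 (D x w) O2"
    using Tk_map_jet1'[OF x(1,3)] B by auto
  have "Tk_foot k ?p = x"
  proof -
    have "?p = jet s B A k x w O1 O1" using x sh by (simp add: jet_swap[of x s])
    then show ?thesis using B x sh by (simp add: Tk_foot_jet1)
  qed
  then have p: "?p \<in> Tk_set k s U" using x sh by (simp add: Tk_set_iff[OF smooth_onD(1)[OF f]])
  have q: "shape_of ?q = Tk_shape k s" using x by simp
  have line: "?p +\<^sub>v t *\<^sub>v ?q = jet s A B k x (t *\<^sub>v u) w (t *\<^sub>v z)" for t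
    using x sh by (subst jet_line) auto
  have "DF k ?p ?q = jet s' A B k O2 (D x u) O2 (D x z +\<^sub>v D2 x u w)"
  proof (cases "A \<inter> {1..k} = {}")
    case False
    show ?thesis
    proof (rule differential_eqI[OF smooth_on_Tk_map[OF f] p q open_UNIV UNIV_I continuous_on_const])
      fix t
      have "F k (?p +\<^sub>v t *\<^sub>v ?q) = jet s' A B k (f x) (D x (t *\<^sub>v u)) (D x w) (D x (t *\<^sub>v z) +\<^sub>v D2 x (t *\<^sub>v u) w)"
        unfolding line using IH[OF False] x by simp
      also have "\<dots> = F k ?p +\<^sub>v t *\<^sub>v jet s' A B k O2 (D x u) O2 (D x z +\<^sub>v D2 x u w)"
        unfolding fp using x sh sh2 by (subst jet_line) (auto simp: differential_vscale[OF f] D2_vscale vscale_vadd)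
      finally show "shape_of (jet s' A B k O2 (D x u) O2 (D x z +\<^sub>v D2 x u w)) = Tk_shape k s' \<and>
        F k (?p +\<^sub>v t *\<^sub>v ?q) = F k ?p +\<^sub>v t *\<^sub>v jet s' A B k O2 (D x u) O2 (D x z +\<^sub>v D2 x u w)"
        using x sh sh2 by simp
    qed
  next
    case True
    \<comment> \<open>position \<open>Suc k\<close> is the innermost one of \<open>A\<close>, and the line runs in the base\<close>
    let ?T = "{t. x +\<^sub>v t *\<^sub>v u \<in> U}"
    obtain G where G: "continuous_on ?T G" "G 0 = D x u" "open ?T" "0 \<in> ?T"
      "\<forall>t\<in>?T. shape_of (G t) = s' \<and> f (x +\<^sub>v t *\<^sub>v u) = f x +\<^sub>v t *\<^sub>v G t"
      using slope_line[OF f x(1,2)] by metis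
    obtain H where H: "continuous_on ?T H" "H 0 = D2 x u w"
      "\<forall>t\<in>?T. shape_of (H t) = s' \<and> D (x +\<^sub>v t *\<^sub>v u) w = D x w +\<^sub>v t *\<^sub>v H t"
      using slope_line[OF smooth_on_differential_dir[OF f x(3)] x(1,2)] unfolding differential2_def by metis
    have Dz: "continuous_on ?T (\<lambda>t. D (x +\<^sub>v t *\<^sub>v u) z)"
      by (rule continuous_on_compose2[OF smooth_onD(4)[OF smooth_on_differential_dir[OF f x(4)]]])
        (use x sh in \<open>auto intro!: continuous_intros\<close>)
    let ?K = "\<lambda>t. jet s' A B k (G t) O2 (H t +\<^sub>v D (x +\<^sub>v t *\<^sub>v u) z) O2"
    have "DF k ?p ?q = ?K 0"
    proof (rule differential_eqI[OF smooth_on_Tk_map[OF f] p q G(3,4)])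
      show "continuous_on ?T ?K"
        by (intro continuous_on_jet continuous_intros G(1) H(1) Dz) (use G(5) H(3) x sh in auto)
      fix t assume t: "t \<in> ?T"
      then have tU: "x +\<^sub>v t *\<^sub>v u \<in> U" by simp
      have "?p +\<^sub>v t *\<^sub>v ?q = jet s A B k (x +\<^sub>v t *\<^sub>v u) O1 (w +\<^sub>v t *\<^sub>v z) O1"
        unfolding line using jet_collapse[OF True, of x s "t *\<^sub>v u" w "t *\<^sub>v z"] x sh by simp
      then have "F k (?p +\<^sub>v t *\<^sub>v ?q) = jet s' A B k (f (x +\<^sub>v t *\<^sub>v u)) O2 (D (x +\<^sub>v t *\<^sub>v u) (w +\<^sub>v t *\<^sub>v z)) O2"
        using Tk_map_jet1'[OF tU, of "w +\<^sub>v t *\<^sub>v z"] B x by simp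
      also have "D (x +\<^sub>v t *\<^sub>v u) (w +\<^sub>v t *\<^sub>v z) = D x w +\<^sub>v t *\<^sub>v (H t +\<^sub>v D (x +\<^sub>v t *\<^sub>v u) z)"
        using H(3) t tU x sh by (simp add: differential_vadd[OF f tU] differential_vscale[OF f tU] vscale_vadd vadd_assoc)
      also have "jet s' A B k (f (x +\<^sub>v t *\<^sub>v u)) O2 (D x w +\<^sub>v t *\<^sub>v (H t +\<^sub>v D (x +\<^sub>v t *\<^sub>v u) z)) O2 = F k ?p +\<^sub>v t *\<^sub>v ?K t"
        unfolding fp using G(5) H(3) t tU x sh by (subst jet_line) auto
      finally show "shape_of (?K t) = Tk_shape k s' \<and> F k (?p +\<^sub>v t *\<^sub>v ?q) = F k ?p +\<^sub>v t *\<^sub>v ?K t"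
        using G(5) H(3) t tU x sh by simp
    qed
    also have "?K 0 = jet s' A B k O2 (D x u) O2 (D x z +\<^sub>v D2 x u w)"
      using jet_collapse[OF True, of O2 s' "D x u" O2 "D x z +\<^sub>v D2 x u w"] x sh sh2
        vadd_commute[of "D x z" "D2 x u w"] by (simp add: G(2) H(2))
    finally show ?thesis .
  qed
  with eq fp A show ?thesis by (simp add: Let_def)
qed

lemma Tk_map_jet_disjoint:
  "x \<in> U \<Longrightarrow> shape_of u = s \<Longrightarrow> shape_of w = s \<Longrightarrow> shape_of z = s \<Longrightarrow>
    A \<inter> {1..k} \<noteq> {} \<Longrightarrow> B \<inter> {1..k} \<noteq> {} \<Longrightarrow> A \<inter> B = {} \<Longrightarrow>
    F k (jet s A B k x u w z) = jet s' A B k (f x) (D x u) (D x w) (D x z +\<^sub>v D2 x u w)"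
proof (induction k arbitrary: u w z A B)
  case (Suc k)
  note sh = shape_values and sh2 = shape_D2 and x = Suc.prems(1-4)
  have ne: "Suc k \<notin> A \<Longrightarrow> A \<inter> {1..k} \<noteq> {}" "Suc k \<notin> B \<Longrightarrow> B \<inter> {1..k} \<noteq> {}"
    using Suc.prems(5,6) Int_atLeastAtMost_Suc by blast+
  consider "Suc k \<in> A" "Suc k \<notin> B" | "Suc k \<notin> A" "Suc k \<in> B" | "Suc k \<notin> A" "Suc k \<notin> B"
    using Suc.prems(7) by auto
  then show ?case
  proof cases
    case 1
    show ?thesis
    proof (rule Tk_map_jet_disjoint_step[OF 1 ne(2)[OF 1(2)] x])
      fix u z :: "('v, 'k) elt" assume uz: "A \<inter> {1..k} \<noteq> {}" "shape_of u = s" "shape_of z = s"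
      show "F k (jet s A B k x u w z) = jet s' A B k (f x) (D x u) (D x w) (D x z +\<^sub>v D2 x u w)"
        by (rule Suc.IH[OF x(1) uz(2) x(3) uz(3,1) ne(2)[OF 1(2)] Suc.prems(7)])
    qed
  next
    case 2
    have "B \<inter> A = {}" using Suc.prems(7) by blast
    have "F (Suc k) (jet s B A (Suc k) x w u z) = jet s' B A (Suc k) (f x) (D x w) (D x u) (D x z +\<^sub>v D2 x w u)"
    proof (rule Tk_map_jet_disjoint_step[OF 2(2,1) ne(1)[OF 2(1)] x(1,3,2,4)])
      fix w z :: "('v, 'k) elt" assume wz: "B \<inter> {1..k} \<noteq> {}" "shape_of w = s" "shape_of z = s"
      show "F k (jet s B A k x w u z) = jet s' B A k (f x) (D x w) (D x u) (D x z +\<^sub>v D2 x w u)"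
        by (rule Suc.IH[OF x(1) wz(2) x(2) wz(3,1) ne(1)[OF 2(1)] \<open>B \<inter> A = {}\<close>])
    qed
    then show ?thesis
      using x sh sh2 jet_swap[of x s u w z A B "Suc k"] differential2_commute[OF f x(1-3)]
        jet_swap[of "f x" s' "D x u" "D x w" "D x z +\<^sub>v D2 x w u" A B "Suc k"]
      by (simp del: jet.simps)
  next
    case 3
    have "jet s A B k x u w z \<in> Tk_set k s U" using Tk_set_jet2[OF ne(1)[OF 3(1)] ne(2)[OF 3(2)]] x by simp
    then show ?thesis using Tk_map_Suc_vzero Suc.IH[OF x ne(1)[OF 3(1)] ne(2)[OF 3(2)] Suc.prems(7)] 3 by (simp add: Let_def)
  qed
qed auto

end

end

section \<open>Multi-indices as binary numbers\<close>

lemma digit_eq_bit: "digit \<alpha> i = of_bool (bit \<alpha> (i - 1))"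
  by (simp add: digit_def bit_iff_odd mod2_eq_if)

lemma disjoint_add_eq_or: "and \<alpha> \<beta> = 0 \<Longrightarrow> \<alpha> + \<beta> = or \<alpha> (\<beta>::nat)"
  by (rule disjunctive_add_eq_or)

lemma and_eq_0_iff: "and \<alpha> \<beta> = 0 \<longleftrightarrow> (\<forall>n. \<not> (bit \<alpha> n \<and> bit (\<beta>::nat) n))"
  by (auto simp: bit_eq_iff bit_simps)

lemma digit_eq_0_1: "digit \<alpha> i = 0 \<longleftrightarrow> \<not> bit \<alpha> (i - 1)" "digit \<alpha> i = 1 \<longleftrightarrow> bit \<alpha> (i - 1)"
  by (simp_all add: digit_eq_bit)

lemma digit_add: "and \<alpha> \<beta> = 0 \<Longrightarrow> digit (\<alpha> + \<beta>) i = digit \<alpha> i + digit \<beta> i"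
  by (auto simp: digit_eq_bit disjoint_add_eq_or bit_simps and_eq_0_iff)

lemma disjoint_add_less_power:
  assumes "and \<alpha> \<beta> = 0" "\<alpha> < 2 ^ k" "\<beta> < (2::nat) ^ k"
  shows "\<alpha> + \<beta> < 2 ^ k"
proof -
  have "take_bit k (or \<alpha> \<beta>) = or \<alpha> \<beta>" using assms(2,3) by (simp add: take_bit_or take_bit_nat_eq_self)
  then have "or \<alpha> \<beta> < 2 ^ k" by (metis take_bit_nat_less_exp)
  then show ?thesis using assms(1) by (simp add: disjoint_add_eq_or)
qed

lemma bit_less_power: "\<alpha> < 2 ^ k \<Longrightarrow> bit (\<alpha>::nat) n \<Longrightarrow> n < k"
  by (metis bit_take_bit_iff take_bit_nat_eq_self_iff)

text \<open>Disjoint multi-indices are ordered by their highest positions, and the highest position of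
  $a + b$ is that of \<open>a\<close> or that of \<open>b\<close>.\<close>

lemma disjoint_add_less:
  "and a b = 0 \<Longrightarrow> and a c = 0 \<Longrightarrow> and b c = 0 \<Longrightarrow> a < c \<Longrightarrow> b < c \<Longrightarrow> a + b < (c::nat)"
proof (induction c arbitrary: a b rule: less_induct)
  case (less c)
  have h: "and (x div 2) (y div 2) = 0" "odd x \<Longrightarrow> even y" if "and x y = 0" for x y :: nat
    using that by (simp add: and_eq_0_iff flip: bit_Suc) (metis and_eq_0_iff bit_0 that)
  have d: "x = 2 * (x div 2) + x mod 2" for x :: nat by simp
  show ?case
  proof (cases "a div 2 = c div 2 \<or> b div 2 = c div 2")
    case True
    then have "c div 2 = 0" using h(1)[OF less.prems(2)] h(1)[OF less.prems(3)] by auto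
    then show ?thesis using less.prems(4,5) by linarith
  next
    case False
    moreover have "a div 2 \<le> c div 2" "b div 2 \<le> c div 2" using less.prems(4,5) div_le_mono by simp_all
    ultimately have "a div 2 < c div 2" "b div 2 < c div 2" by linarith+
    moreover have "c div 2 < c" using less.prems(4) by simp
    ultimately have "a div 2 + b div 2 < c div 2"
      by (intro less.IH h(1)[OF less.prems(1)] h(1)[OF less.prems(2)] h(1)[OF less.prems(3)])
    moreover have "a mod 2 + b mod 2 \<le> 1" using h(2)[OF less.prems(1)] by (auto simp: mod2_eq_if)
    ultimately show ?thesis using d[of a] d[of b] d[of c] by linarith
  qed
qed

lemma and_add_left: "and a b = 0 \<Longrightarrow> and (a + b) c = 0 \<longleftrightarrow> and a c = 0 \<and> and b (c::nat) = 0"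
  by (auto simp: disjoint_add_eq_or and_eq_0_iff bit_simps)

section \<open>Sums over partitions\<close>

text \<open>Partitions of arbitrary length; the partition of length one accounts for the summand that
  stands outside of the sums over partitions in the formulas.\<close>

definition partition_lists :: "nat \<Rightarrow> nat \<Rightarrow> nat list set" where
  "partition_lists k \<gamma> = {ls. ls \<noteq> [] \<and> set ls \<subseteq> {0<..<2 ^ k} \<and> sorted_wrt (<) ls \<and>
     (\<forall>i\<in>{1..k}. (\<Sum>l\<leftarrow>ls. digit l i) = digit \<gamma> i)}"

lemma digit_le_1: "digit \<alpha> i \<le> 1"
  by (simp add: digit_eq_bit)

lemma digit_eqI:
  assumes "\<alpha> < 2 ^ k" "\<beta> < 2 ^ k" "\<And>i. i \<in> {1..k} \<Longrightarrow> digit \<alpha> i = digit \<beta> i"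
  shows "\<alpha> = \<beta>"
proof (rule bit_eqI)
  fix n
  show "bit \<alpha> n = bit \<beta> n"
  proof (cases "n < k")
    case True
    then show ?thesis using assms(3)[of "Suc n"] digit_eq_0_1(2)[of _ "Suc n"] by (simp del: One_nat_def) (metis One_nat_def diff_Suc_1)
  next
    case False
    then show ?thesis using bit_less_power assms by metis
  qed
qed

text \<open>If the digits of \<open>\<beta>\<close> are part of the digits of \<open>\<gamma>\<close>, then the subtraction $\gamma - \beta$
  has no carries.\<close>

lemma digit_difference:
  assumes "\<beta> < 2 ^ k" "\<gamma> < 2 ^ k" "\<And>i. i \<in> {1..k} \<Longrightarrow> digit \<beta> i + r i = digit \<gamma> i"
  shows "\<beta> \<le> \<gamma>" "and (\<gamma> - \<beta>) \<beta> = 0" "\<And>i. i \<in> {1..k} \<Longrightarrow> r i = digit (\<gamma> - \<beta>) i"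
proof -
  define \<alpha> where "\<alpha> = xor \<gamma> \<beta>"
  have "bit \<beta> n \<Longrightarrow> bit \<gamma> n" for n
    using assms(3)[of "Suc n"] bit_less_power[OF assms(1), of n]
    by (cases "bit \<gamma> n") (auto simp: digit_eq_bit)
  then have "and \<alpha> \<beta> = 0" "or \<alpha> \<beta> = \<gamma>"
    by (auto simp: and_eq_0_iff \<alpha>_def bit_simps intro!: bit_eqI)
  then have "\<gamma> = \<alpha> + \<beta>" by (simp add: disjoint_add_eq_or)
  with \<open>and \<alpha> \<beta> = 0\<close> show "\<beta> \<le> \<gamma>" "and (\<gamma> - \<beta>) \<beta> = 0" by auto
  show "r i = digit (\<gamma> - \<beta>) i" if "i \<in> {1..k}" for i
    using assms(3)[OF that] digit_add[OF \<open>and \<alpha> \<beta> = 0\<close>, of i] \<open>\<gamma> = \<alpha> + \<beta>\<close> by simp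
qed

lemma digit_nonzero_ex:
  assumes "0 < \<alpha>" "\<alpha> < 2 ^ k" shows "\<exists>i\<in>{1..k}. digit \<alpha> i = 1"
proof (rule ccontr)
  assume "\<not> ?thesis"
  then have "\<And>i. i \<in> {1..k} \<Longrightarrow> digit \<alpha> i = digit 0 i"
    by (metis bit_0_eq bot_apply digit_eq_0_1 bot_bool_def)
  then have "\<alpha> = 0" using digit_eqI[OF assms(2), of 0] by simp
  with assms show False by simp
qed

lemma length_le_weight:
  assumes "set ls \<subseteq> {0<..<2 ^ k}" "\<And>i. i \<in> {1..k} \<Longrightarrow> (\<Sum>l\<leftarrow>ls. digit l i) = digit \<gamma> i"
  shows "length ls \<le> weight k \<gamma>"
proof -
  have "1 \<le> weight k l" if "l \<in> set ls" for l
  proof -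
    have "0 < l" "l < 2 ^ k" using assms(1) that by auto
    then obtain i where i: "i \<in> {1..k}" "digit l i = 1" using digit_nonzero_ex by blast
    then have "digit l i \<le> weight k l" unfolding weight_def by (intro member_le_sum) auto
    with i show ?thesis by simp
  qed
  then have "(\<Sum>l\<leftarrow>ls. 1) \<le> (\<Sum>l\<leftarrow>ls. weight k l)" by (rule sum_list_mono)
  then have "length ls \<le> (\<Sum>l\<leftarrow>ls. weight k l)" by (simp add: sum_list_triv)
  also have "\<dots> = (\<Sum>i=1..k. \<Sum>l\<leftarrow>ls. digit l i)"
    unfolding weight_def by (induction ls) (auto simp: sum.distrib)
  also have "\<dots> = weight k \<gamma>" unfolding weight_def by (intro sum.cong) (use assms(2) in auto)
  finally show ?thesis .
qed

lemma partition_lists_eq_UN: "partition_lists k \<gamma> = (\<Union>m\<in>{1..weight k \<gamma>}. partitions k m \<gamma>)"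
proof -
  have "ls \<in> partition_lists k \<gamma> \<longleftrightarrow> (\<exists>m\<in>{1..weight k \<gamma>}. ls \<in> partitions k m \<gamma>)" for ls
    using length_le_weight[of ls k \<gamma>] by (cases ls) (auto simp: partition_lists_def partitions_def)
  then show ?thesis by blast
qed

lemma finite_partitions: "finite (partitions k m \<gamma>)"
proof (rule finite_subset)
  show "partitions k m \<gamma> \<subseteq> {ls. set ls \<subseteq> {0<..<(2::nat) ^ k} \<and> length ls = m}"
    by (auto simp: partitions_def)
  show "finite {ls. set ls \<subseteq> {0<..<(2::nat) ^ k} \<and> length ls = m}"
    by (rule finite_lists_length_eq) simp
qed

lemma finite_partition_lists: "finite (partition_lists k \<gamma>)"
  by (simp add: partition_lists_eq_UN finite_partitions)

lemma partitions_1: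
  assumes "0 < \<gamma>" "\<gamma> < 2 ^ k" shows "partitions k 1 \<gamma> = {[\<gamma>]}"
proof -
  have "ls \<in> partitions k 1 \<gamma> \<longleftrightarrow> ls = [\<gamma>]" for ls
    using assms digit_eqI[OF _ assms(2)]
    by (cases ls) (auto simp: partitions_def)
  then show ?thesis by auto
qed

lemma weight_pos: "0 < \<gamma> \<Longrightarrow> \<gamma> < 2 ^ k \<Longrightarrow> 1 \<le> weight k \<gamma>"
  using length_le_weight[of "[\<gamma>]" k \<gamma>] by simp

lemma sum_partition_lists:
  fixes F :: "nat list \<Rightarrow> 'v::comm_monoid_add"
  assumes "0 < \<gamma>" "\<gamma> < 2 ^ k"
  shows "(\<Sum>l\<in>partition_lists k \<gamma>. F l) = F [\<gamma>] + (\<Sum>m\<in>{2..weight k \<gamma>}. \<Sum>l\<in>partitions k m \<gamma>. F l)"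
proof -
  have "(\<Sum>l\<in>partition_lists k \<gamma>. F l) = (\<Sum>m\<in>{1..weight k \<gamma>}. \<Sum>l\<in>partitions k m \<gamma>. F l)"
    unfolding partition_lists_eq_UN
  proof (rule sum.UNION_disjoint)
    show "\<forall>i\<in>{1..weight k \<gamma>}. finite (partitions k i \<gamma>)" by (simp add: finite_partitions)
  qed (auto simp: partitions_def)
  also have "{1..weight k \<gamma>} = insert 1 {2..weight k \<gamma>}" using weight_pos[OF assms] by auto
  also have "(\<Sum>m\<in>insert 1 {2..weight k \<gamma>}. \<Sum>l\<in>partitions k m \<gamma>. F l) =
      F [\<gamma>] + (\<Sum>m\<in>{2..weight k \<gamma>}. \<Sum>l\<in>partitions k m \<gamma>. F l)"
    using partitions_1[OF assms] by (subst sum.insert) auto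
  finally show ?thesis .
qed

text \<open>The members of a partition are disjoint, so that the others form a partition of the
  difference.\<close>

lemma partition_lists_Cons_iff:
  assumes b: "0 < b" "b < 2 ^ k" and g: "\<gamma> < 2 ^ k" and l: "l \<noteq> []"
  shows "b # l \<in> partition_lists k \<gamma> \<longleftrightarrow>
    l \<in> partition_lists k (\<gamma> - b) \<and> (\<forall>x\<in>set l. b < x) \<and> b \<le> \<gamma> \<and> and (\<gamma> - b) b = 0"
proof
  assume "b # l \<in> partition_lists k \<gamma>"
  then have d: "\<And>i. i \<in> {1..k} \<Longrightarrow> digit b i + (\<Sum>l\<leftarrow>l. digit l i) = digit \<gamma> i"
    and "set l \<subseteq> {0<..<2 ^ k}" "sorted_wrt (<) (b # l)" by (auto simp: partition_lists_def)
  with l show "l \<in> partition_lists k (\<gamma> - b) \<and> (\<forall>x\<in>set l. b < x) \<and> b \<le> \<gamma> \<and> and (\<gamma> - b) b = 0"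
    using digit_difference[OF b(2) g d] by (auto simp: partition_lists_def)
next
  assume *: "l \<in> partition_lists k (\<gamma> - b) \<and> (\<forall>x\<in>set l. b < x) \<and> b \<le> \<gamma> \<and> and (\<gamma> - b) b = 0"
  have "digit \<gamma> i = digit (\<gamma> - b) i + digit b i" for i
    using digit_add[of "\<gamma> - b" b i] * by simp
  with * b show "b # l \<in> partition_lists k \<gamma>" by (auto simp: partition_lists_def)
qed

text \<open>The entry before the last one may be inserted and removed as well, as long as the list
  stays increasing.\<close>

lemma partition_lists_insert_iff:
  assumes b: "0 < b" "b < 2 ^ k" and g: "\<gamma> < 2 ^ k"
  shows "l @ [b, t] \<in> partition_lists k \<gamma> \<longleftrightarrow>
    l @ [t] \<in> partition_lists k (\<gamma> - b) \<and> (\<forall>x\<in>set l. x < b) \<and> b < t \<and> b \<le> \<gamma> \<and> and (\<gamma> - b) b = 0"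
proof
  assume "l @ [b, t] \<in> partition_lists k \<gamma>"
  then have d: "\<And>i. i \<in> {1..k} \<Longrightarrow> digit b i + (\<Sum>l\<leftarrow>l@[t]. digit l i) = digit \<gamma> i"
    and "set (l @ [t]) \<subseteq> {0<..<2 ^ k}" "sorted_wrt (<) (l @ [b, t])"
    by (auto simp: partition_lists_def add_ac)
  then show "l @ [t] \<in> partition_lists k (\<gamma> - b) \<and> (\<forall>x\<in>set l. x < b) \<and> b < t \<and> b \<le> \<gamma> \<and> and (\<gamma> - b) b = 0"
    using digit_difference[OF b(2) g d] by (auto simp: partition_lists_def sorted_wrt_append)
next
  assume *: "l @ [t] \<in> partition_lists k (\<gamma> - b) \<and> (\<forall>x\<in>set l. x < b) \<and> b < t \<and> b \<le> \<gamma> \<and> and (\<gamma> - b) b = 0"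
  have "digit \<gamma> i = digit (\<gamma> - b) i + digit b i" for i
    using digit_add[of "\<gamma> - b" b i] * by simp
  with * b show "l @ [b, t] \<in> partition_lists k \<gamma>" by (auto simp: partition_lists_def sorted_wrt_append add_ac)
qed

lemma partition_lists_single:
  assumes "0 < \<gamma>" "\<gamma> < 2 ^ k" shows "[t] \<in> partition_lists k \<gamma> \<longleftrightarrow> t = \<gamma>"
  using assms digit_eqI[OF _ assms(2), of t] by (auto simp: partition_lists_def)

lemma partition_lists_le:
  assumes "l \<in> partition_lists k \<gamma>" "\<gamma> < 2 ^ k" "x \<in> set l" shows "x \<le> \<gamma>"
  using assms
proof (induction l arbitrary: \<gamma> x)
  case (Cons b l)
  have b: "0 < b" "b < 2 ^ k" using Cons.prems(1) by (auto simp: partition_lists_def)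
  show ?case
  proof (cases "l = []")
    case True
    have "digit b i = digit \<gamma> i" if "i \<in> {1..k}" for i
      using Cons.prems(1) True that by (auto simp: partition_lists_def)
    then show ?thesis using digit_eqI[OF b(2) Cons.prems(2)] Cons.prems True by simp
  next
    case False
    then have *: "l \<in> partition_lists k (\<gamma> - b)" "b \<le> \<gamma>"
      using partition_lists_Cons_iff[OF b Cons.prems(2)] Cons.prems(1) by auto
    show ?thesis
    proof (cases "x = b")
      case True
      then show ?thesis using * by simp
    next
      case False
      then have "x \<le> \<gamma> - b" using Cons.IH[OF *(1), of x] Cons.prems(2,3) by auto
      then show ?thesis by simp
    qed
  qed
qed (simp add: partition_lists_def)

text \<open>Iteration of \<open>disjoint_add_less\<close> over the entries.\<close>

lemma partition_lists_sum_less: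
  assumes "l \<in> partition_lists k \<gamma>" "\<gamma> < 2 ^ k" "\<And>x. x \<in> set l \<Longrightarrow> x < b" "and \<gamma> b = 0"
  shows "\<gamma> < b"
  using assms
proof (induction l arbitrary: \<gamma>)
  case (Cons a l)
  have a: "0 < a" "a < 2 ^ k" using Cons.prems(1) by (auto simp: partition_lists_def)
  show ?case
  proof (cases "l = []")
    case True
    have "digit a i = digit \<gamma> i" if "i \<in> {1..k}" for i
      using Cons.prems(1) True that by (auto simp: partition_lists_def)
    then show ?thesis using digit_eqI[OF a(2) Cons.prems(2)] Cons.prems(3) by simp
  next
    case False
    then have *: "l \<in> partition_lists k (\<gamma> - a)" "a \<le> \<gamma>" "and (\<gamma> - a) a = 0"
      using partition_lists_Cons_iff[OF a Cons.prems(2)] Cons.prems(1) by auto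
    have d: "and (\<gamma> - a) b = 0" "and a b = 0" using and_add_left[OF *(3), of b] *(2) Cons.prems(4) by auto
    have "\<gamma> - a < b" by (rule Cons.IH[OF *(1)]) (use Cons.prems d in auto)
    then have "(\<gamma> - a) + a < b" by (intro disjoint_add_less * d) (use Cons.prems in auto)
    then show ?thesis using * by simp
  qed
qed (simp add: partition_lists_def)

section \<open>Collecting factors in filtered groups\<close>

text \<open>The properties of the elements $\varepsilon^\alpha v$ of the fiber over the unit that
  determine the group structure: \<open>e\<close> is additive, factors whose indices have a common position
  commute, factors with disjoint indices commute up to a bracket, and the lowest non-zero
  component \<open>co\<close> of an element is additive.\<close>

locale filtered_group = group H for H :: "('a, 'b) monoid_scheme" (structure) +
  fixes k :: nat and e :: "nat \<Rightarrow> 'v::ab_group_add \<Rightarrow> 'a" and br :: "'v \<Rightarrow> 'v \<Rightarrow> 'v"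
    and co :: "nat \<Rightarrow> 'a \<Rightarrow> 'v"
  assumes e_closed: "0 < \<alpha> \<Longrightarrow> \<alpha> < 2 ^ k \<Longrightarrow> e \<alpha> x \<in> carrier H"
    and e_add: "0 < \<alpha> \<Longrightarrow> \<alpha> < 2 ^ k \<Longrightarrow> e \<alpha> x \<otimes> e \<alpha> y = e \<alpha> (x + y)"
    and e_commute: "0 < \<alpha> \<Longrightarrow> \<alpha> < 2 ^ k \<Longrightarrow> 0 < \<beta> \<Longrightarrow> \<beta> < 2 ^ k \<Longrightarrow> and \<alpha> \<beta> \<noteq> 0 \<Longrightarrow>
      e \<alpha> x \<otimes> e \<beta> y = e \<beta> y \<otimes> e \<alpha> x"
    and e_exchange: "0 < \<alpha> \<Longrightarrow> \<alpha> < 2 ^ k \<Longrightarrow> 0 < \<beta> \<Longrightarrow> \<beta> < 2 ^ k \<Longrightarrow> and \<alpha> \<beta> = 0 \<Longrightarrow>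
      e \<alpha> x \<otimes> e \<beta> y = e \<beta> y \<otimes> e \<alpha> x \<otimes> e (\<alpha> + \<beta>) (br x y)"
    and br_add_left: "br (x + x') y = br x y + br x' y"
    and br_add_right: "br x (y + y') = br x y + br x y'"
    and co_mult: "0 < \<gamma> \<Longrightarrow> \<gamma> < 2 ^ k \<Longrightarrow> p \<in> carrier H \<Longrightarrow> q \<in> carrier H \<Longrightarrow>
      (\<And>\<alpha>. 0 < \<alpha> \<Longrightarrow> \<alpha> < \<gamma> \<Longrightarrow> co \<alpha> p = 0 \<and> co \<alpha> q = 0) \<Longrightarrow> co \<gamma> (p \<otimes> q) = co \<gamma> p + co \<gamma> q"
    and co_e: "0 < \<gamma> \<Longrightarrow> \<gamma> < 2 ^ k \<Longrightarrow> 0 < \<alpha> \<Longrightarrow> \<alpha> < 2 ^ k \<Longrightarrow> co \<gamma> (e \<alpha> x) = (if \<alpha> = \<gamma> then x else 0)"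
begin

lemma br_0_left [simp]: "br 0 y = 0"
  using br_add_left[of 0 0 y] by simp

lemma br_0_right [simp]: "br x 0 = 0"
  using br_add_right[of x 0 0] by simp

lemma br_minus_right: "br x (- y) = - br x y"
  using br_add_right[of x y "- y"] by (simp add: minus_unique)

lemma br_minus_left: "br (- x) y = - br x y"
  using br_add_left[of x "- x" y] by (simp add: minus_unique)

lemma br_sum_left: "br (sum f A) y = (\<Sum>a\<in>A. br (f a) y)"
  by (induction A rule: infinite_finite_induct) (auto simp: br_add_left)

lemma e_0 [simp]: "0 < \<alpha> \<Longrightarrow> \<alpha> < 2 ^ k \<Longrightarrow> e \<alpha> 0 = \<one>"
  using e_add[of \<alpha> 0 0] e_closed[of \<alpha> 0] by (simp add: l_cancel_one)

lemma e_inv: "0 < \<alpha> \<Longrightarrow> \<alpha> < 2 ^ k \<Longrightarrow> inv (e \<alpha> x) = e \<alpha> (- x)"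
  using e_add[of \<alpha> "- x" x] by (intro inv_equality) (auto simp: e_closed)

definition ordered_prod :: "nat list \<Rightarrow> (nat \<Rightarrow> 'v) \<Rightarrow> 'a" where
  "ordered_prod l v = foldr (\<otimes>) (map (\<lambda>\<alpha>. e \<alpha> (v \<alpha>)) l) \<one>"

lemma ordered_prod_simps [simp]:
  "ordered_prod [] v = \<one>" "ordered_prod (\<alpha> # l) v = e \<alpha> (v \<alpha>) \<otimes> ordered_prod l v"
  by (simp_all add: ordered_prod_def)

lemma ordered_prod_closed [simp]: "set l \<subseteq> {0<..<2 ^ k} \<Longrightarrow> ordered_prod l v \<in> carrier H"
  by (induction l) (auto simp: e_closed)

lemma ordered_prod_upt_closed [simp]: "0 < n \<Longrightarrow> ordered_prod [n..<2 ^ k] v \<in> carrier H"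
  by (rule ordered_prod_closed) auto

lemma ordered_prod_append:
  "set l \<subseteq> {0<..<2 ^ k} \<Longrightarrow> set l' \<subseteq> {0<..<2 ^ k} \<Longrightarrow>
    ordered_prod (l @ l') v = ordered_prod l v \<otimes> ordered_prod l' v"
  by (induction l) (auto simp: e_closed m_assoc)

lemma ordered_prod_cong: "(\<And>\<alpha>. \<alpha> \<in> set l \<Longrightarrow> v \<alpha> = w \<alpha>) \<Longrightarrow> ordered_prod l v = ordered_prod l w"
  unfolding ordered_prod_def by (metis (mono_tags, lifting) map_eq_conv)

lemma ordered_prod_rec:
  "n < m \<Longrightarrow> ordered_prod [n..<m] v = e n (v n) \<otimes> ordered_prod [Suc n..<m] v"
  by (simp add: upt_rec[of n m])

text \<open>A factor can be moved to its place if it commutes with all factors on the way.\<close>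

lemma insert_central_factor:
  assumes "0 < n" "n \<le> \<delta>" "\<delta> < 2 ^ k" "\<And>\<alpha>. n \<le> \<alpha> \<Longrightarrow> \<alpha> < \<delta> \<Longrightarrow> and \<alpha> \<delta> \<noteq> 0"
  shows "e \<delta> b \<otimes> ordered_prod [n..<2 ^ k] u = ordered_prod [n..<2 ^ k] (u(\<delta> := u \<delta> + b))"
  using assms(2,1,4)
proof (induction rule: inc_induct)
  case base
  let ?u = "u(\<delta> := u \<delta> + b)"
  have "e \<delta> b \<otimes> ordered_prod [\<delta>..<2 ^ k] u = (e \<delta> b \<otimes> e \<delta> (u \<delta>)) \<otimes> ordered_prod [Suc \<delta>..<2 ^ k] u"
    using assms(3) base by (simp add: ordered_prod_rec[of \<delta>] e_closed m_assoc)
  also have "e \<delta> b \<otimes> e \<delta> (u \<delta>) = e \<delta> (?u \<delta>)" using assms(3) base by (simp add: e_add add.commute)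
  also have "ordered_prod [Suc \<delta>..<2 ^ k] u = ordered_prod [Suc \<delta>..<2 ^ k] ?u"
    by (rule ordered_prod_cong) auto
  also have "e \<delta> (?u \<delta>) \<otimes> ordered_prod [Suc \<delta>..<2 ^ k] ?u = ordered_prod [\<delta>..<2 ^ k] ?u"
    using assms(3) by (simp only: ordered_prod_rec[of \<delta>])
  finally show ?case .
next
  case (step n)
  have n: "n < 2 ^ k" "\<delta> > 0" using step assms(3) by auto
  have "e \<delta> b \<otimes> ordered_prod [n..<2 ^ k] u = e \<delta> b \<otimes> e n (u n) \<otimes> ordered_prod [Suc n..<2 ^ k] u"
    using n step assms(3) by (simp add: ordered_prod_rec[of n] e_closed m_assoc)
  also have "e \<delta> b \<otimes> e n (u n) = e n (u n) \<otimes> e \<delta> b"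
    using step.prems(2)[of n] step n assms(3) by (intro e_commute[symmetric]) auto
  also have "e n (u n) \<otimes> e \<delta> b \<otimes> ordered_prod [Suc n..<2 ^ k] u =
      e n (u n) \<otimes> ordered_prod [Suc n..<2 ^ k] (u(\<delta> := u \<delta> + b))"
    using n step assms(3) by (simp add: e_closed m_assoc fun_upd_def)
  also have "\<dots> = ordered_prod [n..<2 ^ k] (u(\<delta> := u \<delta> + b))"
    using n step by (simp add: ordered_prod_rec[of n])
  finally show ?case .
qed

text \<open>The coordinates of an ordered product after multiplication with $\varepsilon^\beta y$ from the
  right. As \<open>-\<close> is truncated on natural numbers, $\beta < \gamma - \beta$ includes
  $\beta \le \gamma$.\<close>

definition collect :: "nat \<Rightarrow> 'v \<Rightarrow> (nat \<Rightarrow> 'v) \<Rightarrow> nat \<Rightarrow> 'v" where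
  "collect \<beta> y v \<gamma> = v \<gamma> + (if \<gamma> = \<beta> then y
     else if \<beta> < \<gamma> - \<beta> \<and> and (\<gamma> - \<beta>) \<beta> = 0 then br (v (\<gamma> - \<beta>)) y else 0)"

text \<open>Moving $\varepsilon^\beta y$ to the left past $\varepsilon^\alpha v_\alpha$ produces the
  factor $\varepsilon^{\alpha+\beta}[v_\alpha, y]$. It can be moved to its place without producing
  further factors: an index between \<open>\<alpha>\<close> and \<open>\<alpha> + \<beta>\<close> meets \<open>\<alpha> + \<beta>\<close>, because disjoint
  indices are ordered by their highest positions.\<close>

lemma move_left:
  assumes \<beta>: "0 < \<beta>" "\<beta> < 2 ^ k" and n: "\<beta> < n" "n \<le> 2 ^ k"
  shows "ordered_prod [n..<2 ^ k] v \<otimes> e \<beta> y = e \<beta> y \<otimes> ordered_prod [n..<2 ^ k]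
    (\<lambda>\<gamma>. v \<gamma> + (if n \<le> \<gamma> - \<beta> \<and> and (\<gamma> - \<beta>) \<beta> = 0 then br (v (\<gamma> - \<beta>)) y else 0))"
  using n(2,1)
proof (induction rule: inc_induct)
  case base
  then show ?case using \<beta> by (simp add: e_closed)
next
  case (step n)
  define u where "u n = (\<lambda>\<gamma>. v \<gamma> + (if n \<le> \<gamma> - \<beta> \<and> and (\<gamma> - \<beta>) \<beta> = 0 then br (v (\<gamma> - \<beta>)) y else 0))" for n
  have n: "0 < n" "n < 2 ^ k" "\<beta> < n" using step by auto
  have cl: "e n x \<in> carrier H" "e \<beta> x \<in> carrier H" "ordered_prod [Suc n..<2 ^ k] x' \<in> carrier H" for x x'
    using n \<beta> by (auto simp: e_closed)
  have "ordered_prod [n..<2 ^ k] v \<otimes> e \<beta> y = e n (v n) \<otimes> (ordered_prod [Suc n..<2 ^ k] v \<otimes> e \<beta> y)"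
    using n cl by (simp add: ordered_prod_rec[of n] m_assoc)
  also have "\<dots> = e n (v n) \<otimes> (e \<beta> y \<otimes> ordered_prod [Suc n..<2 ^ k] (u (Suc n)))"
    using step.IH n unfolding u_def by simp
  also have "\<dots> = e n (v n) \<otimes> e \<beta> y \<otimes> ordered_prod [Suc n..<2 ^ k] (u (Suc n))"
    using cl by (simp add: m_assoc)
  also have "\<dots> = e \<beta> y \<otimes> ordered_prod [n..<2 ^ k] (u n)"
  proof (cases "and n \<beta> = 0")
    case False
    have "u n \<gamma> = u (Suc n) \<gamma>" for \<gamma>
      using False by (cases "\<gamma> - \<beta> = n") (auto simp: u_def)
    then have "u n = u (Suc n)" by auto
    moreover have "u n n = v n" using n \<beta> less_le_not_le[of "n - \<beta>" n] by (simp add: u_def)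
    ultimately show ?thesis
      using e_commute[OF n(1,2) \<beta> False] cl n by (simp add: ordered_prod_rec[of n] m_assoc)
  next
    case True
    let ?\<delta> = "n + \<beta>" let ?b = "br (v n) y"
    have \<delta>: "?\<delta> < 2 ^ k" by (rule disjoint_add_less_power[OF True n(2) \<beta>(2)])
    have meet: "and \<alpha> ?\<delta> \<noteq> 0" if "Suc n \<le> \<alpha>" "\<alpha> < ?\<delta>" for \<alpha>
    proof
      assume "and \<alpha> ?\<delta> = 0"
      then have "and n \<alpha> = 0" "and \<beta> \<alpha> = 0" using and_add_left[OF True, of \<alpha>] by (simp_all add: and.commute)
      then have "n + \<beta> < \<alpha>" using that n by (intro disjoint_add_less True) auto
      with that show False by simp
    qed
    have "u n \<gamma> = ((u (Suc n))(?\<delta> := u (Suc n) ?\<delta> + ?b)) \<gamma>" for \<gamma>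
      using True by (cases "\<gamma> - \<beta> = n"; cases "\<gamma> = ?\<delta>") (use n in \<open>auto simp: u_def\<close>)
    then have un: "u n = (u (Suc n))(?\<delta> := u (Suc n) ?\<delta> + ?b)" by auto
    have "u n n = v n" using n \<beta> less_le_not_le[of "n - \<beta>" n] by (simp add: u_def)
    have "e n (v n) \<otimes> e \<beta> y \<otimes> ordered_prod [Suc n..<2 ^ k] (u (Suc n)) =
        e \<beta> y \<otimes> (e n (v n) \<otimes> (e ?\<delta> ?b \<otimes> ordered_prod [Suc n..<2 ^ k] (u (Suc n))))"
      using e_exchange[OF n(1,2) \<beta> True] cl e_closed[of ?\<delta> ?b] \<delta> n by (simp add: m_assoc)
    also have "e ?\<delta> ?b \<otimes> ordered_prod [Suc n..<2 ^ k] (u (Suc n)) = ordered_prod [Suc n..<2 ^ k] (u n)"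
      unfolding un using meet \<delta> \<beta> by (intro insert_central_factor) auto
    finally show ?thesis using n \<open>u n n = v n\<close> by (simp add: ordered_prod_rec[of n])
  qed
  finally show ?case unfolding u_def .
qed

lemma ordered_prod_mult_right:
  assumes \<beta>: "0 < \<beta>" "\<beta> < 2 ^ k"
  shows "ordered_prod [1..<2 ^ k] v \<otimes> e \<beta> y = ordered_prod [1..<2 ^ k] (collect \<beta> y v)"
proof -
  have split: "[1..<2 ^ k] = [1..<\<beta>] @ \<beta> # [Suc \<beta>..<2 ^ k]"
    using \<beta> upt_add_eq_append[of 1 \<beta> "2 ^ k - \<beta>"] upt_conv_Cons[of \<beta> "2 ^ k"] by simp
  have sub: "set [1..<\<beta>] \<subseteq> {0<..<2 ^ k}" "set (\<beta> # [Suc \<beta>..<2 ^ k]) \<subseteq> {0<..<2 ^ k}" using \<beta> by auto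
  let ?v' = "\<lambda>\<gamma>. v \<gamma> + (if Suc \<beta> \<le> \<gamma> - \<beta> \<and> and (\<gamma> - \<beta>) \<beta> = 0 then br (v (\<gamma> - \<beta>)) y else 0)"
  have 1: "ordered_prod [1..<\<beta>] v = ordered_prod [1..<\<beta>] (collect \<beta> y v)"
    by (rule ordered_prod_cong) (auto simp: collect_def)
  have 2: "ordered_prod [Suc \<beta>..<2 ^ k] ?v' = ordered_prod [Suc \<beta>..<2 ^ k] (collect \<beta> y v)"
    by (rule ordered_prod_cong) (auto simp: collect_def)
  have 3: "collect \<beta> y v \<beta> = v \<beta> + y" by (simp add: collect_def)
  have cl: "ordered_prod [1..<\<beta>] x \<in> carrier H" "ordered_prod [Suc \<beta>..<2 ^ k] x \<in> carrier H"
    "e \<beta> z \<in> carrier H" for x z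
    using \<beta> ordered_prod_closed[OF sub(1)] by (auto simp: e_closed)
  have "ordered_prod [1..<2 ^ k] v \<otimes> e \<beta> y =
     ordered_prod [1..<\<beta>] v \<otimes> (e \<beta> (v \<beta>) \<otimes> (ordered_prod [Suc \<beta>..<2 ^ k] v \<otimes> e \<beta> y))"
    unfolding split ordered_prod_append[OF sub] using cl by (simp add: m_assoc)
  also have "ordered_prod [Suc \<beta>..<2 ^ k] v \<otimes> e \<beta> y = e \<beta> y \<otimes> ordered_prod [Suc \<beta>..<2 ^ k] ?v'"
    using move_left[OF \<beta>, of "Suc \<beta>" v y] \<beta> by simp
  also have "ordered_prod [1..<\<beta>] v \<otimes> (e \<beta> (v \<beta>) \<otimes> (e \<beta> y \<otimes> ordered_prod [Suc \<beta>..<2 ^ k] ?v')) =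
      ordered_prod [1..<\<beta>] v \<otimes> (e \<beta> (v \<beta> + y) \<otimes> ordered_prod [Suc \<beta>..<2 ^ k] ?v')"
    using cl e_add[OF \<beta>, of "v \<beta>" y] by (simp add: m_assoc[symmetric])
  also have "\<dots> = ordered_prod [1..<2 ^ k] (collect \<beta> y v)"
    unfolding split ordered_prod_append[OF sub] using 1 2 3 by simp
  finally show ?thesis .
qed

text \<open>All components below the first index vanish, so that the lowest component is additive along
  the product. Cancelling the first factor, one recovers all entries from the product.\<close>

lemma co_ordered_prod:
  assumes "0 < n" "n \<le> 2 ^ k" "0 < \<gamma>" "\<gamma> < 2 ^ k" "\<gamma> \<le> n"
  shows "co \<gamma> (ordered_prod [n..<2 ^ k] v) = (if \<gamma> = n then v n else 0)"
  using assms(2,1,3-5)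
proof (induction arbitrary: \<gamma> rule: inc_induct)
  case base
  have "0 < (1::nat)" "(1::nat) < 2 ^ k"
    using base by (auto intro: le_less_trans[of 1 \<gamma>])
  have co1: "co \<gamma> \<one> = 0" if "0 < \<gamma>" "\<gamma> < 2 ^ k" for \<gamma>
    using co_e[OF that that, of 0] that by simp
  then show ?case using base by simp
next
  case (step n)
  have n: "0 < n" "n < 2 ^ k" using step by auto
  have IH: "co \<gamma> (ordered_prod [Suc n..<2 ^ k] v) = 0" if "0 < \<gamma>" "\<gamma> \<le> n" for \<gamma>
    using step.IH[of \<gamma>] that n by auto
  have "co \<gamma> (e n (v n) \<otimes> ordered_prod [Suc n..<2 ^ k] v) =
      co \<gamma> (e n (v n)) + co \<gamma> (ordered_prod [Suc n..<2 ^ k] v)"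
    using step.prems n co_e[OF _ _ n] IH by (intro co_mult) (auto simp: e_closed)
  then show ?case using n step.prems IH co_e[OF _ _ n] by (simp add: ordered_prod_rec[of n])
qed

lemma ordered_prod_inj:
  assumes "ordered_prod [1..<2 ^ k] v = ordered_prod [1..<2 ^ k] w" "0 < \<alpha>" "\<alpha> < 2 ^ k"
  shows "v \<alpha> = w \<alpha>"
proof -
  have "ordered_prod [n..<2 ^ k] v = ordered_prod [n..<2 ^ k] w" if "1 \<le> n" "n \<le> 2 ^ k" for n
    using that
  proof (induction rule: dec_induct)
    case (step n)
    then have n: "0 < n" "n < 2 ^ k" by auto
    have eq: "ordered_prod [n..<2 ^ k] v = ordered_prod [n..<2 ^ k] w" using step by auto
    then have "v n = w n" using co_ordered_prod[of n n v] co_ordered_prod[of n n w] n by simp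
    then show ?case using eq n by (simp add: ordered_prod_rec[of n] e_closed)
  qed (use assms in simp)
  then have "ordered_prod [\<alpha>..<2 ^ k] v = ordered_prod [\<alpha>..<2 ^ k] w" using assms by auto
  then show ?thesis using co_ordered_prod[of \<alpha> \<alpha> v] co_ordered_prod[of \<alpha> \<alpha> w] assms by simp
qed

section \<open>The formulas in filtered groups\<close>

definition bracket_left :: "(nat \<Rightarrow> 'v) \<Rightarrow> (nat \<Rightarrow> 'v) \<Rightarrow> nat list \<Rightarrow> 'v" where
  "bracket_left v w l = foldl br (v (last l)) (map w (butlast l))"

text \<open>Let \<open>u b\<close> be the coordinates after multiplication with the factors
  $\varepsilon^\beta w_\beta$ for $\beta \le b$. The partitions that occur in \<open>u b\<close> are those whose
  members, except for the last one, are at most \<open>b\<close>. The factor with index $b+1$ contributes the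
  brackets of $w_{b+1}$ with the terms of $\gamma - (b+1)$; this inserts $b+1$ as the last but one member.
  It remains in this place, because a partition of an index that is disjoint from and larger than
  $b+1$ has a member larger than $b+1$.\<close>

lemma left_product_step:
  fixes v w :: "nat \<Rightarrow> 'v"
  defines "u \<equiv> \<lambda>b \<gamma>. (if \<gamma> \<le> b then w \<gamma> else 0) +
      (\<Sum>l\<in>{l \<in> partition_lists k \<gamma>. \<forall>x\<in>set (butlast l). x \<le> b}. bracket_left v w l)"
  assumes b: "Suc b < 2 ^ k" and \<gamma>: "0 < \<gamma>" "\<gamma> < 2 ^ k"
  shows "u (Suc b) \<gamma> = collect (Suc b) (w (Suc b)) (u b) \<gamma>"
proof -
  let ?b = "Suc b"
  let ?A = "\<lambda>b. {l \<in> partition_lists k \<gamma>. \<forall>x\<in>set (butlast l). x \<le> b}"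
  let ?B = "{l \<in> partition_lists k \<gamma>. (\<forall>x\<in>set (butlast l). x \<le> ?b) \<and> ?b \<in> set (butlast l)}"
  let ?A' = "{l \<in> partition_lists k (\<gamma> - ?b). \<forall>x\<in>set (butlast l). x \<le> b}"
  let ?g = "\<lambda>l. butlast l @ [?b, last l]"
  have ne: "l \<noteq> []" "sorted_wrt (<) l" if "l \<in> partition_lists k \<gamma>" for l \<gamma>
    using that by (auto simp: partition_lists_def)
  have sorted_last: "x < last l" if "l \<in> partition_lists k \<gamma>" "x \<in> set (butlast l)" for l x \<gamma>
  proof -
    have "sorted_wrt (<) (butlast l @ [last l])" using ne[OF that(1)] by simp
    then show ?thesis using that(2) by (simp add: sorted_wrt_append del: append_butlast_last_id)
  qed
  have AB: "?A ?b = ?A b \<union> ?B" "?A b \<inter> ?B = {}" by (auto simp: le_Suc_eq)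
  have fin: "finite (?A b)" "finite ?B" using finite_partition_lists by auto
  have sum: "(\<Sum>l\<in>?A ?b. bracket_left v w l) = (\<Sum>l\<in>?A b. bracket_left v w l) + (\<Sum>l\<in>?B. bracket_left v w l)"
    unfolding AB(1) by (rule sum.union_disjoint[OF fin AB(2)])
  \<comment> \<open>the partitions that are new in \<open>u (Suc b)\<close> arise by inserting \<open>Suc b\<close> before the last member\<close>
  have B_form: "\<exists>l'. l = ?g l' \<and> l' \<in> ?A' \<and> ?b < last l' \<and> ?b \<le> \<gamma> \<and> and (\<gamma> - ?b) ?b = 0" if "l \<in> ?B" for l
  proof -
    have l: "l \<in> partition_lists k \<gamma>" "\<forall>x\<in>set (butlast l). x \<le> ?b" "?b \<in> set (butlast l)" using that by auto
    then have nb: "butlast l \<noteq> []" by auto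
    have s: "sorted_wrt (<) (butlast (butlast l) @ [last (butlast l)])"
      using ne[OF l(1)] nb by (metis append_butlast_last_id sorted_wrt_append)
    have "last (butlast l) = ?b"
    proof (rule ccontr)
      assume "last (butlast l) \<noteq> ?b"
      then have "?b \<in> set (butlast (butlast l))"
        using l(3) nb by (metis append_butlast_last_id in_set_conv_decomp rotate1.simps(2) set_ConsD set_rotate1)
      then have "?b < last (butlast l)" using s by (simp add: sorted_wrt_append del: append_butlast_last_id)
      moreover have "last (butlast l) \<le> ?b" using l(2) nb by simp
      ultimately show False by simp
    qed
    then have form: "l = butlast (butlast l) @ [?b, last l]"
      using nb by (metis append_Cons append_Nil append_assoc append_butlast_last_id butlast.simps(1))
    have "?b < 2 ^ k" using b .
    from form l(1) have "butlast (butlast l) @ [?b, last l] \<in> partition_lists k \<gamma>" by simp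
    then have *: "butlast (butlast l) @ [last l] \<in> partition_lists k (\<gamma> - ?b)" "\<forall>x\<in>set (butlast (butlast l)). x < ?b"
      "?b < last l" "?b \<le> \<gamma>" "and (\<gamma> - ?b) ?b = 0"
      using partition_lists_insert_iff[OF _ b \<gamma>(2)] by auto
    show ?thesis
      by (rule exI[of _ "butlast (butlast l) @ [last l]"]) (use * form in \<open>auto simp del: One_nat_def\<close>)
  qed
  have sumB: "(\<Sum>l\<in>?B. bracket_left v w l) =
      (if ?b < \<gamma> - ?b \<and> and (\<gamma> - ?b) ?b = 0 then br (u b (\<gamma> - ?b)) (w ?b) else 0)"
  proof (cases "?b < \<gamma> - ?b \<and> and (\<gamma> - ?b) ?b = 0")
    case True
    have last: "?b < last l'" if "l' \<in> ?A'" for l'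
    proof (rule ccontr)
      assume "\<not> ?b < last l'"
      then have le: "x \<le> ?b" if "x \<in> set l'" for x
        using that \<open>l' \<in> ?A'\<close> ne[of l' "\<gamma> - ?b"]
        by (metis (no_types, lifting) append_butlast_last_id in_set_conv_decomp le_Suc_eq linorder_le_less_linear mem_Collect_eq rotate1.simps(2) set_ConsD set_rotate1)
      have nb: "?b \<notin> set l'"
      proof
        assume "?b \<in> set l'"
        obtain i where i: "i \<in> {1..k}" "digit ?b i = 1" using digit_nonzero_ex[of ?b k] b by blast
        have "digit ?b i \<le> (\<Sum>l\<leftarrow>l'. digit l i)" using \<open>?b \<in> set l'\<close> by (intro member_le_sum_list) auto
        also have "\<dots> = digit (\<gamma> - ?b) i" using \<open>l' \<in> ?A'\<close> i by (auto simp: partition_lists_def)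
        finally have "digit (\<gamma> - ?b) i = 1" using i digit_le_1[of "\<gamma> - ?b" i] by simp
        then have "bit (\<gamma> - ?b) (i - 1)" "bit ?b (i - 1)" using i(2) digit_eq_0_1(2) by blast+
        then show False using True and_eq_0_iff by blast
      qed
      have "\<gamma> - ?b < ?b"
      proof (rule partition_lists_sum_less)
        show "l' \<in> partition_lists k (\<gamma> - ?b)" using \<open>l' \<in> ?A'\<close> by blast
        show "x < ?b" if "x \<in> set l'" for x using le[OF that] nb that by (metis le_neq_implies_less)
      qed (use \<gamma> True in auto)
      with True show False by simp
    qed
    have "?B = ?g ` ?A'"
    proof
      show "?B \<subseteq> ?g ` ?A'" using B_form by blast
      show "?g ` ?A' \<subseteq> ?B"
      proof
        fix l assume "l \<in> ?g ` ?A'"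
        then obtain l' where l': "l' \<in> ?A'" "l = ?g l'" by blast
        have "butlast l' @ [last l'] \<in> partition_lists k (\<gamma> - ?b)" using l'(1) ne by auto
        moreover have "\<forall>x\<in>set (butlast l'). x < ?b" using l'(1) by auto
        ultimately have "?g l' \<in> partition_lists k \<gamma>"
          using partition_lists_insert_iff[OF _ b \<gamma>(2), of "butlast l'" "last l'"] last[OF l'(1)] True by auto
        then show "l \<in> ?B" using l' by (auto simp: butlast_append)
      qed
    qed
    moreover have "inj_on ?g ?A'"
    proof (rule inj_onI)
      fix l1 l2 assume l: "l1 \<in> ?A'" "l2 \<in> ?A'" "?g l1 = ?g l2"
      then have "butlast l1 = butlast l2 \<and> last l1 = last l2" "l1 \<noteq> []" "l2 \<noteq> []" using ne by auto
      then show "l1 = l2" by (metis append_butlast_last_id)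
    qed
    ultimately have "(\<Sum>l\<in>?B. bracket_left v w l) = (\<Sum>l\<in>?A'. bracket_left v w (?g l))"
      by (simp add: sum.reindex)
    also have "\<dots> = (\<Sum>l\<in>?A'. br (bracket_left v w l) (w ?b))"
      by (intro sum.cong) (auto simp: bracket_left_def butlast_append)
    also have "\<dots> = br (u b (\<gamma> - ?b)) (w ?b)"
      using True by (simp add: u_def br_sum_left)
    finally show ?thesis using True by simp
  next
    case False
    have E: "?B = {}"
    proof (rule ccontr)
      assume "?B \<noteq> {}"
      then obtain l where "l \<in> ?B" by blast
      then obtain l' where l': "l' \<in> ?A'" "?b < last l'" "?b \<le> \<gamma>" "and (\<gamma> - ?b) ?b = 0" using B_form by blast
      have "last l' \<le> \<gamma> - ?b" using l'(1) ne \<gamma> by (intro partition_lists_le[of l']) auto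
      with l' False show False by simp
    qed
    show ?thesis unfolding E using False by auto
  qed
  show ?thesis
  proof (cases "\<gamma> = ?b")
    case True
    have E: "?B = {}"
    proof (rule ccontr)
      assume "?B \<noteq> {}"
      then obtain l where "l \<in> ?B" by blast
      then obtain l' where l': "l' \<in> ?A'" "?b < last l'" using B_form by blast
      have "last l' \<le> \<gamma> - ?b" using l'(1) ne \<gamma> by (intro partition_lists_le[of l']) auto
      with l' True show False by simp
    qed
    show ?thesis using sum True unfolding E by (simp add: u_def collect_def add_ac)
  next
    case False
    then have "\<gamma> \<le> ?b \<longleftrightarrow> \<gamma> \<le> b" by auto
    then show ?thesis using sum sumB False by (simp add: u_def collect_def add_ac)
  qed
qed

lemma partition_list_eq_singleton:
  assumes "\<gamma> < 2 ^ k" "l \<in> partition_lists k \<gamma>" "\<forall>x\<in>set (butlast l). x \<le> 0"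
  shows "l = [\<gamma>]"
proof -
  have "set (butlast l) \<subseteq> {0<..<2 ^ k}" "l \<noteq> []"
    using assms(2) by (auto simp: partition_lists_def dest: in_set_butlastD)
  then have "butlast l = []" using assms(3) by (cases "butlast l") auto
  then obtain t where t: "l = [t]" using \<open>l \<noteq> []\<close> by (metis append_Nil append_butlast_last_id)
  then have "t \<le> \<gamma>" "0 < t" using partition_lists_le[OF assms(2,1)] assms(2) by (auto simp: partition_lists_def)
  then show ?thesis using partition_lists_single[of \<gamma> k t] assms t by simp
qed

theorem left_product_formula:
  "ordered_prod [1..<2 ^ k] v \<otimes> ordered_prod [1..<2 ^ k] w =
   ordered_prod [1..<2 ^ k] (\<lambda>\<gamma>. v \<gamma> + w \<gamma> + (\<Sum>m\<in>{2..weight k \<gamma>}. \<Sum>l\<in>partitions k m \<gamma>. bracket_left v w l))"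
proof -
  define u where "u = (\<lambda>b \<gamma>. (if \<gamma> \<le> b then w \<gamma> else 0) +
      (\<Sum>l\<in>{l \<in> partition_lists k \<gamma>. \<forall>x\<in>set (butlast l). x \<le> b}. bracket_left v w l))"
  have "ordered_prod [1..<2 ^ k] v \<otimes> ordered_prod [1..<Suc b] w = ordered_prod [1..<2 ^ k] (u b)"
    if "b < 2 ^ k" for b
    using that
  proof (induction b)
    case 0
    have "v \<gamma> = u 0 \<gamma>" if "0 < \<gamma>" "\<gamma> < 2 ^ k" for \<gamma>
    proof -
      have "[\<gamma>] \<in> partition_lists k \<gamma>" using partition_lists_single that by simp
      then have "{l \<in> partition_lists k \<gamma>. \<forall>x\<in>set (butlast l). x \<le> 0} = {[\<gamma>]}"
      proof (intro equalityI subsetI)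
        fix l assume "l \<in> {l \<in> partition_lists k \<gamma>. \<forall>x\<in>set (butlast l). x \<le> 0}"
        then show "l \<in> {[\<gamma>]}" using partition_list_eq_singleton[OF that(2), of l] by blast
      qed simp
      then show ?thesis using that by (simp only: u_def) (simp add: bracket_left_def)
    qed
    then have "ordered_prod [1..<2 ^ k] v = ordered_prod [1..<2 ^ k] (u 0)"
      by (intro ordered_prod_cong) auto
    then show ?case by simp
  next
    case (Suc b)
    have sub: "set [1..<Suc b] \<subseteq> {0<..<2 ^ k}" "set [Suc b] \<subseteq> {0<..<2 ^ k}" using Suc.prems by auto
    have "[1..<Suc (Suc b)] = [1..<Suc b] @ [Suc b]" by simp
    then have "ordered_prod [1..<Suc (Suc b)] w = ordered_prod [1..<Suc b] w \<otimes> e (Suc b) (w (Suc b))"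
      using ordered_prod_append[OF sub] e_closed Suc.prems by simp
    then have "ordered_prod [1..<2 ^ k] v \<otimes> ordered_prod [1..<Suc (Suc b)] w =
        ordered_prod [1..<2 ^ k] (u b) \<otimes> e (Suc b) (w (Suc b))"
      using Suc ordered_prod_closed[OF sub(1)] e_closed[of "Suc b"] by (simp add: m_assoc[symmetric] del: upt_Suc)
    also have "\<dots> = ordered_prod [1..<2 ^ k] (collect (Suc b) (w (Suc b)) (u b))"
      using Suc.prems by (intro ordered_prod_mult_right) auto
    also have "\<dots> = ordered_prod [1..<2 ^ k] (u (Suc b))"
    proof (rule ordered_prod_cong)
      fix \<alpha> assume "\<alpha> \<in> set [1..<2 ^ k]"
      then show "collect (Suc b) (w (Suc b)) (u b) \<alpha> = u (Suc b) \<alpha>"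
        unfolding u_def using left_product_step[OF Suc.prems, of \<alpha> w v] by simp
    qed
    finally show ?case .
  qed
  from this[of "2 ^ k - 1"]
  have "ordered_prod [1..<2 ^ k] v \<otimes> ordered_prod [1..<2 ^ k] w = ordered_prod [1..<2 ^ k] (u (2 ^ k - 1))"
    by simp
  also have "\<dots> = ordered_prod [1..<2 ^ k] (\<lambda>\<gamma>. v \<gamma> + w \<gamma> + (\<Sum>m\<in>{2..weight k \<gamma>}. \<Sum>l\<in>partitions k m \<gamma>. bracket_left v w l))"
  proof (rule ordered_prod_cong)
    fix \<gamma> assume "\<gamma> \<in> set [1..<2 ^ k]"
    then have \<gamma>: "0 < \<gamma>" "\<gamma> < 2 ^ k" by auto
    have "x \<le> 2 ^ k - 1" if "l \<in> partition_lists k \<gamma>" "x \<in> set (butlast l)" for l x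
      using partition_lists_le[OF that(1) \<gamma>(2) in_set_butlastD[OF that(2)]] \<gamma> by simp
    then have all: "{l \<in> partition_lists k \<gamma>. \<forall>x\<in>set (butlast l). x \<le> 2 ^ k - 1} = partition_lists k \<gamma>" by blast
    then show "u (2 ^ k - 1) \<gamma> = v \<gamma> + w \<gamma> + (\<Sum>m\<in>{2..weight k \<gamma>}. \<Sum>l\<in>partitions k m \<gamma>. bracket_left v w l)"
    proof -
      have "\<gamma> \<le> 2 ^ k - 1" using \<gamma> by linarith
      then show ?thesis
        using sum_partition_lists[OF \<gamma>, of "bracket_left v w"] all by (simp add: u_def bracket_left_def add_ac)
    qed
  qed
  finally show ?thesis .
qed

definition bracket_inv :: "(nat \<Rightarrow> 'v) \<Rightarrow> nat list \<Rightarrow> 'v" where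
  "bracket_inv v l = foldl br (v (last l)) (map v (rev (butlast l)))"

text \<open>The inverse of $\prod^\uparrow \varepsilon^\alpha v_\alpha$ is
  $\prod^\downarrow \varepsilon^\alpha (-v_\alpha)$, which is collected by multiplying the unit with the
  factors in decreasing order. Let \<open>u b\<close> be the coordinates after the factors with index at least
  \<open>b\<close>; the partitions that occur in \<open>u b\<close> are those with members at least \<open>b\<close>. The next factor
  prepends its index to partitions all of whose members are larger.\<close>

lemma left_inversion_step:
  fixes v :: "nat \<Rightarrow> 'v"
  defines "u \<equiv> \<lambda>b \<gamma>. (\<Sum>l\<in>{l \<in> partition_lists k \<gamma>. \<forall>x\<in>set l. b \<le> x}. bracket_inv v l)"
  assumes b: "0 < b" "b < 2 ^ k" and \<gamma>: "0 < \<gamma>" "\<gamma> < 2 ^ k"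
  shows "u b \<gamma> = collect b (v b) (u (Suc b)) \<gamma>"
proof -
  let ?A = "\<lambda>b. {l \<in> partition_lists k \<gamma>. \<forall>x\<in>set l. b \<le> x}"
  let ?B = "{l \<in> partition_lists k \<gamma>. (\<forall>x\<in>set l. b \<le> x) \<and> b \<in> set l}"
  let ?A' = "{l \<in> partition_lists k (\<gamma> - b). \<forall>x\<in>set l. Suc b \<le> x}"
  have AB: "?A b = ?A (Suc b) \<union> ?B" "?A (Suc b) \<inter> ?B = {}"
    by (auto simp: Suc_le_eq le_less)
  have fin: "finite (?A (Suc b))" "finite ?B" using finite_partition_lists by auto
  have sum: "u b \<gamma> = u (Suc b) \<gamma> + (\<Sum>l\<in>?B. bracket_inv v l)"
    unfolding u_def AB(1) by (rule sum.union_disjoint[OF fin AB(2)])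
  \<comment> \<open>the partitions that are new in \<open>u b\<close> start with \<open>b\<close>\<close>
  have B_form: "\<exists>l'. l = b # l' \<and> (\<forall>x\<in>set l'. b < x)" if "l \<in> ?B" for l
  proof (cases l)
    case (Cons a l')
    then have "a < x" if "x \<in> set l'" for x using \<open>l \<in> ?B\<close> that by (auto simp: partition_lists_def)
    moreover have "b \<le> a" "b = a \<or> b \<in> set l'" using \<open>l \<in> ?B\<close> Cons by auto
    ultimately have "a = b" by fastforce
    with Cons \<open>\<And>x. x \<in> set l' \<Longrightarrow> a < x\<close> show ?thesis by auto
  qed (use that in auto)
  show ?thesis
  proof (cases "\<gamma> = b")
    case True
    have "?B = {[b]}"
    proof
      show "{[b]} \<subseteq> ?B" using partition_lists_single[OF \<gamma>] True by auto
      show "?B \<subseteq> {[b]}"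
      proof
        fix l assume l: "l \<in> ?B"
        then obtain l' where l': "l = b # l'" "\<forall>x\<in>set l'. b < x" using B_form by blast
        have "l' = []"
        proof (cases l')
          case (Cons x l'')
          then have "x \<le> \<gamma>" using partition_lists_le[of l k \<gamma> x] l l' \<gamma> by auto
          then show ?thesis using True l' Cons by auto
        qed
        with l' show "l \<in> {[b]}" by simp
      qed
    qed
    then show ?thesis unfolding sum using True by (simp add: collect_def bracket_inv_def)
  next
    case False
    have Bne: "l' \<in> ?A' \<and> b \<le> \<gamma> \<and> and (\<gamma> - b) b = 0" if "b # l' \<in> ?B" for l'
    proof -
      have "l' \<noteq> []" using that False partition_lists_single[OF \<gamma>] by auto
      with that show ?thesis using partition_lists_Cons_iff[OF b \<gamma>(2), of l'] by (auto simp: Suc_le_eq)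
    qed
    have "(\<Sum>l\<in>?B. bracket_inv v l) = (if b < \<gamma> - b \<and> and (\<gamma> - b) b = 0 then br (u (Suc b) (\<gamma> - b)) (v b) else 0)"
    proof (cases "b < \<gamma> - b \<and> and (\<gamma> - b) b = 0")
      case True
      have ne: "l' \<noteq> []" if "l' \<in> ?A'" for l' using that by (auto simp: partition_lists_def)
      have "?B = (#) b ` ?A'"
      proof
        show "?B \<subseteq> (#) b ` ?A'" using B_form Bne by blast
        show "(#) b ` ?A' \<subseteq> ?B"
          using partition_lists_Cons_iff[OF b \<gamma>(2)] ne True by (auto simp: Suc_le_eq less_imp_le)
      qed
      then have "(\<Sum>l\<in>?B. bracket_inv v l) = (\<Sum>l\<in>?A'. bracket_inv v (b # l))"
        by (simp add: sum.reindex)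
      also have "\<dots> = (\<Sum>l\<in>?A'. br (bracket_inv v l) (v b))"
        by (intro sum.cong) (use ne in \<open>auto simp: bracket_inv_def\<close>)
      also have "\<dots> = br (u (Suc b) (\<gamma> - b)) (v b)" by (simp add: u_def br_sum_left)
      finally show ?thesis using True by simp
    next
      case nc: False
      have E: "?B = {}"
      proof (rule ccontr)
        assume "?B \<noteq> {}"
        then obtain l where l: "l \<in> ?B" by blast
        then obtain l' where l': "l = b # l'" using B_form by blast
        then have *: "l' \<in> ?A'" "b \<le> \<gamma>" "and (\<gamma> - b) b = 0" using Bne l by auto
        then obtain x where x: "x \<in> set l'" by (auto simp: partition_lists_def) (metis list.set_intros(1) neq_Nil_conv)
        then have "x \<le> \<gamma> - b" using *(1) \<gamma> by (intro partition_lists_le[of l']) auto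
        moreover have "b < x" using * x by auto
        ultimately show False using nc *(3) by simp
      qed
      show ?thesis unfolding E using nc by auto
    qed
    then show ?thesis unfolding sum using False by (simp add: collect_def)
  qed
qed

lemma inv_ordered_prod:
  assumes "set l \<subseteq> {0<..<2 ^ k}"
  shows "inv (ordered_prod l v) = ordered_prod (rev l) (\<lambda>\<alpha>. - v \<alpha>)"
  using assms
proof (induction l)
  case (Cons a l)
  then have a: "0 < a" "a < 2 ^ k" and l: "set l \<subseteq> {0<..<2 ^ k}" by auto
  have "inv (ordered_prod (a # l) v) = inv (ordered_prod l v) \<otimes> e a (- v a)"
    using a l by (simp add: inv_mult_group e_closed e_inv)
  also have "\<dots> = ordered_prod (rev (a # l)) (\<lambda>\<alpha>. - v \<alpha>)"
    using Cons.IH[OF l] ordered_prod_append[of "rev l" "[a]"] a l by (simp add: e_closed)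
  finally show ?case .
qed simp

text \<open>The sign $(-1)^m$ in the inversion formula: each of the \<open>m\<close> entries is negated.\<close>

lemma bracket_inv_uminus:
  assumes "l \<noteq> []"
  shows "bracket_inv (\<lambda>\<alpha>. - v \<alpha>) l = (if even (length l) then bracket_inv v l else - bracket_inv v l)"
proof -
  have *: "foldl br (- x) (map (\<lambda>\<alpha>. - v \<alpha>) xs) =
      (if even (length xs) then - foldl br x (map v xs) else foldl br x (map v xs))" for x xs
    by (induction xs rule: rev_induct) (auto simp: br_minus_left br_minus_right)
  have "even (length (rev (butlast l))) \<longleftrightarrow> odd (length l)" using assms by (cases l) auto
  then show ?thesis using *[of "v (last l)" "rev (butlast l)"] by (simp add: bracket_inv_def)
qed

theorem left_inversion_formula:
  "inv (ordered_prod [1..<2 ^ k] v) = ordered_prod [1..<2 ^ k] (\<lambda>\<gamma>. - v \<gamma> +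
     (\<Sum>m\<in>{2..weight k \<gamma>}. \<Sum>l\<in>partitions k m \<gamma>. if even m then bracket_inv v l else - bracket_inv v l))"
proof -
  let ?v = "\<lambda>\<alpha>. - v \<alpha>"
  define u where "u = (\<lambda>b \<gamma>. (\<Sum>l\<in>{l \<in> partition_lists k \<gamma>. \<forall>x\<in>set l. b \<le> x}. bracket_inv ?v l))"
  have "ordered_prod (rev [b..<2 ^ k]) ?v = ordered_prod [1..<2 ^ k] (u b)" if "0 < b" "b \<le> 2 ^ k" for b
    using that(2,1)
  proof (induction rule: inc_induct)
    case base
    have "u (2 ^ k) \<gamma> = 0" for \<gamma>
    proof -
      have "{l \<in> partition_lists k \<gamma>. \<forall>x\<in>set l. 2 ^ k \<le> x} = {}"
      proof -
        have "\<exists>x\<in>set l. x < 2 ^ k" if "l \<in> partition_lists k \<gamma>" for l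
          using that by (cases l) (auto simp: partition_lists_def)
        then show ?thesis by (auto simp: not_le[symmetric])
      qed
      then show ?thesis by (simp only: u_def) simp
    qed
    moreover have "ordered_prod l (\<lambda>\<gamma>. 0) = \<one>" if "set l \<subseteq> {0<..<2 ^ k}" for l
      using that by (induction l) auto
    ultimately show ?case
      using ordered_prod_cong[of "[1..<2 ^ k]" "u (2 ^ k)" "\<lambda>_. 0"] by (force simp: subset_iff)
  next
    case (step b)
    then have b: "0 < b" "b < 2 ^ k" by auto
    have "rev [b..<2 ^ k] = rev [Suc b..<2 ^ k] @ [b]" using b by (simp add: upt_rec[of b])
    then have "ordered_prod (rev [b..<2 ^ k]) ?v = ordered_prod (rev [Suc b..<2 ^ k]) ?v \<otimes> e b (- v b)"
    proof -
      have "set (rev [Suc b..<2 ^ k]) \<subseteq> {0<..<2 ^ k}" "set [b] \<subseteq> {0<..<2 ^ k}" using b by auto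
      from ordered_prod_append[OF this, of ?v] show ?thesis
        using \<open>rev [b..<2 ^ k] = rev [Suc b..<2 ^ k] @ [b]\<close> b e_closed[OF b] by simp
    qed
    also have "\<dots> = ordered_prod [1..<2 ^ k] (collect b (- v b) (u (Suc b)))"
      using step.IH ordered_prod_mult_right[OF b, of "u (Suc b)" "- v b"] by simp
    also have "\<dots> = ordered_prod [1..<2 ^ k] (u b)"
    proof (rule ordered_prod_cong)
      fix \<alpha> assume "\<alpha> \<in> set [1..<2 ^ k]"
      then show "collect b (- v b) (u (Suc b)) \<alpha> = u b \<alpha>"
        unfolding u_def using left_inversion_step[OF b, of \<alpha> ?v] by simp
    qed
    finally show ?case .
  qed
  from this[of 1] have "ordered_prod (rev [1..<2 ^ k]) ?v = ordered_prod [1..<2 ^ k] (u 1)" by simp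
  then have "inv (ordered_prod [1..<2 ^ k] v) = ordered_prod [1..<2 ^ k] (u 1)"
    using inv_ordered_prod[of "[1..<2 ^ k]" v] by fastforce
  also have "\<dots> = ordered_prod [1..<2 ^ k] (\<lambda>\<gamma>. - v \<gamma> +
     (\<Sum>m\<in>{2..weight k \<gamma>}. \<Sum>l\<in>partitions k m \<gamma>. if even m then bracket_inv v l else - bracket_inv v l))"
  proof (rule ordered_prod_cong)
    fix \<gamma> assume "\<gamma> \<in> set [1..<2 ^ k]"
    then have \<gamma>: "0 < \<gamma>" "\<gamma> < 2 ^ k" by auto
    have "{l \<in> partition_lists k \<gamma>. \<forall>x\<in>set l. 1 \<le> x} = partition_lists k \<gamma>"
      by (auto simp: partition_lists_def)
    then have "u 1 \<gamma> = - v \<gamma> + (\<Sum>m\<in>{2..weight k \<gamma>}. \<Sum>l\<in>partitions k m \<gamma>. bracket_inv ?v l)"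
      using sum_partition_lists[OF \<gamma>, of "bracket_inv ?v"] by (simp only: u_def) (simp add: bracket_inv_def)
    also have "\<dots> = - v \<gamma> + (\<Sum>m\<in>{2..weight k \<gamma>}. \<Sum>l\<in>partitions k m \<gamma>. if even m then bracket_inv v l else - bracket_inv v l)"
    proof (intro arg_cong2[where f = "(+)"] refl sum.cong)
      fix m l assume "m \<in> {2..weight k \<gamma>}" "l \<in> partitions k m \<gamma>"
      then have "l \<noteq> []" "length l = m" by (auto simp: partitions_def)
      then show "bracket_inv ?v l = (if even m then bracket_inv v l else - bracket_inv v l)"
        using bracket_inv_uminus[of l v] by simp
    qed
    finally show "u 1 \<gamma> = - v \<gamma> + (\<Sum>m\<in>{2..weight k \<gamma>}. \<Sum>l\<in>partitions k m \<gamma>. if even m then bracket_inv v l else - bracket_inv v l)" .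
  qed
  finally show ?thesis .
qed

end

text \<open>In the opposite group, with the opposite bracket, products in increasing order become products
  in decreasing order. So the right product is the left product of the opposite group, with
  exchanged arguments.\<close>

definition opposite :: "('a, 'b) monoid_scheme \<Rightarrow> 'a monoid" where
  "opposite H = \<lparr>carrier = carrier H, mult = (\<lambda>x y. y \<otimes>\<^bsub>H\<^esub> x), one = \<one>\<^bsub>H\<^esub>\<rparr>"

lemma opposite_simps [simp]:
  "carrier (opposite H) = carrier H" "x \<otimes>\<^bsub>opposite H\<^esub> y = y \<otimes>\<^bsub>H\<^esub> x" "\<one>\<^bsub>opposite H\<^esub> = \<one>\<^bsub>H\<^esub>"
  by (simp_all add: opposite_def)

lemma (in group) group_opposite: "group (opposite G)"
proof (rule groupI)
  fix x assume "x \<in> carrier (opposite G)"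
  then show "\<exists>y\<in>carrier (opposite G). y \<otimes>\<^bsub>opposite G\<^esub> x = \<one>\<^bsub>opposite G\<^esub>"
    by (intro bexI[of _ "inv x"]) auto
qed (auto simp: m_assoc)

lemma (in filtered_group) filtered_group_opposite:
  "filtered_group (opposite H) k e (\<lambda>x y. br y x) co"
proof (intro filtered_group.intro group_opposite filtered_group_axioms.intro)
  fix \<alpha> \<beta> :: nat and x y
  assume ab: "0 < \<alpha>" "\<alpha> < 2 ^ k" "0 < \<beta>" "\<beta> < 2 ^ k" "and \<alpha> \<beta> = 0"
  let ?d = "e (\<alpha> + \<beta>) (br y x)"
  have d: "0 < \<alpha> + \<beta>" "\<alpha> + \<beta> < 2 ^ k" using ab disjoint_add_less_power by auto
  have "and \<alpha> (\<alpha> + \<beta>) \<noteq> 0" "and \<beta> (\<alpha> + \<beta>) \<noteq> 0"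
    using and_add_left[OF ab(5), of \<alpha>] and_add_left[OF ab(5), of \<beta>] ab by (auto simp: and.commute)
  then have comm: "e \<alpha> x \<otimes> ?d = ?d \<otimes> e \<alpha> x" "e \<beta> y \<otimes> ?d = ?d \<otimes> e \<beta> y"
    using e_commute[OF ab(1,2) d] e_commute[OF ab(3,4) d] by auto
  have cl: "e \<alpha> x \<in> carrier H" "e \<beta> y \<in> carrier H" "?d \<in> carrier H" using ab d by (auto simp: e_closed)
  have "e \<beta> y \<otimes> e \<alpha> x = e \<alpha> x \<otimes> e \<beta> y \<otimes> ?d"
    using e_exchange[OF ab(3,4,1,2), of y x] ab(5) by (simp add: and.commute add.commute)
  also have "\<dots> = ?d \<otimes> (e \<alpha> x \<otimes> e \<beta> y)"
    using cl comm by (metis m_assoc)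
  finally show "e \<alpha> x \<otimes>\<^bsub>opposite H\<^esub> e \<beta> y =
      e \<beta> y \<otimes>\<^bsub>opposite H\<^esub> e \<alpha> x \<otimes>\<^bsub>opposite H\<^esub> e (\<alpha> + \<beta>) (br y x)"
    by simp
next
  fix \<gamma> p q assume *: "0 < \<gamma>" "\<gamma> < 2 ^ k" "p \<in> carrier (opposite H)" "q \<in> carrier (opposite H)"
    "\<And>\<alpha>. 0 < \<alpha> \<Longrightarrow> \<alpha> < \<gamma> \<Longrightarrow> co \<alpha> p = 0 \<and> co \<alpha> q = 0"
  then have "co \<gamma> (q \<otimes> p) = co \<gamma> q + co \<gamma> p" by (intro co_mult) auto
  then show "co \<gamma> (p \<otimes>\<^bsub>opposite H\<^esub> q) = co \<gamma> p + co \<gamma> q" by (simp add: add.commute)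
next
  fix \<alpha> \<beta> :: nat and x y
  assume "0 < \<alpha>" "\<alpha> < 2 ^ k" "0 < \<beta>" "\<beta> < 2 ^ k" "and \<alpha> \<beta> \<noteq> 0"
  then show "e \<alpha> x \<otimes>\<^bsub>opposite H\<^esub> e \<beta> y = e \<beta> y \<otimes>\<^bsub>opposite H\<^esub> e \<alpha> x"
    using e_commute[of \<alpha> \<beta> x y] by simp
qed (auto simp: e_closed e_add br_add_left br_add_right co_e add.commute)

lemma (in filtered_group) ordered_prod_opposite:
  assumes "set l \<subseteq> {0<..<2 ^ k}"
  shows "filtered_group.ordered_prod (opposite H) e l v = ordered_prod (rev l) v"
proof -
  interpret op: filtered_group "opposite H" k e "\<lambda>x y. br y x" co by (rule filtered_group_opposite)
  show ?thesis using assms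
  proof (induction l)
    case (Cons a l)
    then show ?case using ordered_prod_append[of "rev l" "[a]" v] by (auto simp: e_closed)
  qed simp
qed

theorem (in filtered_group) right_product_formula:
  "ordered_prod (rev [1..<2 ^ k]) v \<otimes> ordered_prod (rev [1..<2 ^ k]) w =
   ordered_prod (rev [1..<2 ^ k]) (\<lambda>\<gamma>. v \<gamma> + w \<gamma> + (\<Sum>m\<in>{2..weight k \<gamma>}. \<Sum>l\<in>partitions k m \<gamma>.
     foldl (\<lambda>x y. br y x) (w (last l)) (map v (butlast l))))"
proof -
  interpret op: filtered_group "opposite H" k e "\<lambda>x y. br y x" co by (rule filtered_group_opposite)
  have sub: "set [1..<2 ^ k] \<subseteq> {0<..<2 ^ k}" by auto
  note op.left_product_formula[of w v]
  then show ?thesis unfolding ordered_prod_opposite[OF sub] op.bracket_left_def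
    by (simp add: add.commute[of "w _" "v _"])
qed

lemma (in filtered_group) ordered_prod_rev_inj:
  assumes "ordered_prod (rev [1..<2 ^ k]) v = ordered_prod (rev [1..<2 ^ k]) w" "0 < \<alpha>" "\<alpha> < 2 ^ k"
  shows "v \<alpha> = w \<alpha>"
proof -
  interpret op: filtered_group "opposite H" k e "\<lambda>x y. br y x" co by (rule filtered_group_opposite)
  have sub: "set [1..<2 ^ k] \<subseteq> {0<..<2 ^ k}" by auto
  show ?thesis by (rule op.ordered_prod_inj) (use assms in \<open>simp_all only: ordered_prod_opposite[OF sub]\<close>)
qed

section \<open>Points of iterated tangent bundles in charts\<close>

context good_module
begin

lemma Tk_map_local':
  assumes f: "smooth_on sc s s' U f" and g: "smooth_on sc s s' V g"
    and eq: "\<And>x. x \<in> U \<Longrightarrow> x \<in> V \<Longrightarrow> f x = g x"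
    and u: "shape_of u = Tk_shape k s" "Tk_foot k u \<in> U" "Tk_foot k u \<in> V"
  shows "Tk_map k sc s s' U f u = Tk_map k sc s s' V g u"
proof -
  have UV: "open (U \<inter> V)" using smooth_onD(2)[OF f] smooth_onD(2)[OF g] by blast
  have f': "smooth_on sc s s' (U \<inter> V) f" and g': "smooth_on sc s s' (U \<inter> V) g"
    using smooth_on_subset[OF f _ UV] smooth_on_subset[OF g _ UV] by auto
  have u': "u \<in> Tk_set k s (U \<inter> V)" using u smooth_onD(1)[OF f'] by (simp add: Tk_set_iff)
  have "Tk_map k sc s s' U f u = Tk_map k sc s s' (U \<inter> V) f u"
    by (rule Tk_map_local[OF f f' _ _ u']) auto
  also have "\<dots> = Tk_map k sc s s' (U \<inter> V) g u"
    by (rule Tk_map_local[OF f' g' _ _ u']) (use eq in auto)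
  also have "\<dots> = Tk_map k sc s s' V g u"
    by (rule Tk_map_local[OF g g' _ _ u', symmetric]) auto
  finally show ?thesis .
qed

lemma open_smooth_preimage:
  assumes f: "smooth_on sc s s' U f" and W: "open W"
  shows "open {x \<in> U. f x \<in> W}"
  by (rule open_preimage[OF smooth_onD(2,4)[OF f] W])

text \<open>Functoriality only requires the maps to be composable near the base point.\<close>

lemma Tk_map_comp_local:
  assumes f: "smooth_on sc s s' U f" and g: "smooth_on sc s' s'' W g" and h: "smooth_on sc s s'' V h"
    and eq: "\<And>x. x \<in> U \<Longrightarrow> x \<in> V \<Longrightarrow> f x \<in> W \<Longrightarrow> h x = g (f x)"
    and u: "shape_of u = Tk_shape k s" "Tk_foot k u \<in> U" "Tk_foot k u \<in> V" "f (Tk_foot k u) \<in> W"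
  shows "Tk_map k sc s s'' V h u = Tk_map k sc s' s'' W g (Tk_map k sc s s' U f u)"
proof -
  let ?U = "{x \<in> U. f x \<in> W}"
  have f': "smooth_on sc s s' ?U f"
    by (rule smooth_on_subset[OF f _ open_smooth_preimage[OF f smooth_onD(2)[OF g]]]) auto
  have gf: "smooth_on sc s s'' ?U (\<lambda>x. g (f x))" by (rule smooth_on_comp[OF f' g]) auto
  have "Tk_map k sc s s'' V h u = Tk_map k sc s s'' ?U (\<lambda>x. g (f x)) u"
    by (rule Tk_map_local'[OF h gf]) (use eq u in auto)
  also have "\<dots> = Tk_map k sc s' s'' W g (Tk_map k sc s s' ?U f u)"
    by (rule Tk_map_comp[OF f' g]) (use u smooth_onD(1)[OF f'] in \<open>auto simp: Tk_set_iff\<close>)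
  also have "Tk_map k sc s s' ?U f u = Tk_map k sc s s' U f u"
    by (rule Tk_map_local'[OF f' f]) (use u in auto)
  finally show ?thesis .
qed

end

lemma cinv_in: "x \<in> cimage c \<Longrightarrow> cinv c x \<in> fst c"
  by (auto simp: cimage_def cinv_def intro: inv_into_into)

lemma snd_cinv: "x \<in> cimage c \<Longrightarrow> snd c (cinv c x) = x"
  by (auto simp: cimage_def cinv_def intro: f_inv_into_f)

lemma snd_in_cimage: "p \<in> fst c \<Longrightarrow> snd c p \<in> cimage c"
  by (auto simp: cimage_def)

lemma cinv_snd: "inj_on (snd c) (fst c) \<Longrightarrow> p \<in> fst c \<Longrightarrow> cinv c (snd c p) = p"
  by (simp add: cinv_def)

lemma rep_dom_iff: "x \<in> rep_dom c d f \<longleftrightarrow> x \<in> cimage c \<and> f (cinv c x) \<in> fst d"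
  by (simp add: rep_dom_def)

lemma rep_in_cimage: "x \<in> rep_dom c d f \<Longrightarrow> rep c d f x \<in> cimage d"
  by (auto simp: rep_dom_iff rep_def intro: snd_in_cimage)

text \<open>All that the description of jets in charts needs from a manifold. Products of manifolds have
  these properties as well.\<close>

locale charted = good_module sc
  for sc :: "'k::hausdorff_ring \<Rightarrow> 'v::{topological_ab_group_add, t2_space} \<Rightarrow> 'v" +
  fixes M :: "('m, 'v, 'k) manifold"
  assumes inj_chart: "c \<in> atlas M \<Longrightarrow> inj_on (snd c) (fst c)"
    and smooth_transition: "c \<in> atlas M \<Longrightarrow> d \<in> atlas M \<Longrightarrow>
      smooth_on sc (model M) (model M) (rep_dom c d id) (rep c d id)"
begin

abbreviation s :: shape where "s \<equiv> model M"
abbreviation "jet_class k \<equiv> Tk_class sc k M"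
abbreviation "transition k c d \<equiv> Tk_map k sc s s (rep_dom c d id) (rep c d id)"

lemma cinv_rep:
  assumes "d \<in> atlas M" "x \<in> rep_dom c d f" shows "cinv d (rep c d f x) = f (cinv c x)"
  using assms cinv_snd[OF inj_chart] by (simp add: rep_dom_iff rep_def)

lemma rep_dom_self [simp]: "rep_dom c c id = cimage c"
  by (auto simp: rep_dom_iff cinv_in)

lemma rep_self: "x \<in> cimage c \<Longrightarrow> rep c c id x = x"
  by (simp add: rep_def snd_cinv)

lemma cimage_points: "c \<in> atlas M \<Longrightarrow> cimage c \<subseteq> points s"
  and open_cimage: "c \<in> atlas M \<Longrightarrow> open (cimage c)"
  using smooth_onD(1,2)[OF smooth_transition[of c c]] by auto

lemma Tk_set_cimage_iff:
  "c \<in> atlas M \<Longrightarrow> u \<in> Tk_set k s (cimage c) \<longleftrightarrow> shape_of u = Tk_shape k s \<and> Tk_foot k u \<in> cimage c"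
  by (rule Tk_set_iff[OF cimage_points])

lemma transition_self:
  assumes "c \<in> atlas M" "u \<in> Tk_set k s (cimage c)"
  shows "transition k c c u = u"
  unfolding rep_dom_self
  by (rule Tk_map_id[OF cimage_points[OF assms(1)] open_cimage[OF assms(1)] assms(2) rep_self])

lemma transition_trans:
  assumes "c \<in> atlas M" "d \<in> atlas M" "e \<in> atlas M" "shape_of u = Tk_shape k s"
    "Tk_foot k u \<in> rep_dom c d id" "cinv c (Tk_foot k u) \<in> fst e"
  shows "transition k d e (transition k c d u) = transition k c e u"
proof (rule Tk_map_comp_local[OF smooth_transition smooth_transition smooth_transition, symmetric])
  show "rep c e id x = rep d e id (rep c d id x)" if "x \<in> rep_dom c d id" for x
    using cinv_rep[OF assms(2) that] by (simp add: rep_def)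
  show "Tk_foot k u \<in> rep_dom c e id" using assms by (simp add: rep_dom_iff)
  show "rep c d id (Tk_foot k u) \<in> rep_dom d e id"
    using assms cinv_rep[OF assms(2,5)] rep_in_cimage[OF assms(5)] by (simp add: rep_dom_iff)
qed (use assms in auto)

lemma Tk_foot_transition:
  "c \<in> atlas M \<Longrightarrow> d \<in> atlas M \<Longrightarrow> u \<in> Tk_set k s (rep_dom c d id) \<Longrightarrow>
    Tk_foot k (transition k c d u) = rep c d id (Tk_foot k u)"
  by (rule Tk_foot_Tk_map)

lemma Tk_set_rep_dom_iff:
  "c \<in> atlas M \<Longrightarrow> d \<in> atlas M \<Longrightarrow>
    u \<in> Tk_set k s (rep_dom c d id) \<longleftrightarrow> shape_of u = Tk_shape k s \<and> Tk_foot k u \<in> rep_dom c d id"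
  by (rule Tk_set_iff[OF smooth_onD(1)[OF smooth_transition]])

lemma Tk_rel_iff:
  "((c, u), (d, w)) \<in> Tk_rel sc k M \<longleftrightarrow> c \<in> atlas M \<and> d \<in> atlas M \<and> shape_of u = Tk_shape k s \<and>
     Tk_foot k u \<in> rep_dom c d id \<and> w = transition k c d u"
proof -
  have "((c, u), (d, w)) \<in> Tk_rel sc k M \<longleftrightarrow> c \<in> atlas M \<and> d \<in> atlas M \<and>
      u \<in> Tk_set k s (rep_dom c d id) \<and> w = transition k c d u"
    unfolding Tk_rel_def by blast
  then show ?thesis using Tk_set_rep_dom_iff[of c d u k] by blast
qed

lemma Tk_rel_sym:
  assumes "((c, u), (d, w)) \<in> Tk_rel sc k M" shows "((d, w), (c, u)) \<in> Tk_rel sc k M"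
proof -
  from assms have *: "c \<in> atlas M" "d \<in> atlas M" "shape_of u = Tk_shape k s" "Tk_foot k u \<in> rep_dom c d id"
    "w = transition k c d u" by (auto simp: Tk_rel_iff)
  then have u: "u \<in> Tk_set k s (rep_dom c d id)" by (simp add: Tk_set_rep_dom_iff)
  have foot: "Tk_foot k w = rep c d id (Tk_foot k u)" using * Tk_foot_transition u by simp
  have "Tk_foot k w \<in> rep_dom d c id"
    using * cinv_rep[OF *(2,4)] rep_in_cimage[OF *(4)] unfolding foot by (auto simp: rep_dom_iff cinv_in)
  moreover have "shape_of w = Tk_shape k s" using * u shape_Tk_map[OF smooth_transition[OF *(1,2)]] by simp
  moreover have "u = transition k d c w"
  proof -
    have "Tk_foot k u \<in> cimage c" using *(4) by (simp add: rep_dom_iff)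
    then have "transition k d c w = transition k c c u" "u \<in> Tk_set k s (cimage c)"
      using transition_trans[OF *(1,2,1,3,4)] *(1,3,5) by (simp_all add: cinv_in Tk_set_cimage_iff)
    then show ?thesis using transition_self[OF *(1)] by simp
  qed
  ultimately show ?thesis using *(1,2) unfolding Tk_rel_iff by blast
qed

lemma Tk_rel_trans:
  assumes "((c, u), (d, w)) \<in> Tk_rel sc k M" "((d, w), (e, z)) \<in> Tk_rel sc k M"
  shows "((c, u), (e, z)) \<in> Tk_rel sc k M"
proof -
  from assms have *: "c \<in> atlas M" "d \<in> atlas M" "shape_of u = Tk_shape k s" "Tk_foot k u \<in> rep_dom c d id"
    "w = transition k c d u" "e \<in> atlas M" "Tk_foot k w \<in> rep_dom d e id" "z = transition k d e w" by (auto simp: Tk_rel_iff)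
  then have u: "u \<in> Tk_set k s (rep_dom c d id)" by (simp add: Tk_set_rep_dom_iff)
  have "cinv c (Tk_foot k u) \<in> fst e"
    using * Tk_foot_transition[OF *(1,2) u] cinv_rep[OF *(2,4)] by (simp add: rep_dom_iff)
  then show ?thesis using * transition_trans[OF *(1,2,6,3,4)] by (simp add: Tk_rel_iff rep_dom_iff)
qed

lemma Tk_class_memb_iff: "(d, w) \<in> jet_class k c u \<longleftrightarrow> ((c, u), (d, w)) \<in> Tk_rel sc k M"
  by (simp add: Tk_class_def)

lemma Tk_class_eqI:
  assumes "((c, u), (d, w)) \<in> Tk_rel sc k M" shows "jet_class k c u = jet_class k d w"
proof -
  have "(e, z) \<in> jet_class k c u \<longleftrightarrow> (e, z) \<in> jet_class k d w" for e z
    unfolding Tk_class_memb_iff using Tk_rel_trans[OF assms] Tk_rel_trans[OF Tk_rel_sym[OF assms]] by blast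
  then show ?thesis by auto
qed

lemma Tk_class_transition:
  assumes "c \<in> atlas M" "d \<in> atlas M" "u \<in> Tk_set k s (rep_dom c d id)"
  shows "jet_class k d (transition k c d u) = jet_class k c u"
  by (rule Tk_class_eqI[symmetric]) (use assms in \<open>auto simp: Tk_rel_iff Tk_set_rep_dom_iff\<close>)

lemma coords_Tk_class:
  assumes "c \<in> atlas M" "d \<in> atlas M" "u \<in> Tk_set k s (rep_dom c d id)"
  shows "coords d (jet_class k c u) = transition k c d u"
  using assms unfolding coords_def Tk_class_memb_iff
  by (intro the_equality) (auto simp: Tk_rel_iff Tk_set_rep_dom_iff)

lemma coords_Tk_class_self:
  assumes "c \<in> atlas M" "u \<in> Tk_set k s (cimage c)"
  shows "coords c (jet_class k c u) = u"
  using coords_Tk_class[OF assms(1,1)] assms transition_self by simp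

lemma foot_Tk_class:
  assumes "c \<in> atlas M" "u \<in> Tk_set k s (cimage c)"
  shows "foot k (jet_class k c u) = cinv c (Tk_foot k u)"
  unfolding foot_def
proof (rule the_equality)
  have "(c, u) \<in> jet_class k c u"
    using assms transition_self[OF assms] Tk_set_cimage_iff by (auto simp: Tk_class_memb_iff Tk_rel_iff)
  then show "\<exists>(d, w)\<in>jet_class k c u. cinv c (Tk_foot k u) = cinv d (Tk_foot k w)" by blast
next
  fix p assume "\<exists>(d, w)\<in>jet_class k c u. p = cinv d (Tk_foot k w)"
  then obtain d w where "(d, w) \<in> jet_class k c u" and p: "p = cinv d (Tk_foot k w)" by blast
  then have *: "d \<in> atlas M" "shape_of u = Tk_shape k s" "Tk_foot k u \<in> rep_dom c d id" "w = transition k c d u"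
    by (auto simp: Tk_class_memb_iff Tk_rel_iff)
  then show "p = cinv c (Tk_foot k u)"
    using p Tk_foot_transition[OF assms(1) *(1)] cinv_rep[OF *(1,3)] Tk_set_rep_dom_iff[OF assms(1) *(1)] by simp
qed

lemma Tk_class_in_bundle:
  "c \<in> atlas M \<Longrightarrow> u \<in> Tk_set k s (cimage c) \<Longrightarrow> jet_class k c u \<in> Tk_bundle sc k M"
  unfolding Tk_bundle_def Tk_class_def by (rule quotientI) (simp add: Tk_pre_def)

lemma Tk_bundle_in_chart:
  assumes "\<xi> \<in> Tk_bundle sc k M" "d \<in> atlas M" "foot k \<xi> \<in> fst d"
  obtains w where "w \<in> Tk_set k s (cimage d)" "\<xi> = jet_class k d w"
proof -
  obtain c u where c: "c \<in> atlas M" "u \<in> Tk_set k s (cimage c)" "\<xi> = jet_class k c u"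
    using assms(1) by (auto simp: Tk_bundle_def Tk_class_def Tk_pre_def elim!: quotientE)
  then have "cinv c (Tk_foot k u) \<in> fst d" using assms(3) foot_Tk_class by simp
  then have u: "u \<in> Tk_set k s (rep_dom c d id)"
    using c assms(2) by (simp add: Tk_set_rep_dom_iff Tk_set_cimage_iff rep_dom_iff)
  have "transition k c d u \<in> Tk_set k s (cimage d)"
    using u c assms(2) Tk_foot_transition[OF c(1) assms(2) u] rep_in_cimage[of "Tk_foot k u" c d id]
      shape_Tk_map[OF smooth_transition[OF c(1) assms(2)] u]
    by (simp add: Tk_set_cimage_iff Tk_set_rep_dom_iff)
  then show ?thesis using that Tk_class_transition[OF c(1) assms(2) u] c(3) by metis
qed

lemma chart_at:
  assumes "p \<in> fst c" "c \<in> atlas M"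
  shows "chart_at M p \<in> atlas M" "p \<in> fst (chart_at M p)"
  using someI[of "\<lambda>c. c \<in> atlas M \<and> p \<in> fst c" c] assms unfolding chart_at_def by auto

end

text \<open>\<open>Tk_fun\<close> uses the charts selected by \<open>chart_at\<close>. By functoriality, the result is the
  same in any pair of charts in which \<open>f\<close> is defined at the foot of the jet.\<close>

lemma Tk_fun_Tk_class:
  assumes "charted sc M" "charted sc N"
    and smooth: "\<And>c d. c \<in> atlas M \<Longrightarrow> d \<in> atlas N \<Longrightarrow>
      smooth_on sc (model M) (model N) (rep_dom c d f) (rep c d f)"
    and cd: "c \<in> atlas M" "d \<in> atlas N" and u: "u \<in> Tk_set k (model M) (rep_dom c d f)"
  shows "Tk_fun sc k M N f (Tk_class sc k M c u) =
    Tk_class sc k N d (Tk_map k sc (model M) (model N) (rep_dom c d f) (rep c d f) u)"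
proof -
  interpret M: charted sc M by (rule assms)
  interpret N: charted sc N by (rule assms)
  let ?p = "cinv c (Tk_foot k u)"
  let ?c = "chart_at M ?p" and ?d = "chart_at N (f ?p)"
  let ?T = "\<lambda>c d. Tk_map k sc (model M) (model N) (rep_dom c d f) (rep c d f)"
  have foot: "Tk_foot k u \<in> rep_dom c d f" and sh: "shape_of u = Tk_shape k (model M)"
    using u Tk_set_iff[OF M.smooth_onD(1)[OF smooth[OF cd]]] by auto
  then have p: "Tk_foot k u \<in> cimage c" "f ?p \<in> fst d" "?p \<in> fst c" by (auto simp: rep_dom_iff cinv_in)
  have u': "u \<in> Tk_set k (model M) (cimage c)" using M.Tk_set_cimage_iff[OF cd(1)] sh p by simp
  have fp: "foot k (Tk_class sc k M c u) = ?p" by (rule M.foot_Tk_class[OF cd(1) u'])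
  have c': "?c \<in> atlas M" "?p \<in> fst ?c" using M.chart_at[OF p(3) cd(1)] .
  have d': "?d \<in> atlas N" "f ?p \<in> fst ?d" using N.chart_at[OF p(2) cd(2)] .
  have uc: "u \<in> Tk_set k (model M) (rep_dom c ?c id)"
    using c' p sh M.Tk_set_rep_dom_iff[OF cd(1) c'(1)] by (simp add: rep_dom_iff)
  have "Tk_fun sc k M N f (Tk_class sc k M c u) = Tk_class sc k N ?d (?T ?c ?d (M.transition k c ?c u))"
    unfolding Tk_fun_def fp Let_def using M.coords_Tk_class[OF cd(1) c'(1) uc] by simp
  also have "?T ?c ?d (M.transition k c ?c u) = ?T c ?d u"
  proof (rule M.Tk_map_comp_local[OF M.smooth_transition smooth smooth, symmetric])
    show "rep c ?d f x = rep ?c ?d f (rep c ?c id x)" if "x \<in> rep_dom c ?c id" for x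
      using M.cinv_rep[OF c'(1) that] by (simp add: rep_def)
    show "Tk_foot k u \<in> rep_dom c ?c id" "Tk_foot k u \<in> rep_dom c ?d f"
      using p c' d' by (auto simp: rep_dom_iff)
    then show "rep c ?c id (Tk_foot k u) \<in> rep_dom ?c ?d f"
      using d' M.cinv_rep[OF c'(1), of "Tk_foot k u" c id] rep_in_cimage[of "Tk_foot k u" c ?c id]
      by (simp add: rep_dom_iff)
  qed (use cd c' d' sh in auto)
  also have "\<dots> = N.transition k d ?d (?T c d u)"
  proof (rule M.Tk_map_comp_local[OF smooth N.smooth_transition smooth])
    show "rep c ?d f x = rep d ?d id (rep c d f x)" if "x \<in> rep_dom c d f" for x
      using N.cinv_rep[OF cd(2) that] by (simp add: rep_def)
    show "Tk_foot k u \<in> rep_dom c ?d f" using p d' by (auto simp: rep_dom_iff)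
    show "rep c d f (Tk_foot k u) \<in> rep_dom d ?d id"
      using d' N.cinv_rep[OF cd(2) foot] rep_in_cimage[OF foot] by (simp add: rep_dom_iff)
  qed (use cd c' d' sh foot in auto)
  also have "Tk_class sc k N ?d (N.transition k d ?d (?T c d u)) = Tk_class sc k N d (?T c d u)"
  proof (rule N.Tk_class_transition[OF cd(2) d'(1)])
    have "Tk_foot k (?T c d u) = rep c d f (Tk_foot k u)" by (rule Tk_foot_Tk_map[OF u])
    then show "?T c d u \<in> Tk_set k (model N) (rep_dom d ?d id)"
      using d' N.cinv_rep[OF cd(2) foot] rep_in_cimage[OF foot] M.shape_Tk_map[OF smooth[OF cd] u]
      by (simp add: N.Tk_set_rep_dom_iff[OF cd(2) d'(1)] rep_dom_iff)
  qed
  finally show ?thesis .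
qed

section \<open>Products of manifolds\<close>

lemma fst_prod_chart [simp]: "fst (prod_chart c d) = fst c \<times> fst d"
  and snd_prod_chart [simp]: "snd (prod_chart c d) (p, q) = VPair (snd c p) (snd d q)"
  by (simp_all add: prod_chart_def)

lemma cimage_prod_chart: "VPair x y \<in> cimage (prod_chart c d) \<longleftrightarrow> x \<in> cimage c \<and> y \<in> cimage d"
  by (force simp: cimage_def image_iff)

lemma cimage_prod_chart_VPair: "p \<in> cimage (prod_chart c d) \<Longrightarrow> \<exists>x y. p = VPair x y"
  by (auto simp: cimage_def)

lemma inj_prod_chart:
  "inj_on (snd c) (fst c) \<Longrightarrow> inj_on (snd d) (fst d) \<Longrightarrow> inj_on (snd (prod_chart c d)) (fst (prod_chart c d))"
  by (auto simp: inj_on_def)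

lemma cinv_prod_chart:
  assumes "inj_on (snd c) (fst c)" "inj_on (snd d) (fst d)" "x \<in> cimage c" "y \<in> cimage d"
  shows "cinv (prod_chart c d) (VPair x y) = (cinv c x, cinv d y)"
proof -
  have "snd (prod_chart c d) (cinv c x, cinv d y) = VPair x y" using assms by (simp add: snd_cinv)
  moreover have "(cinv c x, cinv d y) \<in> fst (prod_chart c d)" using assms by (simp add: cinv_in)
  ultimately show ?thesis using cinv_snd[OF inj_prod_chart[OF assms(1,2)]] by metis
qed

lemma charted_prod:
  assumes "charted sc M" "charted sc N"
  shows "charted sc (prod_manifold M N)"
proof -
  interpret M: charted sc M by (rule assms)
  interpret N: charted sc N by (rule assms)
  let ?P = "prod_manifold M N"
  show ?thesis
  proof (intro charted.intro charted_axioms.intro M.good_module_axioms)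
    fix c assume "c \<in> atlas ?P"
    then obtain a b where "c = prod_chart a b" "a \<in> atlas M" "b \<in> atlas N" by (auto simp: prod_manifold_def)
    then show "inj_on (snd c) (fst c)"
      using inj_prod_chart[OF M.inj_chart N.inj_chart] by blast
  next
    fix c c' assume "c \<in> atlas ?P" "c' \<in> atlas ?P"
    then obtain a b a' b' where c: "c = prod_chart a b" "c' = prod_chart a' b'"
      and at: "a \<in> atlas M" "a' \<in> atlas M" "b \<in> atlas N" "b' \<in> atlas N" by (auto simp: prod_manifold_def)
    let ?A = "rep_dom a a' id" and ?B = "rep_dom b b' id"
    have cinv: "cinv c (VPair x y) = (cinv a x, cinv b y)" if "x \<in> cimage a" "y \<in> cimage b" for x y
      unfolding c using cinv_prod_chart M.inj_chart N.inj_chart at that by blast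
    have dom: "rep_dom c c' id = {VPair x y | x y. x \<in> ?A \<and> y \<in> ?B}"
    proof (rule Set.set_eqI)
      fix p show "p \<in> rep_dom c c' id \<longleftrightarrow> p \<in> {VPair x y | x y. x \<in> ?A \<and> y \<in> ?B}"
      proof (cases "\<exists>x y. p = VPair x y")
        case True
        then obtain x y where "p = VPair x y" by blast
        then show ?thesis using cinv[of x y] by (auto simp: rep_dom_iff c cimage_prod_chart)
      next
        case False
        then show ?thesis using cimage_prod_chart_VPair[of p a b] by (auto simp: rep_dom_iff c)
      qed
    qed
    note A = M.smooth_transition[OF at(1,2)] and B = N.smooth_transition[OF at(3,4)]
    have op: "open (rep_dom c c' id)"
      unfolding dom by (rule open_VPair_image[OF M.smooth_onD(2)[OF A] M.smooth_onD(2)[OF B]])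
    have sub: "rep_dom c c' id \<subseteq> points (Prod (model M) (model N))"
      using M.smooth_on_dom_shape[OF A] M.smooth_on_dom_shape[OF B] unfolding dom by auto
    have "smooth_on sc (Prod (model M) (model N)) (model M) (rep_dom c c' id) (\<lambda>p. rep a a' id (vfst p))"
      by (rule M.smooth_on_comp[OF M.smooth_on_linear[OF M.continuous_linear_vfst sub op] A]) (auto simp: dom)
    moreover have "smooth_on sc (Prod (model M) (model N)) (model N) (rep_dom c c' id) (\<lambda>p. rep b b' id (vsnd p))"
      by (rule M.smooth_on_comp[OF M.smooth_on_linear[OF M.continuous_linear_vsnd sub op] B]) (auto simp: dom)
    ultimately have "smooth_on sc (Prod (model M) (model N)) (Prod (model M) (model N)) (rep_dom c c' id)
        (\<lambda>p. VPair (rep a a' id (vfst p)) (rep b b' id (vsnd p)))"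
      by (rule M.smooth_on_VPair)
    then show "smooth_on sc (model ?P) (model ?P) (rep_dom c c' id) (rep c c' id)"
      unfolding prod_manifold_def manifold.simps
    proof (rule M.smooth_on_cong)
      fix p assume "p \<in> rep_dom c c' id"
      then obtain x y where "p = VPair x y" "x \<in> ?A" "y \<in> ?B" unfolding dom by blast
      then show "VPair (rep a a' id (vfst p)) (rep b b' id (vsnd p)) = rep c c' id p"
        using cinv[of x y] by (simp add: rep_def rep_dom_iff) (simp add: c)
    qed
  qed
qed

section \<open>The group law in the chart at the unit\<close>

lemma charted_of_smooth_manifold:
  assumes "good_module sc" "smooth_manifold sc M"
  shows "charted sc M"
proof (intro charted.intro charted_axioms.intro assms(1))
  fix c assume c: "c \<in> atlas M"
  then have h: "homeomorphic_map (subtopology (mtop M) (fst c)) (top_of_set (cimage c)) (snd c)"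
    and o: "openin (mtop M) (fst c)" using assms(2) by (auto simp: smooth_manifold_def)
  then show "inj_on (snd c) (fst c)"
    using homeomorphic_imp_injective_map[OF h] openin_subset[OF o] by (simp add: Int_absorb1)
next
  fix c d assume "c \<in> atlas M" "d \<in> atlas M"
  then show "smooth_on sc (model M) (model M) (rep_dom c d id) (rep c d id)"
    using assms(2) unfolding smooth_manifold_def by blast
qed

lemma prod_chart_in_atlas: "c \<in> atlas M \<Longrightarrow> d \<in> atlas N \<Longrightarrow> prod_chart c d \<in> atlas (prod_manifold M N)"
  unfolding prod_manifold_def manifold.simps by blast

lemma prod_chart_atlasE:
  assumes "c \<in> atlas (prod_manifold M N)"
  obtains a b where "c = prod_chart a b" "a \<in> atlas M" "b \<in> atlas N"
  using assms unfolding prod_manifold_def manifold.simps by blast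

locale lie_group_over = good_module sc
  for sc :: "'k::hausdorff_ring \<Rightarrow> 'v::{topological_ab_group_add, t2_space} \<Rightarrow> 'v" +
  fixes G :: "('g, 'v, 'k) lie_structure"
  assumes lie: "lie_group sc G"
begin

abbreviation "M \<equiv> mfd G"
abbreviation "c0 \<equiv> unit_chart G"
abbreviation "C \<equiv> cimage c0"
abbreviation "x0 \<equiv> snd c0 \<one>\<^bsub>G\<^esub>"
abbreviation "mul \<equiv> (\<lambda>(x, y). x \<otimes>\<^bsub>G\<^esub> y)"

sublocale G: group G
  using lie by (simp add: lie_group_def)

lemma charted_M: "charted sc M"
  by (rule charted_of_smooth_manifold[OF good_module_axioms]) (use lie in \<open>simp add: lie_group_def\<close>)

sublocale M: charted sc M
  by (rule charted_M)

lemma model_M [simp]: "model M = Model"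
  using lie by (simp add: lie_group_def)

lemma charts_cover: "(\<Union>c\<in>atlas M. fst c) = carrier G"
  using lie by (simp add: lie_group_def smooth_manifold_def)

lemma chart_carrier: "c \<in> atlas M \<Longrightarrow> p \<in> fst c \<Longrightarrow> p \<in> carrier G"
  using charts_cover by blast

lemma unit_chart: "c0 \<in> atlas M" "\<one>\<^bsub>G\<^esub> \<in> fst c0"
proof -
  obtain c where "c \<in> atlas M" "\<one>\<^bsub>G\<^esub> \<in> fst c" using charts_cover G.one_closed by blast
  then show "c0 \<in> atlas M" "\<one>\<^bsub>G\<^esub> \<in> fst c0" unfolding unit_chart_def using M.chart_at by blast+
qed

lemma C: "C \<subseteq> points Model" "open C" "x0 \<in> C"
  using M.cimage_points[OF unit_chart(1)] M.open_cimage[OF unit_chart(1)] snd_in_cimage[OF unit_chart(2)] by auto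

lemma shape_C: "x \<in> C \<Longrightarrow> shape_of x = Model"
  using C(1) by auto

lemma shape_x0 [simp]: "shape_of x0 = Model"
  using C by auto

lemma cinv_C: "x \<in> C \<Longrightarrow> cinv c0 x \<in> fst c0" "x \<in> C \<Longrightarrow> cinv c0 x \<in> carrier G"
  using cinv_in chart_carrier[OF unit_chart(1)] by blast+

lemma cinv_x0 [simp]: "cinv c0 x0 = \<one>\<^bsub>G\<^esub>"
  by (rule cinv_snd[OF M.inj_chart[OF unit_chart(1)] unit_chart(2)])

lemma smooth_mul:
  "a \<in> atlas M \<Longrightarrow> b \<in> atlas M \<Longrightarrow> d \<in> atlas M \<Longrightarrow>
    smooth_on sc (Prod Model Model) Model (rep_dom (prod_chart a b) d mul) (rep (prod_chart a b) d mul)"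
proof -
  assume *: "a \<in> atlas M" "b \<in> atlas M" "d \<in> atlas M"
  have "smooth_map sc (prod_manifold M M) M mul" using lie by (simp add: lie_group_def)
  moreover have "prod_chart a b \<in> atlas (prod_manifold M M)" using * by (intro prod_chart_in_atlas)
  ultimately have "smooth_on sc (model (prod_manifold M M)) (model M) (rep_dom (prod_chart a b) d mul) (rep (prod_chart a b) d mul)"
    using * unfolding smooth_map_def by blast
  then show ?thesis by (simp add: prod_manifold_def)
qed

lemma smooth_inv: "smooth_on sc Model Model (rep_dom c0 c0 (m_inv G)) (rep c0 c0 (m_inv G))"
proof -
  have "smooth_map sc M M (m_inv G)" using lie by (simp add: lie_group_def)
  then have "smooth_on sc (model M) (model M) (rep_dom c0 c0 (m_inv G)) (rep c0 c0 (m_inv G))"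
    using unit_chart unfolding smooth_map_def by blast
  then show ?thesis by simp
qed

text \<open>The multiplication in the chart at the unit. The chart is in general not closed under
  multiplication, whence the domain.\<close>

abbreviation "MM \<equiv> Prod Model Model"
definition "Dm = rep_dom (prod_chart c0 c0) c0 mul"
definition "mu = rep (prod_chart c0 c0) c0 mul"

lemma smooth_mu: "smooth_on sc MM Model Dm mu"
  unfolding Dm_def mu_def by (rule smooth_mul[OF unit_chart(1) unit_chart(1) unit_chart(1)])

lemma cinv_prod: "a \<in> atlas M \<Longrightarrow> b \<in> atlas M \<Longrightarrow> x \<in> cimage a \<Longrightarrow> y \<in> cimage b \<Longrightarrow>
    cinv (prod_chart a b) (VPair x y) = (cinv a x, cinv b y)"
  by (rule cinv_prod_chart[OF M.inj_chart M.inj_chart])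

lemma rep_dom_mul_iff: "a \<in> atlas M \<Longrightarrow> b \<in> atlas M \<Longrightarrow> VPair x y \<in> rep_dom (prod_chart a b) d mul \<longleftrightarrow>
    x \<in> cimage a \<and> y \<in> cimage b \<and> cinv a x \<otimes>\<^bsub>G\<^esub> cinv b y \<in> fst d"
  by (auto simp: rep_dom_iff cimage_prod_chart cinv_prod)

lemma Dm_iff: "VPair x y \<in> Dm \<longleftrightarrow> x \<in> C \<and> y \<in> C \<and> cinv c0 x \<otimes>\<^bsub>G\<^esub> cinv c0 y \<in> fst c0"
  unfolding Dm_def by (rule rep_dom_mul_iff[OF unit_chart(1) unit_chart(1)])

lemma DmE: assumes "p \<in> Dm" obtains x y where "p = VPair x y" "x \<in> C" "y \<in> C"
  using assms cimage_prod_chart_VPair[of p c0 c0] Dm_iff by (auto simp: Dm_def rep_dom_iff)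

lemma mu_eq: "x \<in> C \<Longrightarrow> y \<in> C \<Longrightarrow> mu (VPair x y) = snd c0 (cinv c0 x \<otimes>\<^bsub>G\<^esub> cinv c0 y)"
  by (simp add: mu_def rep_def cinv_prod[OF unit_chart(1) unit_chart(1)])

lemma mu_C: "VPair x y \<in> Dm \<Longrightarrow> mu (VPair x y) \<in> C"
  by (simp add: Dm_iff mu_eq snd_in_cimage)

lemma cinv_mu: "VPair x y \<in> Dm \<Longrightarrow> cinv c0 (mu (VPair x y)) = cinv c0 x \<otimes>\<^bsub>G\<^esub> cinv c0 y"
  by (simp add: Dm_iff mu_eq cinv_snd[OF M.inj_chart[OF unit_chart(1)]])

lemma mu_x0: "x \<in> C \<Longrightarrow> VPair x x0 \<in> Dm" "x \<in> C \<Longrightarrow> VPair x0 x \<in> Dm"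
  "x \<in> C \<Longrightarrow> mu (VPair x x0) = x" "x \<in> C \<Longrightarrow> mu (VPair x0 x) = x"
  using C cinv_C by (auto simp: Dm_iff mu_eq snd_cinv)

text \<open>The fiber over the unit, in the coordinates of the chart at the unit.\<close>

definition fiber :: "nat \<Rightarrow> ('v, 'k) elt set" where
  "fiber k = {u. shape_of u = Tk_shape k Model \<and> Tk_foot k u = x0}"

definition base :: "nat \<Rightarrow> ('v, 'k) elt" where "base k = Tk_single Model k 0 x0"

definition fmul :: "nat \<Rightarrow> ('v, 'k) elt \<Rightarrow> ('v, 'k) elt \<Rightarrow> ('v, 'k) elt" where
  "fmul k u w = Tk_map k sc MM Model Dm mu (Tk_zip k u w)"

lemma Tk_foot_base [simp]: "Tk_foot k (base k) = x0"
  unfolding base_def by (induction k) auto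

lemma shape_base [simp]: "shape_of (base k) = Tk_shape k Model"
  by (simp add: base_def)

lemma base_fiber [simp]: "base k \<in> fiber k"
  by (simp add: fiber_def)

lemma fiber_subset: "fiber k \<subseteq> Tk_set k Model C"
  using C by (auto simp: fiber_def Tk_set_iff)

lemma Tk_set_Dm_iff:
  "shape_of u = Tk_shape k Model \<Longrightarrow> shape_of w = Tk_shape k Model \<Longrightarrow>
    Tk_zip k u w \<in> Tk_set k MM Dm \<longleftrightarrow> VPair (Tk_foot k u) (Tk_foot k w) \<in> Dm"
  by (simp add: Tk_set_iff[OF smooth_onD(1)[OF smooth_mu]])

lemma fmul_fiber: "u \<in> fiber k \<Longrightarrow> w \<in> fiber k \<Longrightarrow> fmul k u w \<in> fiber k"
  using mu_x0[OF C(3)] Tk_set_Dm_iff[of u k w] shape_Tk_map[OF smooth_mu, of "Tk_zip k u w" k]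
  by (simp add: fiber_def fmul_def Tk_foot_Tk_map)

text \<open>A pointwise product $h = f \cdot g$ of maps into the chart satisfies
  $T^kh = T^kf \cdot T^kg$. Each group law follows from an identity between such maps.\<close>

lemma fmul_comp:
  assumes f: "smooth_on sc s Model U f" and g: "smooth_on sc s Model U g" and h: "smooth_on sc s Model V h"
    and eq: "\<And>x. x \<in> U \<Longrightarrow> x \<in> V \<Longrightarrow> VPair (f x) (g x) \<in> Dm \<Longrightarrow> h x = mu (VPair (f x) (g x))"
    and u: "shape_of u = Tk_shape k s" "Tk_foot k u \<in> U" "Tk_foot k u \<in> V"
      "VPair (f (Tk_foot k u)) (g (Tk_foot k u)) \<in> Dm"
  shows "fmul k (Tk_map k sc s Model U f u) (Tk_map k sc s Model U g u) = Tk_map k sc s Model V h u"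
proof -
  have "u \<in> Tk_set k s U" using u smooth_onD(1)[OF f] by (simp add: Tk_set_iff)
  then have "Tk_map k sc s MM U (\<lambda>x. VPair (f x) (g x)) u = Tk_zip k (Tk_map k sc s Model U f u) (Tk_map k sc s Model U g u)"
    by (rule Tk_map_VPair[OF f g])
  then show ?thesis unfolding fmul_def
    using Tk_map_comp_local[OF smooth_on_VPair[OF f g] smooth_mu h eq u] by simp
qed

lemma Tk_map_id_C: "u \<in> Tk_set k Model C \<Longrightarrow> Tk_map k sc Model Model C (\<lambda>x. x) u = u"
  by (rule Tk_map_id[OF C(1,2)]) auto

lemma fmul_base_left: "u \<in> Tk_set k Model C \<Longrightarrow> fmul k (base k) u = u"
  and fmul_base_right: "u \<in> Tk_set k Model C \<Longrightarrow> fmul k u (base k) = u"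
proof -
  assume u: "u \<in> Tk_set k Model C"
  note const = smooth_on_const[OF C(1,2) shape_x0] and id = smooth_on_linear[OF continuous_linear_id C(1,2)]
  have u': "shape_of u = Tk_shape k Model" "Tk_foot k u \<in> C" using u C by (auto simp: Tk_set_iff)
  have b: "Tk_map k sc Model Model C (\<lambda>_. x0) u = base k"
    unfolding base_def by (rule Tk_map_const[OF C(1,2) shape_x0 u])
  show "fmul k (base k) u = u"
    using fmul_comp[OF const id id, of u k] u' mu_x0 by (simp add: b Tk_map_id_C[OF u])
  show "fmul k u (base k) = u"
    using fmul_comp[OF id const id, of u k] u' mu_x0 by (simp add: b Tk_map_id_C[OF u])
qed

lemma fmul_inverse:
  assumes u: "u \<in> fiber k" shows "\<exists>w\<in>fiber k. fmul k w u = base k"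
proof -
  let ?i = "rep c0 c0 (m_inv G)" and ?D = "rep_dom c0 c0 (m_inv G)"
  have D: "?D \<subseteq> points Model" "open ?D" "?D \<subseteq> C" "x0 \<in> ?D"
    using smooth_onD[OF smooth_inv] unit_chart(2) C(3) by (auto simp: rep_dom_iff)
  note id = smooth_on_linear[OF continuous_linear_id D(1,2)] and const = smooth_on_const[OF D(1,2) shape_x0]
  have u': "shape_of u = Tk_shape k Model" "Tk_foot k u = x0" "u \<in> Tk_set k Model ?D"
    using u D by (auto simp: fiber_def Tk_set_iff)
  let ?w = "Tk_map k sc Model Model ?D ?i u"
  have i: "?i x \<in> C" "cinv c0 (?i x) = inv\<^bsub>G\<^esub> (cinv c0 x)" if "x \<in> ?D" for x
    using rep_in_cimage[OF that] M.cinv_rep[OF unit_chart(1) that] by auto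
  have ix0: "?i x0 = x0" by (simp add: rep_def)
  have "fmul k ?w (Tk_map k sc Model Model ?D (\<lambda>x. x) u) = Tk_map k sc Model Model ?D (\<lambda>_. x0) u"
  proof (rule fmul_comp[OF smooth_inv id const])
    show "x0 = mu (VPair (?i x) x)" if "x \<in> ?D" for x
      using i[OF that] D(3) that cinv_C by (auto simp: mu_eq subset_iff)
    show "VPair (?i (Tk_foot k u)) (Tk_foot k u) \<in> Dm" using u'(2) ix0 mu_x0 C by simp
  qed (use u' D in auto)
  moreover have "Tk_map k sc Model Model ?D (\<lambda>_. x0) u = base k"
    unfolding base_def by (rule Tk_map_const[OF D(1,2) shape_x0 u'(3)])
  moreover have "Tk_map k sc Model Model ?D (\<lambda>x. x) u = u" by (rule Tk_map_id[OF D(1,2) u'(3)]) auto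
  moreover have "?w \<in> fiber k"
    using shape_Tk_map[OF smooth_inv u'(3)] Tk_foot_Tk_map[OF u'(3), of sc Model ?i] u'(2) ix0 by (simp add: fiber_def)
  ultimately show ?thesis by auto
qed

lemma Tk_map_vfst:
  assumes g: "smooth_on sc s' s'' W g" and U: "U \<subseteq> points (Prod s' s1)" "open U" "vfst ` U \<subseteq> W"
    and p: "Tk_zip k u w \<in> Tk_set k (Prod s' s1) U" "shape_of u = Tk_shape k s'" "shape_of w = Tk_shape k s1"
  shows "Tk_map k sc (Prod s' s1) s'' U (\<lambda>p. g (vfst p)) (Tk_zip k u w) = Tk_map k sc s' s'' W g u"
  using Tk_map_comp[OF smooth_on_linear[OF continuous_linear_vfst U(1,2)] g U(3) p(1)]
    Tk_map_linear[OF continuous_linear_vfst U(1,2) p(1)] p(2,3) by simp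

text \<open>Associativity is inherited from \<open>G\<close>: near the unit, both products are iterated
  tangent maps of the same function of three variables.\<close>

lemma fmul_assoc:
  assumes u: "u \<in> fiber k" and w: "w \<in> fiber k" and r: "r \<in> fiber k"
  shows "fmul k (fmul k u w) r = fmul k u (fmul k w r)"
proof -
  let ?s = "Prod MM Model"
  let ?p = "Tk_zip k (Tk_zip k u w) r"
  define U1 where "U1 = {VPair q z | q z. q \<in> Dm \<and> z \<in> C}"
  note Dm = smooth_onD(1,2)[OF smooth_mu]
  have U1: "U1 \<subseteq> points ?s" "open U1"
    unfolding U1_def using smooth_on_dom_shape[OF smooth_mu] shape_C open_VPair_image[OF Dm(2) C(2)] by auto
  define sh where "sh = (\<lambda>p. VPair (vsnd (vfst p)) (vsnd p) :: ('v, 'k) elt)"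
  have lin_fst: "continuous_linear ?s Model (\<lambda>p. vfst (vfst p))"
    and lin_sh: "continuous_linear ?s MM sh"
    unfolding sh_def
    by (intro continuous_linear_VPair continuous_linear_vsnd continuous_linear_comp[OF continuous_linear_vfst]
        continuous_linear_vfst)+
  define U2 where "U2 = {p \<in> U1. sh p \<in> Dm}"
  have smsh: "smooth_on sc ?s MM U1 sh" by (rule smooth_on_linear[OF lin_sh U1])
  have U2: "U2 \<subseteq> points ?s" "open U2" unfolding U2_def
    using U1 open_smooth_preimage[OF smsh Dm(2)] by auto
  have sh: "shape_of u = Tk_shape k Model" "shape_of w = Tk_shape k Model" "shape_of r = Tk_shape k Model"
    "Tk_foot k u = x0" "Tk_foot k w = x0" "Tk_foot k r = x0" using u w r by (auto simp: fiber_def)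
  have x0: "VPair x0 x0 \<in> Dm" "mu (VPair x0 x0) = x0" using mu_x0 C by auto
  have foot: "Tk_foot k ?p = VPair (VPair x0 x0) x0" by (simp add: sh)
  have footU: "Tk_foot k ?p \<in> U2" unfolding foot U2_def U1_def sh_def using x0 C by simp
  have shp: "shape_of ?p = Tk_shape k ?s" using sh by simp
  have p: "?p \<in> Tk_set k ?s U2" using footU shp by (simp add: Tk_set_iff[OF U2(1)])
  have muv: "smooth_on sc ?s Model U2 (\<lambda>p. mu (vfst p))" and C2: "smooth_on sc ?s Model U2 (\<lambda>p. vsnd p)"
    and fst2: "smooth_on sc ?s Model U2 (\<lambda>p. vfst (vfst p))" and mush: "smooth_on sc ?s Model U2 (\<lambda>p. mu (sh p))"
    by (rule smooth_on_comp[OF smooth_on_linear[OF continuous_linear_vfst U2] smooth_mu],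
        force simp: U2_def U1_def)
      (rule smooth_on_linear[OF continuous_linear_vsnd U2],
       rule smooth_on_linear[OF lin_fst U2],
       rule smooth_on_comp[OF smooth_on_linear[OF lin_sh U2] smooth_mu], force simp: U2_def)
  \<comment> \<open>\<open>h\<close> is the product $(xy)z$; the product $x(yz)$ agrees with it where both are defined\<close>
  define V where "V = {p \<in> U2. VPair (mu (vfst p)) (vsnd p) \<in> Dm}"
  define h where "h = (\<lambda>p. mu (VPair (mu (vfst p)) (vsnd p)))"
  have V: "open V" unfolding V_def by (rule open_smooth_preimage[OF smooth_on_VPair[OF muv C2] Dm(2)])
  have h: "smooth_on sc ?s Model V h" unfolding h_def
    by (rule smooth_on_comp[OF smooth_on_subset[OF smooth_on_VPair[OF muv C2] _ V] smooth_mu]) (auto simp: V_def)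
  have footV: "Tk_foot k ?p \<in> V" using footU x0 unfolding V_def foot by simp
  have "fmul k (Tk_map k sc ?s Model U2 (\<lambda>p. mu (vfst p)) ?p) (Tk_map k sc ?s Model U2 (\<lambda>p. vsnd p) ?p)
      = Tk_map k sc ?s Model V h ?p"
    by (rule fmul_comp[OF muv C2 h]) (use shp footU footV x0 sh in \<open>auto simp: h_def foot\<close>)
  moreover have "Tk_map k sc ?s Model U2 (\<lambda>p. mu (vfst p)) ?p = fmul k u w"
    unfolding fmul_def by (rule Tk_map_vfst[OF smooth_mu U2 _ p]) (use sh in \<open>auto simp: U2_def U1_def\<close>)
  moreover have "Tk_map k sc ?s Model U2 (\<lambda>p. vsnd p) ?p = r"
    using Tk_map_linear[OF continuous_linear_vsnd U2 p] sh by simp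
  ultimately have 1: "fmul k (fmul k u w) r = Tk_map k sc ?s Model V h ?p" by simp
  have "fmul k (Tk_map k sc ?s Model U2 (\<lambda>p. vfst (vfst p)) ?p) (Tk_map k sc ?s Model U2 (\<lambda>p. mu (sh p)) ?p)
      = Tk_map k sc ?s Model V h ?p"
  proof (rule fmul_comp[OF fst2 mush h])
    fix p assume "p \<in> U2" "p \<in> V" and d: "VPair (vfst (vfst p)) (mu (sh p)) \<in> Dm"
    then obtain q z where q: "p = VPair q z" "q \<in> Dm" "z \<in> C" and V': "VPair (mu q) z \<in> Dm" and sh': "sh p \<in> Dm"
      by (auto simp: U2_def U1_def V_def)
    obtain x y where xy: "q = VPair x y" "x \<in> C" "y \<in> C" using q(2) by (rule DmE)
    have d': "VPair x (mu (VPair y z)) \<in> Dm" "VPair y z \<in> Dm" using d sh' q(1) xy(1) by (simp_all add: sh_def)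
    have "h p = snd c0 ((cinv c0 x \<otimes>\<^bsub>G\<^esub> cinv c0 y) \<otimes>\<^bsub>G\<^esub> cinv c0 z)"
      using q xy V' mu_eq[of "mu q" z] mu_C[of x y] cinv_mu[of x y] by (simp add: h_def)
    also have "\<dots> = snd c0 (cinv c0 x \<otimes>\<^bsub>G\<^esub> (cinv c0 y \<otimes>\<^bsub>G\<^esub> cinv c0 z))"
      using q(3) xy cinv_C by (simp add: G.m_assoc)
    also have "\<dots> = mu (VPair x (mu (VPair y z)))"
      using d' xy mu_eq[of x "mu (VPair y z)"] mu_C[of y z] cinv_mu[of y z] by simp
    finally show "h p = mu (VPair (vfst (vfst p)) (mu (sh p)))" using q(1) xy(1) by (simp add: sh_def)
  qed (use shp footU footV x0 sh in \<open>auto simp: foot sh_def\<close>)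
  moreover have "Tk_map k sc ?s Model U2 (\<lambda>p. vfst (vfst p)) ?p = u"
  proof -
    have "Tk_map k sc ?s Model U2 (\<lambda>p. vfst (vfst p)) ?p = Tk_map k sc MM Model Dm vfst (Tk_zip k u w)"
      by (rule Tk_map_vfst[OF smooth_on_linear[OF continuous_linear_vfst Dm] U2 _ p])
        (use sh in \<open>auto simp: U2_def U1_def\<close>)
    also have "\<dots> = u"
      using Tk_map_linear[OF continuous_linear_vfst Dm, of "Tk_zip k u w" k] Tk_set_Dm_iff[of u k w] sh x0 by simp
    finally show ?thesis .
  qed
  moreover have "Tk_map k sc ?s Model U2 (\<lambda>p. mu (sh p)) ?p = fmul k w r"
  proof -
    have "Tk_map k sc ?s Model U2 (\<lambda>p. mu (sh p)) ?p = Tk_map k sc MM Model Dm mu (Tk_map k sc ?s MM U2 sh ?p)"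
      by (rule Tk_map_comp[OF smooth_on_linear[OF lin_sh U2] smooth_mu _ p]) (auto simp: U2_def)
    also have "Tk_map k sc ?s MM U2 sh ?p = Tk_zip k (Tk_map k sc ?s Model U2 (\<lambda>p. vsnd (vfst p)) ?p) (Tk_map k sc ?s Model U2 vsnd ?p)"
      unfolding sh_def
      by (rule Tk_map_VPair[OF smooth_on_linear[OF continuous_linear_comp[OF continuous_linear_vfst continuous_linear_vsnd] U2]
            smooth_on_linear[OF continuous_linear_vsnd U2] p])
    also have "Tk_map k sc ?s Model U2 (\<lambda>p. vsnd (vfst p)) ?p = Tk_map k sc MM Model Dm vsnd (Tk_zip k u w)"
      by (rule Tk_map_vfst[OF smooth_on_linear[OF continuous_linear_vsnd Dm] U2 _ p])
        (use sh in \<open>auto simp: U2_def U1_def\<close>)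
    also have "\<dots> = w"
      using Tk_map_linear[OF continuous_linear_vsnd Dm, of "Tk_zip k u w" k] Tk_set_Dm_iff[of u k w] sh x0 by simp
    also have "Tk_map k sc ?s Model U2 vsnd ?p = r"
      using Tk_map_linear[OF continuous_linear_vsnd U2 p] sh by simp
    finally show ?thesis by (simp add: fmul_def)
  qed
  ultimately show ?thesis using 1 by simp
qed

section \<open>The group structure of the fiber over the unit\<close>

definition to_jet :: "nat \<Rightarrow> ('v, 'k) elt \<Rightarrow> ('g, 'v, 'k) jet" where
  "to_jet k u = Tk_class sc k M c0 u"

lemma fiber_cimage: "u \<in> fiber k \<Longrightarrow> u \<in> Tk_set k (model M) C"
  using fiber_subset by auto

lemma coords_to_jet: "u \<in> fiber k \<Longrightarrow> coords c0 (to_jet k u) = u"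
  unfolding to_jet_def by (rule M.coords_Tk_class_self[OF unit_chart(1) fiber_cimage])

lemma foot_to_jet: "u \<in> fiber k \<Longrightarrow> foot k (to_jet k u) = \<one>\<^bsub>G\<^esub>"
  unfolding to_jet_def using M.foot_Tk_class[OF unit_chart(1) fiber_cimage] by (simp add: fiber_def)

lemma jets_over_unit: "{\<xi> \<in> Tk_bundle sc k M. foot k \<xi> = \<one>\<^bsub>G\<^esub>} = to_jet k ` fiber k"
proof (intro equalityI subsetI)
  fix \<xi> assume "\<xi> \<in> {\<xi> \<in> Tk_bundle sc k M. foot k \<xi> = \<one>\<^bsub>G\<^esub>}"
  then have \<xi>: "\<xi> \<in> Tk_bundle sc k M" "foot k \<xi> = \<one>\<^bsub>G\<^esub>" by auto
  then have "foot k \<xi> \<in> fst c0" using unit_chart(2) by simp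
  then obtain w where w: "w \<in> Tk_set k (model M) C" "\<xi> = to_jet k w"
    unfolding to_jet_def using M.Tk_bundle_in_chart[OF \<xi>(1) unit_chart(1)] by metis
  then have "cinv c0 (Tk_foot k w) = \<one>\<^bsub>G\<^esub>"
    using \<xi>(2) M.foot_Tk_class[OF unit_chart(1) w(1)] by (simp add: to_jet_def)
  moreover have "Tk_foot k w \<in> C" "shape_of w = Tk_shape k Model" using w(1) C by (auto simp: Tk_set_iff)
  ultimately have "w \<in> fiber k" using snd_cinv[of "Tk_foot k w" c0] by (simp add: fiber_def)
  with w(2) show "\<xi> \<in> to_jet k ` fiber k" by blast
next
  fix \<xi> assume "\<xi> \<in> to_jet k ` fiber k"
  then show "\<xi> \<in> {\<xi> \<in> Tk_bundle sc k M. foot k \<xi> = \<one>\<^bsub>G\<^esub>}"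
    using foot_to_jet M.Tk_class_in_bundle[OF unit_chart(1) fiber_cimage] by (auto simp: to_jet_def)
qed

abbreviation "UF k \<equiv> unit_fiber sc k G"

lemma UF_carrier: "carrier (UF k) = to_jet k ` fiber k"
  using jets_over_unit by (simp add: unit_fiber_def Tk_group_def)

lemma UF_one: "\<one>\<^bsub>UF k\<^esub> = to_jet k (base k)"
  by (simp add: unit_fiber_def Tk_group_def to_jet_def base_def)

lemma UF_mult:
  assumes u: "u \<in> fiber k" and w: "w \<in> fiber k"
  shows "to_jet k u \<otimes>\<^bsub>UF k\<^esub> to_jet k w = to_jet k (fmul k u w)"
proof -
  let ?P = "prod_manifold M M"
  have chart: "chart_at M \<one>\<^bsub>G\<^esub> = c0" by (simp add: unit_chart_def)
  have "Tk_pair sc k M M (to_jet k u) (to_jet k w) = Tk_class sc k ?P (prod_chart c0 c0) (Tk_zip k u w)"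
    unfolding Tk_pair_def Let_def using u w by (simp add: foot_to_jet chart coords_to_jet)
  moreover have "Tk_fun sc k ?P M mul (Tk_class sc k ?P (prod_chart c0 c0) (Tk_zip k u w)) =
      Tk_class sc k M c0 (Tk_map k sc (model ?P) (model M) (rep_dom (prod_chart c0 c0) c0 mul) (rep (prod_chart c0 c0) c0 mul) (Tk_zip k u w))"
  proof (rule Tk_fun_Tk_class[OF charted_prod[OF charted_M charted_M] charted_M])
    show "smooth_on sc (model ?P) (model M) (rep_dom c d mul) (rep c d mul)" if c: "c \<in> atlas ?P" and d: "d \<in> atlas M" for c d
    proof -
      obtain a b where "c = prod_chart a b" "a \<in> atlas M" "b \<in> atlas M" using prod_chart_atlasE[OF c] .
      then show ?thesis using smooth_mul[OF _ _ d] by (simp add: prod_manifold_def)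
    qed
    show "prod_chart c0 c0 \<in> atlas ?P" using unit_chart by (intro prod_chart_in_atlas)
    show "c0 \<in> atlas M" by (rule unit_chart)
    show "Tk_zip k u w \<in> Tk_set k (model ?P) (rep_dom (prod_chart c0 c0) c0 mul)"
      using u w Tk_set_Dm_iff[of u k w] mu_x0[OF C(3)] by (simp add: prod_manifold_def fiber_def Dm_def)
  qed
  ultimately show ?thesis
    by (simp add: unit_fiber_def Tk_group_def to_jet_def fmul_def Dm_def mu_def prod_manifold_def)
qed

lemma group_UF: "group (UF k)"
proof (rule groupI)
  fix x y z
  assume "x \<in> carrier (UF k)" "y \<in> carrier (UF k)" "z \<in> carrier (UF k)"
  then obtain u w r where *: "u \<in> fiber k" "w \<in> fiber k" "r \<in> fiber k" "x = to_jet k u" "y = to_jet k w" "z = to_jet k r"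
    unfolding UF_carrier by blast
  then show "x \<otimes>\<^bsub>UF k\<^esub> y \<otimes>\<^bsub>UF k\<^esub> z = x \<otimes>\<^bsub>UF k\<^esub> (y \<otimes>\<^bsub>UF k\<^esub> z)"
    using fmul_fiber fmul_assoc by (simp add: UF_mult)
next
  fix x y assume "x \<in> carrier (UF k)" "y \<in> carrier (UF k)"
  then show "x \<otimes>\<^bsub>UF k\<^esub> y \<in> carrier (UF k)" unfolding UF_carrier using fmul_fiber by (auto simp: UF_mult)
next
  show "\<one>\<^bsub>UF k\<^esub> \<in> carrier (UF k)" by (simp add: UF_one UF_carrier)
next
  fix x assume "x \<in> carrier (UF k)"
  then obtain u where u: "u \<in> fiber k" "x = to_jet k u" unfolding UF_carrier by blast
  show "\<one>\<^bsub>UF k\<^esub> \<otimes>\<^bsub>UF k\<^esub> x = x"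
    using u fmul_base_left[of u k] fiber_subset by (simp add: UF_one UF_mult subset_iff)
  obtain w where "w \<in> fiber k" "fmul k w u = base k" using fmul_inverse[OF u(1)] by blast
  then show "\<exists>y\<in>carrier (UF k). y \<otimes>\<^bsub>UF k\<^esub> x = \<one>\<^bsub>UF k\<^esub>"
    using u by (intro bexI[of _ "to_jet k w"]) (auto simp: UF_mult UF_one UF_carrier)
qed

end

section \<open>Coordinates of points of iterated tangent spaces\<close>

text \<open>The coefficient of $\varepsilon^\gamma$ in a point of $T^kV$.\<close>

primrec leaf :: "nat \<Rightarrow> nat \<Rightarrow> ('v, 'k) elt \<Rightarrow> 'v" where
  "leaf 0 \<gamma> p = vec p"
| "leaf (Suc k) \<gamma> p = leaf k \<gamma> (if digit \<gamma> (Suc k) = 0 then vfst p else vsnd p)"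

lemma leaf_vadd:
  fixes p q :: "('v::topological_ab_group_add, 'k::hausdorff_ring) elt"
  shows "shape_of p = Tk_shape k Model \<Longrightarrow> shape_of q = Tk_shape k Model \<Longrightarrow> leaf k \<gamma> (p +\<^sub>v q) = leaf k \<gamma> p + leaf k \<gamma> q"
  by (induction k arbitrary: p q) (auto dest!: elt_cases_shape)

lemma leaf_vzero [simp]: "leaf k \<gamma> (vzero (Tk_shape k Model)) = 0"
  by (induction k) auto

lemma leaf_Tk_single: "leaf k \<gamma> (Tk_single Model k \<alpha> (Vec x)) =
    (if \<forall>i\<in>{1..k}. digit \<alpha> i = digit \<gamma> i then x else 0)"
proof (induction k)
  case (Suc k)
  have "(\<forall>i\<in>{1..Suc k}. digit \<alpha> i = digit \<gamma> i) \<longleftrightarrow> digit \<alpha> (Suc k) = digit \<gamma> (Suc k) \<and> (\<forall>i\<in>{1..k}. digit \<alpha> i = digit \<gamma> i)"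
    by (auto simp: atLeastAtMostSuc_conv)
  moreover have "digit \<alpha> (Suc k) = digit \<gamma> (Suc k) \<longleftrightarrow> (digit \<alpha> (Suc k) = 0 \<longleftrightarrow> digit \<gamma> (Suc k) = 0)"
    by (simp add: digit_eq_bit)
  ultimately show ?case using Suc by simp
qed simp

lemma leaf_cong: "(\<And>i. i \<in> {1..k} \<Longrightarrow> digit \<gamma> i = digit \<delta> i) \<Longrightarrow> leaf k \<gamma> p = leaf k \<delta> p"
  by (induction k arbitrary: p) auto

lemma digit_high: "\<gamma> < 2 ^ k \<Longrightarrow> digit \<gamma> (Suc k) = 0"
  by (simp add: digit_def)

lemma digit_add_power:
  assumes "\<gamma> < 2 ^ k"
  shows "digit (\<gamma> + 2 ^ k) (Suc k) = 1" "i \<in> {1..k} \<Longrightarrow> digit (\<gamma> + 2 ^ k) i = digit \<gamma> i"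
proof -
  have "and \<gamma> (2 ^ k) = 0" using bit_less_power[OF assms] by (auto simp: and_eq_0_iff bit_simps)
  note d = digit_add[OF this]
  show "digit (\<gamma> + 2 ^ k) (Suc k) = 1" using digit_high[OF assms] d[of "Suc k"] by (simp add: digit_eq_bit bit_simps)
  show "i \<in> {1..k} \<Longrightarrow> digit (\<gamma> + 2 ^ k) i = digit \<gamma> i" using d[of i] by (auto simp: digit_eq_bit bit_simps)
qed

lemma leaf_ext:
  "shape_of p = Tk_shape k Model \<Longrightarrow> shape_of q = Tk_shape k Model \<Longrightarrow>
    (\<And>\<gamma>. \<gamma> < 2 ^ k \<Longrightarrow> leaf k \<gamma> p = leaf k \<gamma> q) \<Longrightarrow> p = q"
proof (induction k arbitrary: p q)
  case 0
  then show ?case by (auto dest!: elt_cases_shape(1))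
next
  case (Suc k)
  then obtain p0 p1 q0 q1 where *: "p = VPair p0 p1" "q = VPair q0 q1"
    "shape_of p0 = Tk_shape k Model" "shape_of p1 = Tk_shape k Model"
    "shape_of q0 = Tk_shape k Model" "shape_of q1 = Tk_shape k Model"
    by (auto dest!: elt_cases_shape(3))
  have "leaf k \<gamma> p0 = leaf k \<gamma> q0" if "\<gamma> < 2 ^ k" for \<gamma>
    using Suc.prems(3)[of \<gamma>] that by (simp add: * digit_high)
  then have "p0 = q0" by (intro Suc.IH *) auto
  moreover have "leaf k \<gamma> p1 = leaf k \<gamma> q1" if "\<gamma> < 2 ^ k" for \<gamma>
  proof -
    have c: "leaf k (\<gamma> + 2 ^ k) p = leaf k \<gamma> p" for p :: "('a, 'b) elt"
      by (rule leaf_cong) (use digit_add_power(2)[OF that] in auto)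
    show ?thesis using Suc.prems(3)[of "\<gamma> + 2 ^ k"] that digit_add_power(1)[OF that] c by (simp add: *)
  qed
  then have "p1 = q1" by (intro Suc.IH *) auto
  ultimately show ?case using * by simp
qed

lemma vadd_Vec_0 [simp]:
  fixes p :: "('v::comm_monoid_add, 'k::comm_monoid_add) elt"
  shows "shape_of p = Model \<Longrightarrow> p +\<^sub>v Vec 0 = p" "shape_of p = Model \<Longrightarrow> Vec 0 +\<^sub>v p = p"
  using vadd_0[of p Model] by simp_all

context lie_group_over
begin

section \<open>Products of the elements $\varepsilon^\alpha v$\<close>

abbreviation "p0 \<equiv> VPair x0 x0"
abbreviation O0 :: "('v, 'k) elt" where "O0 \<equiv> vzero Model"
abbreviation "Dmu \<equiv> differential sc MM Model Dm mu"
abbreviation "D2mu \<equiv> differential2 MM Model Dm mu"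

lemma p0: "p0 \<in> Dm" "mu p0 = x0"
  using mu_x0 C by auto

lemma smooth_diag:
  "smooth_on sc Model MM C (\<lambda>x. VPair x x0)" "smooth_on sc Model MM C (\<lambda>x. VPair x0 x)"
  by (intro smooth_on_VPair smooth_on_linear[OF continuous_linear_id] smooth_on_const C(1,2) shape_x0)+

lemma differential_diag:
  assumes "x \<in> C" "shape_of v = Model"
  shows "differential sc Model MM C (\<lambda>x. VPair x x0) x v = VPair v O0"
    "differential sc Model MM C (\<lambda>x. VPair x0 x) x v = VPair O0 v"
  using differential_VPair[OF smooth_on_linear[OF continuous_linear_id C(1,2)] smooth_on_const[OF C(1,2) shape_x0] assms]
    differential_VPair[OF smooth_on_const[OF C(1,2) shape_x0] smooth_on_linear[OF continuous_linear_id C(1,2)] assms]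
    differential_linear[OF continuous_linear_id C(1,2) assms] differential_const[OF C(1,2) assms shape_x0]
  by simp_all

lemma Dmu_partial:
  assumes x: "x \<in> C" "shape_of v = Model"
  shows "Dmu (VPair x x0) (VPair v O0) = v" "Dmu (VPair x0 x) (VPair O0 v) = v"
proof -
  have id: "differential sc Model Model C (\<lambda>x. f x) x v = v" if "\<And>x. x \<in> C \<Longrightarrow> f x = x" for f
    using differential_cong[OF smooth_on_linear[OF continuous_linear_id C(1,2)] _ x, of f]
      differential_linear[OF continuous_linear_id C(1,2) x] that by simp
  have 1: "(\<lambda>x. VPair x x0) ` C \<subseteq> Dm" "(\<lambda>x. VPair x0 x) ` C \<subseteq> Dm" using mu_x0 by auto
  show "Dmu (VPair x x0) (VPair v O0) = v" "Dmu (VPair x0 x) (VPair O0 v) = v"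
    using differential_comp[OF smooth_diag(1) smooth_mu 1(1) x] differential_comp[OF smooth_diag(2) smooth_mu 1(2) x]
      differential_diag[OF x] id[of "\<lambda>x. mu (VPair x x0)"] id[of "\<lambda>x. mu (VPair x0 x)"] mu_x0 by simp_all
qed

lemma Dmu_p0:
  assumes "shape_of v = Model" "shape_of w = Model"
  shows "Dmu p0 (VPair v w) = v +\<^sub>v w"
  using differential_vadd[OF smooth_mu p0(1), of "VPair v O0" "VPair O0 w"] assms Dmu_partial[OF C(3)] by simp

text \<open>The map $y \mapsto \mu(y,e)$ is the identity, so its differential is constant.\<close>

lemma D2mu_same:
  assumes v: "shape_of v = Model" and w: "shape_of w = Model"
  shows "D2mu p0 (VPair v O0) (VPair w O0) = O0"
proof -
  have sh: "shape_of (VPair w O0) = MM" using w by simp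
  have 1: "(\<lambda>x. VPair x x0) ` C \<subseteq> Dm" using mu_x0 by auto
  note sm = smooth_on_differential_dir[OF smooth_mu sh]
  have "D2mu p0 (VPair v O0) (VPair w O0) = differential sc MM Model Dm (\<lambda>y. Dmu y (VPair w O0)) (VPair x0 x0)
      (differential sc Model MM C (\<lambda>x. VPair x x0) x0 v)"
    unfolding differential2_def differential_diag(1)[OF C(3) v] ..
  also have "\<dots> = differential sc Model Model C (\<lambda>x. Dmu (VPair x x0) (VPair w O0)) x0 v"
    by (rule differential_comp[OF smooth_diag(1) sm 1 C(3) v, symmetric])
  also have "\<dots> = differential sc Model Model C (\<lambda>_. w) x0 v"
    by (rule differential_cong[OF smooth_on_comp[OF smooth_diag(1) sm 1] _ C(3) v]) (use Dmu_partial(1) w in auto)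
  also have "\<dots> = O0" by (rule differential_const[OF C(1,2,3) v w])
  finally show ?thesis .
qed

text \<open>The mixed second differential $b(x,y)$ of the multiplication at the unit. The Lie bracket will
  turn out to be $b(x,y) - b(y,x)$.\<close>

definition mixed :: "'v \<Rightarrow> 'v \<Rightarrow> 'v" where
  "mixed x y = vec (D2mu p0 (VPair (Vec x) O0) (VPair O0 (Vec y)))"

definition bracket :: "'v \<Rightarrow> 'v \<Rightarrow> 'v" where
  "bracket x y = mixed x y - mixed y x"

lemma shape_D2mu: "shape_of u = MM \<Longrightarrow> shape_of w = MM \<Longrightarrow> shape_of (D2mu p0 u w) = Model"
  using shape_D2[OF smooth_mu p0(1)] .

lemma Vec_mixed: "Vec (mixed x y) = D2mu p0 (VPair (Vec x) O0) (VPair O0 (Vec y))"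
  using shape_D2mu[of "VPair (Vec x) O0" "VPair O0 (Vec y)"] by (auto simp: mixed_def dest!: elt_cases_shape(1))

lemma Vec_mixed': "Vec (mixed x y) = D2mu p0 (VPair O0 (Vec y)) (VPair (Vec x) O0)"
  unfolding Vec_mixed by (rule differential2_commute[OF smooth_mu p0(1)]) auto

lemma mixed_add: "mixed (x + x') y = mixed x y + mixed x' y" "mixed x (y + y') = mixed x y + mixed x y'"
proof -
  have 1: "D2mu p0 (u +\<^sub>v u') w = D2mu p0 u w +\<^sub>v D2mu p0 u' w"
    if "shape_of u = MM" "shape_of u' = MM" "shape_of w = MM" for u u' w
    unfolding differential2_def using differential_vadd[OF smooth_on_differential_dir[OF smooth_mu that(3)] p0(1) that(1,2)] .
  have "Vec (mixed (x + x') y) = D2mu p0 (VPair (Vec x) O0 +\<^sub>v VPair (Vec x') O0) (VPair O0 (Vec y))"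
    unfolding Vec_mixed by simp
  also have "\<dots> = Vec (mixed x y) +\<^sub>v Vec (mixed x' y)" unfolding Vec_mixed by (rule 1) auto
  finally show "mixed (x + x') y = mixed x y + mixed x' y" by simp
  have "Vec (mixed x (y + y')) = D2mu p0 (VPair O0 (Vec y) +\<^sub>v VPair O0 (Vec y')) (VPair (Vec x) O0)"
    unfolding Vec_mixed' by simp
  also have "\<dots> = Vec (mixed x y) +\<^sub>v Vec (mixed x y')" unfolding Vec_mixed' by (rule 1) auto
  finally show "mixed x (y + y') = mixed x y + mixed x y'" by simp
qed

lemma fmul_jet1:
  assumes "A \<inter> {1..k} \<noteq> {}" "shape_of v = Model" "shape_of w = Model"
  shows "fmul k (jet Model A B k x0 v O0 O0) (jet Model A B k x0 w O0 O0) = jet Model A B k x0 (v +\<^sub>v w) O0 O0"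
  unfolding fmul_def
  using assms Tk_zip_jet[of x0 Model v O0 O0 x0 Model w O0 O0 k A B]
    Tk_map_jet1[OF smooth_mu p0(1), of "VPair v w" A k B] Dmu_p0 p0(2) by simp

lemma fmul_jet_meeting:
  assumes "A \<inter> B \<inter> {1..k} \<noteq> {}" "shape_of v = Model" "shape_of w = Model"
  shows "fmul k (jet Model A B k x0 v O0 O0) (jet Model A B k x0 O0 w O0) = jet Model A B k x0 v w O0"
    "fmul k (jet Model A B k x0 O0 w O0) (jet Model A B k x0 v O0 O0) = jet Model A B k x0 v w O0"
  unfolding fmul_def
  using assms Tk_zip_jet[of x0 Model v O0 O0 x0 Model O0 w O0 k A B] Tk_zip_jet[of x0 Model O0 w O0 x0 Model v O0 O0 k A B]
    Tk_map_jet_meeting[OF smooth_mu p0(1), of "VPair v O0" "VPair O0 w" A B k]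
    Tk_map_jet_meeting[OF smooth_mu p0(1), of "VPair O0 v" "VPair w O0" A B k] Dmu_p0 p0(2) by simp_all

lemma fmul_jet_disjoint:
  assumes AB: "A \<inter> {1..k} \<noteq> {}" "B \<inter> {1..k} \<noteq> {}" "A \<inter> B = {}"
    and sh: "shape_of v = Model" "shape_of v' = Model" "shape_of w = Model" "shape_of w' = Model"
      "shape_of z = Model" "shape_of z' = Model"
  shows "fmul k (jet Model A B k x0 v w z) (jet Model A B k x0 v' w' z') =
    jet Model A B k x0 (v +\<^sub>v v') (w +\<^sub>v w') (z +\<^sub>v z' +\<^sub>v D2mu p0 (VPair v v') (VPair w w'))"
  unfolding fmul_def
  using sh Tk_zip_jet[of x0 Model v w z x0 Model v' w' z' k A B]
    Tk_map_jet_disjoint[OF smooth_mu p0(1) _ _ _ AB, of "VPair v v'" "VPair w w'" "VPair z z'"] Dmu_p0 p0(2)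
  by simp

definition single :: "nat \<Rightarrow> nat \<Rightarrow> 'v \<Rightarrow> ('v, 'k) elt" where
  "single k \<alpha> x = base k +\<^sub>v Tk_single Model k \<alpha> (Vec x)"

lemma single_eq_jets:
  assumes A: "\<And>i. i \<in> {1..k} \<Longrightarrow> i \<in> A \<longleftrightarrow> digit \<alpha> i \<noteq> 0"
  shows "single k \<alpha> x = jet Model A B k x0 (Vec x) O0 O0" "single k \<alpha> x = jet Model B A k x0 O0 (Vec x) O0"
proof -
  have b: "base k = jet Model A B k x0 O0 O0 O0"
    unfolding base_def by (rule Tk_single_0_eq_jet) simp
  have s: "Tk_single Model k \<alpha> (Vec x) = jet Model A B k O0 (Vec x) O0 O0"
    by (rule Tk_single_eq_jet) (use A in auto)
  show 1: "single k \<alpha> x = jet Model A B k x0 (Vec x) O0 O0"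
    unfolding single_def b s by (subst jet_vadd) auto
  show "single k \<alpha> x = jet Model B A k x0 O0 (Vec x) O0"
    unfolding 1 by (rule jet_swap) auto
qed

lemma single_union_eq_jet:
  assumes "A \<inter> B = {}" "\<And>i. i \<in> {1..k} \<Longrightarrow> i \<in> A \<union> B \<longleftrightarrow> digit \<gamma> i \<noteq> 0"
  shows "single k \<gamma> x = jet Model A B k x0 O0 O0 (Vec x)"
proof -
  have b: "base k = jet Model A B k x0 O0 O0 O0"
    unfolding base_def by (rule Tk_single_0_eq_jet) simp
  have s: "Tk_single Model k \<gamma> (Vec x) = jet Model A B k O0 O0 O0 (Vec x)"
    by (rule Tk_single_union_eq_jet) (use assms in auto)
  show ?thesis unfolding single_def b s by (subst jet_vadd) auto
qed

lemma single_in_fiber: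
  assumes "0 < \<alpha>" "\<alpha> < 2 ^ k" shows "single k \<alpha> x \<in> fiber k"
proof -
  let ?A = "{i. digit \<alpha> i \<noteq> 0}"
  have "?A \<inter> {1..k} \<noteq> {}" using digit_nonzero_ex[OF assms] by force
  moreover have "single k \<alpha> x = jet Model ?A {} k x0 (Vec x) O0 O0" by (rule single_eq_jets(1)) auto
  ultimately show ?thesis using Tk_foot_jet1[of x0 Model "Vec x" k ?A "{}"] by (simp add: fiber_def)
qed

lemma digit_positions_nonempty:
  assumes "0 < \<alpha>" "\<alpha> < 2 ^ k" shows "{i. digit \<alpha> i \<noteq> 0} \<inter> {1..k} \<noteq> {}"
  using digit_nonzero_ex[OF assms] by force

lemma fmul_single_add:
  assumes "0 < \<alpha>" "\<alpha> < 2 ^ k"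
  shows "fmul k (single k \<alpha> x) (single k \<alpha> y) = single k \<alpha> (x + y)"
proof -
  let ?A = "{i. digit \<alpha> i \<noteq> 0}"
  have s: "single k \<alpha> x = jet Model ?A {} k x0 (Vec x) O0 O0" for x by (rule single_eq_jets(1)) auto
  show ?thesis unfolding s using fmul_jet1[OF digit_positions_nonempty[OF assms], of "Vec x" "Vec y" "{}"] by simp
qed

lemma fmul_single_commute:
  assumes "0 < \<alpha>" "\<alpha> < 2 ^ k" "0 < \<beta>" "\<beta> < 2 ^ k" "and \<alpha> \<beta> \<noteq> 0"
  shows "fmul k (single k \<alpha> x) (single k \<beta> y) = fmul k (single k \<beta> y) (single k \<alpha> x)"
proof -
  let ?A = "{i. digit \<alpha> i \<noteq> 0}" and ?B = "{i. digit \<beta> i \<noteq> 0}"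
  have s: "single k \<alpha> x = jet Model ?A ?B k x0 (Vec x) O0 O0" "single k \<beta> y = jet Model ?A ?B k x0 O0 (Vec y) O0"
    by (rule single_eq_jets(1), simp) (rule single_eq_jets(2), simp)
  obtain n where n: "bit \<alpha> n" "bit \<beta> n" using assms(5) unfolding and_eq_0_iff by auto
  then have "Suc n \<in> ?A \<inter> ?B \<inter> {1..k}" using bit_less_power[OF assms(2)] by (simp add: digit_eq_bit Suc_le_eq)
  then have "?A \<inter> ?B \<inter> {1..k} \<noteq> {}" by blast
  then show ?thesis unfolding s using fmul_jet_meeting by simp
qed

text \<open>In coordinates, $\varepsilon^\alpha x \cdot \varepsilon^\beta y$ and
  $\varepsilon^\beta y \cdot \varepsilon^\alpha x$ are $\varepsilon^\alpha x + \varepsilon^\beta y +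
  \varepsilon^{\alpha+\beta} z$ with $z = b(x,y)$ and $z = b(y,x)$, respectively, and the
  multiplication with $\varepsilon^{\alpha+\beta} z'$ adds $z'$ to \<open>z\<close>.\<close>

lemma fmul_single_exchange:
  assumes "0 < \<alpha>" "\<alpha> < 2 ^ k" "0 < \<beta>" "\<beta> < 2 ^ k" "and \<alpha> \<beta> = 0"
  shows "fmul k (single k \<alpha> x) (single k \<beta> y) =
    fmul k (fmul k (single k \<beta> y) (single k \<alpha> x)) (single k (\<alpha> + \<beta>) (bracket x y))"
proof -
  let ?A = "{i. digit \<alpha> i \<noteq> 0}" and ?B = "{i. digit \<beta> i \<noteq> 0}"
  have AB: "?A \<inter> {1..k} \<noteq> {}" "?B \<inter> {1..k} \<noteq> {}" "?A \<inter> ?B = {}"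
    using digit_positions_nonempty assms(1-4) assms(5) by (auto simp: and_eq_0_iff digit_eq_bit)
  have s: "single k \<alpha> x = jet Model ?A ?B k x0 (Vec x) O0 O0" "single k \<beta> y = jet Model ?A ?B k x0 O0 (Vec y) O0"
    by (rule single_eq_jets(1), simp) (rule single_eq_jets(2), simp)
  have s3: "single k (\<alpha> + \<beta>) z = jet Model ?A ?B k x0 O0 O0 (Vec z)" for z
    by (rule single_union_eq_jet[OF AB(3)]) (auto simp: digit_add[OF assms(5)])
  have "fmul k (single k \<alpha> x) (single k \<beta> y) = jet Model ?A ?B k x0 (Vec x) (Vec y) (Vec (mixed x y))"
    unfolding s by (subst fmul_jet_disjoint[OF AB]) (auto simp: Vec_mixed shape_D2mu)
  moreover have "fmul k (single k \<beta> y) (single k \<alpha> x) = jet Model ?A ?B k x0 (Vec x) (Vec y) (Vec (mixed y x))"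
    unfolding s by (subst fmul_jet_disjoint[OF AB]) (auto simp: Vec_mixed' shape_D2mu)
  moreover have "fmul k (jet Model ?A ?B k x0 (Vec x) (Vec y) (Vec (mixed y x))) (jet Model ?A ?B k x0 O0 O0 (Vec z)) =
      jet Model ?A ?B k x0 (Vec x) (Vec y) (Vec (mixed y x + z))" for z
    using D2mu_same[of "Vec x" "Vec y"] by (subst fmul_jet_disjoint[OF AB]) auto
  ultimately show ?thesis unfolding s3 by (simp add: bracket_def)
qed

lemma leaf_base: "0 < \<gamma> \<Longrightarrow> \<gamma> < 2 ^ k \<Longrightarrow> leaf k \<gamma> (base k) = 0"
proof -
  assume \<gamma>: "0 < \<gamma>" "\<gamma> < 2 ^ k"
  obtain a where a: "x0 = Vec a" using elt_cases_shape(1)[OF shape_x0] by blast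
  show ?thesis unfolding base_def a using digit_nonzero_ex[OF \<gamma>] by (auto simp: leaf_Tk_single)
qed

lemma leaf_single:
  assumes "0 < \<gamma>" "\<gamma> < 2 ^ k" "\<alpha> < 2 ^ k"
  shows "leaf k \<gamma> (single k \<alpha> x) = (if \<alpha> = \<gamma> then x else 0)"
  using assms leaf_base[OF assms(1,2)] digit_eqI[OF assms(3,2)]
  by (auto simp: single_def leaf_vadd leaf_Tk_single)

lemma leaf_0: "leaf k 0 p = vec (Tk_foot k p)"
  by (induction k arbitrary: p) auto

lemma Tk_zip_vadd:
  fixes p q p' q' :: "('v, 'k) elt"
  assumes "shape_of p = Tk_shape k s" "shape_of p' = Tk_shape k s" "shape_of q = Tk_shape k s'" "shape_of q' = Tk_shape k s'"
  shows "Tk_zip k (p +\<^sub>v p') (q +\<^sub>v q') = Tk_zip k p q +\<^sub>v Tk_zip k p' q'"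
proof -
  have "Tk_zip k (vfst (a +\<^sub>v b)) (vsnd (a +\<^sub>v b)) = Tk_zip k (vfst a) (vsnd a) +\<^sub>v Tk_zip k (vfst b) (vsnd b)"
    if "shape_of a = Prod (Tk_shape k s) (Tk_shape k s')" "shape_of b = Prod (Tk_shape k s) (Tk_shape k s')"
    for a b :: "('v, 'k) elt"
    using continuous_linear_Tk_zip[of k s s'] that unfolding continuous_linear_def by blast
  from this[of "VPair p q" "VPair p' q'"] show ?thesis using assms by simp
qed

lemma Tk_zip_vscale:
  fixes p q :: "('v, 'k) elt"
  assumes "shape_of p = Tk_shape k s" "shape_of q = Tk_shape k s'"
  shows "Tk_zip k (t *\<^sub>v p) (t *\<^sub>v q) = t *\<^sub>v Tk_zip k p q"
proof -
  have "Tk_zip k (vfst (t *\<^sub>v a)) (vsnd (t *\<^sub>v a)) = t *\<^sub>v Tk_zip k (vfst a) (vsnd a)"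
    if "shape_of a = Prod (Tk_shape k s) (Tk_shape k s')" for a :: "('v, 'k) elt"
    using continuous_linear_Tk_zip[of k s s'] that unfolding continuous_linear_def by blast
  from this[of "VPair p q"] show ?thesis using assms by simp
qed

abbreviation OT :: "nat \<Rightarrow> ('v, 'k) elt" where "OT k \<equiv> vzero (Tk_shape k Model)"
abbreviation bb :: "nat \<Rightarrow> ('v, 'k) elt" where "bb k \<equiv> Tk_zip k (base k) (base k)"
abbreviation "DFmu k \<equiv> differential sc (Tk_shape k MM) (Tk_shape k Model) (Tk_set k MM Dm) (Tk_map k sc MM Model Dm mu)"

text \<open>At the zero section over the unit, the differential of the multiplication is the addition,
  because the unit laws determine the two partial differentials.\<close>

lemma differential_at_base:
  assumes u: "shape_of u = Tk_shape k Model" and w: "shape_of w = Tk_shape k Model"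
  shows "DFmu k (bb k) (Tk_zip k u w) = u +\<^sub>v w"
proof -
  note F = smooth_on_Tk_map[OF smooth_mu, of k]
  have bb: "bb k \<in> Tk_set k MM Dm" using p0(1) Tk_set_Dm_iff by simp
  have val: "Tk_map k sc MM Model Dm mu (bb k) = base k"
    using fmul_base_left[OF subsetD[OF fiber_subset base_fiber], of k] by (simp add: fmul_def)
  have 1: "DFmu k (bb k) (Tk_zip k u (OT k)) = u"
  proof (rule differential_eqI[OF F bb _ open_UNIV UNIV_I continuous_on_const])
    show "shape_of (Tk_zip k u (OT k)) = Tk_shape k MM" using u by simp
    fix t assume t: "bb k +\<^sub>v t *\<^sub>v Tk_zip k u (OT k) \<in> Tk_set k MM Dm"
    have eq: "bb k +\<^sub>v t *\<^sub>v Tk_zip k u (OT k) = Tk_zip k (base k +\<^sub>v t *\<^sub>v u) (base k)"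
      using u Tk_zip_vadd[of "base k" k Model "t *\<^sub>v u" "base k" Model "t *\<^sub>v OT k"]
        Tk_zip_vscale[of u k Model "OT k" Model t] by simp
    have sh: "shape_of (base k +\<^sub>v t *\<^sub>v u) = Tk_shape k Model" using u by simp
    have "VPair (Tk_foot k (base k +\<^sub>v t *\<^sub>v u)) x0 \<in> Dm"
      using t Tk_set_Dm_iff[OF sh, of "base k"] unfolding eq by simp
    then have "base k +\<^sub>v t *\<^sub>v u \<in> Tk_set k Model C" using sh C(1) by (simp add: Dm_iff Tk_set_iff)
    then have "Tk_map k sc MM Model Dm mu (bb k +\<^sub>v t *\<^sub>v Tk_zip k u (OT k)) = base k +\<^sub>v t *\<^sub>v u"
      unfolding eq using fmul_base_right by (simp add: fmul_def)
    then show "shape_of u = Tk_shape k Model \<and> Tk_map k sc MM Model Dm mu (bb k +\<^sub>v t *\<^sub>v Tk_zip k u (OT k)) =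
        Tk_map k sc MM Model Dm mu (bb k) +\<^sub>v t *\<^sub>v u" using u val by simp
  qed
  have 2: "DFmu k (bb k) (Tk_zip k (OT k) w) = w"
  proof (rule differential_eqI[OF F bb _ open_UNIV UNIV_I continuous_on_const])
    show "shape_of (Tk_zip k (OT k) w) = Tk_shape k MM" using w by simp
    fix t assume t: "bb k +\<^sub>v t *\<^sub>v Tk_zip k (OT k) w \<in> Tk_set k MM Dm"
    have eq: "bb k +\<^sub>v t *\<^sub>v Tk_zip k (OT k) w = Tk_zip k (base k) (base k +\<^sub>v t *\<^sub>v w)"
      using w Tk_zip_vadd[of "base k" k Model "t *\<^sub>v OT k" "base k" Model "t *\<^sub>v w"]
        Tk_zip_vscale[of "OT k" k Model w Model t] by simp
    have sh: "shape_of (base k +\<^sub>v t *\<^sub>v w) = Tk_shape k Model" using w by simp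
    have "VPair x0 (Tk_foot k (base k +\<^sub>v t *\<^sub>v w)) \<in> Dm"
      using t Tk_set_Dm_iff[of "base k", OF _ sh] unfolding eq by simp
    then have "base k +\<^sub>v t *\<^sub>v w \<in> Tk_set k Model C" using sh C(1) by (simp add: Dm_iff Tk_set_iff)
    then have "Tk_map k sc MM Model Dm mu (bb k +\<^sub>v t *\<^sub>v Tk_zip k (OT k) w) = base k +\<^sub>v t *\<^sub>v w"
      unfolding eq using fmul_base_left by (simp add: fmul_def)
    then show "shape_of w = Tk_shape k Model \<and> Tk_map k sc MM Model Dm mu (bb k +\<^sub>v t *\<^sub>v Tk_zip k (OT k) w) =
        Tk_map k sc MM Model Dm mu (bb k) +\<^sub>v t *\<^sub>v w" using w val by simp
  qed
  have "Tk_zip k u w = Tk_zip k u (OT k) +\<^sub>v Tk_zip k (OT k) w"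
    using Tk_zip_vadd[of u k Model "OT k" "OT k" Model w] u w by simp
  then show ?thesis using differential_vadd[OF F bb, of "Tk_zip k u (OT k)" "Tk_zip k (OT k) w"] u w 1 2 by simp
qed

text \<open>If the index \<open>\<gamma>\<close> involves the outermost tangent direction, then the vanishing of the lower
  components means that both factors are tangent vectors at the zero section, and these are added.
  Otherwise the outermost direction can be ignored.\<close>

lemma leaf_fmul:
  "u \<in> fiber k \<Longrightarrow> w \<in> fiber k \<Longrightarrow> 0 < \<gamma> \<Longrightarrow> \<gamma> < 2 ^ k \<Longrightarrow>
    (\<And>\<alpha>. 0 < \<alpha> \<Longrightarrow> \<alpha> < \<gamma> \<Longrightarrow> leaf k \<alpha> u = 0 \<and> leaf k \<alpha> w = 0) \<Longrightarrow>
    leaf k \<gamma> (fmul k u w) = leaf k \<gamma> u + leaf k \<gamma> w"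
proof (induction k arbitrary: u w)
  case (Suc k)
  obtain u0 u1 w0 w1 where *: "u = VPair u0 u1" "w = VPair w0 w1" "u0 \<in> fiber k" "w0 \<in> fiber k"
    "shape_of u1 = Tk_shape k Model" "shape_of w1 = Tk_shape k Model"
    using Suc.prems(1,2) by (auto simp: fiber_def dest!: elt_cases_shape(3))
  have m: "fmul (Suc k) u w = VPair (fmul k u0 w0) (DFmu k (Tk_zip k u0 w0) (Tk_zip k u1 w1))"
    by (simp add: fmul_def *)
  show ?case
  proof (cases "\<gamma> < 2 ^ k")
    case True
    have "leaf k \<alpha> u0 = 0 \<and> leaf k \<alpha> w0 = 0" if "0 < \<alpha>" "\<alpha> < \<gamma>" for \<alpha>
      using Suc.prems(5)[OF that] that True by (simp add: * digit_high)
    then show ?thesis using Suc.IH[OF *(3,4) Suc.prems(3) True] m True by (simp add: * digit_high)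
  next
    case False
    have zero: "leaf k \<alpha> u0 = 0 \<and> leaf k \<alpha> w0 = 0" if "0 < \<alpha>" "\<alpha> < 2 ^ k" for \<alpha>
      using Suc.prems(5)[of \<alpha>] that False by (simp add: * digit_high)
    have isbase: "p = base k" if "p \<in> fiber k" "\<And>\<alpha>. 0 < \<alpha> \<Longrightarrow> \<alpha> < 2 ^ k \<Longrightarrow> leaf k \<alpha> p = 0" for p
    proof (rule leaf_ext)
      show "leaf k \<alpha> p = leaf k \<alpha> (base k)" if "\<alpha> < 2 ^ k" for \<alpha>
        using \<open>p \<in> fiber k\<close> that leaf_base[of \<alpha> k] \<open>\<And>\<alpha>. 0 < \<alpha> \<Longrightarrow> \<alpha> < 2 ^ k \<Longrightarrow> leaf k \<alpha> p = 0\<close>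
        by (cases "\<alpha> = 0") (auto simp: leaf_0 fiber_def)
    qed (use that in \<open>auto simp: fiber_def\<close>)
    have "u0 = base k" "w0 = base k" using isbase * zero by auto
    then have m': "fmul (Suc k) u w = VPair (fmul k u0 w0) (u1 +\<^sub>v w1)"
      using m differential_at_base[OF *(5,6)] by simp
    have "digit \<gamma> (Suc k) = 1"
    proof -
      have "\<gamma> - 2 ^ k < 2 ^ k" using Suc.prems(4) by simp
      from digit_add_power(1)[OF this] show ?thesis using False by simp
    qed
    then show ?thesis unfolding m' using leaf_vadd[OF *(5,6)] by (simp add: *)
  qed
qed simp

definition eps_elem :: "nat \<Rightarrow> nat \<Rightarrow> 'v \<Rightarrow> ('g, 'v, 'k) jet" where
  "eps_elem k \<alpha> x = to_jet k (single k \<alpha> x)"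

lemma filtered_group_UF:
  "filtered_group (UF k) k (eps_elem k) bracket (\<lambda>\<gamma> \<xi>. leaf k \<gamma> (coords c0 \<xi>))"
proof (intro filtered_group.intro group_UF filtered_group_axioms.intro)
  fix \<alpha> \<beta> :: nat and x y :: 'v
  assume a: "0 < \<alpha>" "\<alpha> < 2 ^ k"
  show "eps_elem k \<alpha> x \<in> carrier (UF k)"
    unfolding eps_elem_def UF_carrier using single_in_fiber[OF a] by blast
  show "eps_elem k \<alpha> x \<otimes>\<^bsub>UF k\<^esub> eps_elem k \<alpha> y = eps_elem k \<alpha> (x + y)"
    unfolding eps_elem_def using single_in_fiber[OF a] fmul_single_add[OF a] by (simp add: UF_mult)
  assume b: "0 < \<beta>" "\<beta> < 2 ^ k"
  show "eps_elem k \<alpha> x \<otimes>\<^bsub>UF k\<^esub> eps_elem k \<beta> y = eps_elem k \<beta> y \<otimes>\<^bsub>UF k\<^esub> eps_elem k \<alpha> x" if "and \<alpha> \<beta> \<noteq> 0"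
    unfolding eps_elem_def using single_in_fiber[OF a] single_in_fiber[OF b] fmul_single_commute[OF a b that] by (simp add: UF_mult)
  show "eps_elem k \<alpha> x \<otimes>\<^bsub>UF k\<^esub> eps_elem k \<beta> y =
      eps_elem k \<beta> y \<otimes>\<^bsub>UF k\<^esub> eps_elem k \<alpha> x \<otimes>\<^bsub>UF k\<^esub> eps_elem k (\<alpha> + \<beta>) (bracket x y)" if "and \<alpha> \<beta> = 0"
  proof -
    have "0 < \<alpha> + \<beta>" "\<alpha> + \<beta> < 2 ^ k" using a b disjoint_add_less_power[OF that] by auto
    then show ?thesis
      unfolding eps_elem_def using single_in_fiber a b fmul_single_exchange[OF a b that, of x y] fmul_fiber
      by (simp add: UF_mult)
  qed
  show "leaf k \<beta> (coords c0 (eps_elem k \<alpha> x)) = (if \<alpha> = \<beta> then x else 0)"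
    unfolding eps_elem_def using coords_to_jet[OF single_in_fiber[OF a]] leaf_single[OF b a(2)] by simp
next
  fix \<gamma> p q
  assume \<gamma>: "0 < \<gamma>" "\<gamma> < 2 ^ k" and pq: "p \<in> carrier (UF k)" "q \<in> carrier (UF k)"
    and z: "\<And>\<alpha>. 0 < \<alpha> \<Longrightarrow> \<alpha> < \<gamma> \<Longrightarrow> leaf k \<alpha> (coords c0 p) = 0 \<and> leaf k \<alpha> (coords c0 q) = 0"
  obtain u w where uw: "p = to_jet k u" "q = to_jet k w" "u \<in> fiber k" "w \<in> fiber k"
    using pq unfolding UF_carrier by blast
  then show "leaf k \<gamma> (coords c0 (p \<otimes>\<^bsub>UF k\<^esub> q)) = leaf k \<gamma> (coords c0 p) + leaf k \<gamma> (coords c0 q)"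
    using z leaf_fmul[OF uw(3,4) \<gamma>] fmul_fiber by (simp add: UF_mult coords_to_jet)
qed (auto simp: bracket_def mixed_add)

end

context lie_group_over
begin

section \<open>The Lie algebra\<close>

text \<open>The model module as the tangent space at the unit.\<close>

definition tv :: "'v \<Rightarrow> ('g, 'v, 'k) jet" where
  "tv x = tangent_at_unit sc G (Vec x)"

lemma tv_to_jet: "tv x = to_jet 1 (VPair x0 (Vec x))"
  by (simp add: tv_def tangent_at_unit_def to_jet_def)

lemma fiber_1: "VPair x0 (Vec x) \<in> fiber 1"
  by (simp add: fiber_def)

lemma principal_part_tv [simp]: "principal_part G (tv x) = Vec x"
  unfolding principal_part_def tv_to_jet using coords_to_jet[OF fiber_1] by simp

lemma tv_inj [simp]: "tv x = tv y \<longleftrightarrow> x = y"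
  by (metis principal_part_tv elt.inject(1))

abbreviation "L \<equiv> lie_algebra sc G"

lemma carrier_L: "carrier L = range tv"
proof -
  have "carrier L = to_jet 1 ` fiber 1" using jets_over_unit by (simp add: lie_algebra_def)
  also have "fiber 1 = range (\<lambda>x. VPair x0 (Vec x))"
    by (auto simp: fiber_def dest!: elt_cases_shape)
  also have "to_jet 1 ` range (\<lambda>x. VPair x0 (Vec x)) = range tv"
    unfolding image_image by (rule image_cong) (simp_all only: tv_to_jet)
  finally show ?thesis .
qed

lemma tv_carrier [simp]: "tv x \<in> carrier L"
  by (simp add: carrier_L)

lemma L_simps [simp]:
  "tv x \<oplus>\<^bsub>L\<^esub> tv y = tv (x + y)" "\<zero>\<^bsub>L\<^esub> = tv 0" "t \<odot>\<^bsub>L\<^esub> tv x = tv (sc t x)"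
  by (simp_all add: lie_algebra_def) (simp_all add: tv_def)

lemma abelian_group_L: "abelian_group L"
proof (rule abelian_groupI)
  fix a assume "a \<in> carrier L"
  then obtain x where "a = tv x" by (auto simp: carrier_L)
  then show "\<exists>b\<in>carrier L. b \<oplus>\<^bsub>L\<^esub> a = \<zero>\<^bsub>L\<^esub>" by (intro bexI[of _ "tv (- x)"]) auto
qed (auto simp: carrier_L add_ac)

sublocale L: abelian_group L
  by (rule abelian_group_L)

lemma L_minus [simp]: "\<ominus>\<^bsub>L\<^esub> tv x = tv (- x)"
  by (rule L.minus_equality) auto

lemma L_finsum: "finite A \<Longrightarrow> (\<And>i. i \<in> A \<Longrightarrow> f i = tv (g i)) \<Longrightarrow> (\<Oplus>\<^bsub>L\<^esub>i\<in>A. f i) = tv (sum g A)"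
proof (induction A rule: finite_induct)
  case (insert a A)
  then have "(\<Oplus>\<^bsub>L\<^esub>i\<in>insert a A. f i) = f a \<oplus>\<^bsub>L\<^esub> (\<Oplus>\<^bsub>L\<^esub>i\<in>A. f i)"
    by (intro L.finsum_insert) auto
  then show ?case using insert by simp
qed simp

lemma smooth_right_translation:
  assumes a: "a \<in> atlas M" and d: "d \<in> atlas M" and y: "y \<in> C"
  shows "smooth_on sc Model Model (rep_dom a d (\<lambda>h. h \<otimes>\<^bsub>G\<^esub> cinv c0 y)) (rep a d (\<lambda>h. h \<otimes>\<^bsub>G\<^esub> cinv c0 y))"
proof -
  let ?r = "\<lambda>h. h \<otimes>\<^bsub>G\<^esub> cinv c0 y"
  let ?W = "rep_dom (prod_chart a c0) d mul" and ?m = "rep (prod_chart a c0) d mul"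
  have A: "cimage a \<subseteq> points Model" "open (cimage a)" using M.cimage_points[OF a] M.open_cimage[OF a] by auto
  note sm = smooth_mul[OF a unit_chart(1) d]
  have pair: "smooth_on sc Model MM (cimage a) (\<lambda>x. VPair x y)"
    by (intro smooth_on_VPair smooth_on_linear[OF continuous_linear_id] smooth_on_const A shape_C y)
  have dom: "rep_dom a d ?r = {x \<in> cimage a. VPair x y \<in> ?W}"
    using rep_dom_mul_iff[OF a unit_chart(1)] y by (auto simp: rep_dom_iff)
  have op: "open (rep_dom a d ?r)" unfolding dom by (rule open_smooth_preimage[OF pair smooth_onD(2)[OF sm]])
  have "smooth_on sc Model Model (rep_dom a d ?r) (\<lambda>x. ?m (VPair x y))"
    by (rule smooth_on_comp[OF smooth_on_subset[OF pair _ op] sm]) (auto simp: dom)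
  then show ?thesis
    by (rule smooth_on_cong) (use cinv_prod[OF a unit_chart(1)] y in \<open>auto simp: rep_def rep_dom_iff\<close>)
qed

text \<open>In the chart at the unit, the right invariant vector field of \<open>v\<close> is
  $y \mapsto d\mu(e, y)(v, 0)$.\<close>

lemma right_invariant_coords:
  assumes y: "y \<in> C"
  shows "vsnd (coords c0 (right_invariant sc G (tv x) (cinv c0 y))) = Dmu (VPair x0 y) (VPair (Vec x) O0)"
proof -
  let ?r = "\<lambda>h. h \<otimes>\<^bsub>G\<^esub> cinv c0 y"
  let ?U = "rep_dom c0 c0 ?r" and ?f = "rep c0 c0 ?r"
  note sm = smooth_right_translation[OF unit_chart(1) unit_chart(1) y]
  have x0: "x0 \<in> ?U" using C(3) cinv_C[OF y] by (simp add: rep_dom_iff)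
  have sub: "?U \<subseteq> points Model" "open ?U" using smooth_onD[OF sm] by auto
  have u: "VPair x0 (Vec x) \<in> Tk_set 1 (model M) ?U" using x0 by simp
  have f0: "?f x0 = y" using cinv_C[OF y] snd_cinv[OF y] by (simp add: rep_def)
  let ?w = "Tk_map 1 sc (model M) (model M) ?U ?f (VPair x0 (Vec x))"
  have w: "?w = VPair y (differential sc Model Model ?U ?f x0 (Vec x))"
    using Tk_map_Suc[of 0 Model Model ?U ?f x0 "Vec x"] f0 by simp
  have "right_invariant sc G (tv x) (cinv c0 y) = Tk_class sc 1 M c0 ?w"
    unfolding right_invariant_def tv_to_jet to_jet_def
    by (rule Tk_fun_Tk_class[OF charted_M charted_M _ unit_chart(1) unit_chart(1) u])
      (use smooth_right_translation[OF _ _ y] in simp)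
  moreover have "coords c0 (Tk_class sc 1 M c0 ?w) = ?w"
  proof (rule M.coords_Tk_class_self[OF unit_chart(1)])
    show "?w \<in> Tk_set 1 (model M) C"
      unfolding w using y shape_differential[OF sm x0, of "Vec x"] by simp
  qed
  ultimately have 1: "vsnd (coords c0 (right_invariant sc G (tv x) (cinv c0 y))) = differential sc Model Model ?U ?f x0 (Vec x)"
    using w by simp
  have pair: "smooth_on sc Model MM ?U (\<lambda>x. VPair x y)"
    by (intro smooth_on_VPair smooth_on_linear[OF continuous_linear_id] smooth_on_const sub shape_C y)
  have im: "(\<lambda>x. VPair x y) ` ?U \<subseteq> Dm" using y by (auto simp: Dm_iff rep_dom_iff)
  have "differential sc Model Model ?U ?f x0 (Vec x) = differential sc Model Model ?U (\<lambda>x. mu (VPair x y)) x0 (Vec x)"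
    by (rule differential_cong[OF sm _ x0]) (use y in \<open>auto simp: rep_def rep_dom_iff mu_eq\<close>)
  also have "\<dots> = Dmu (VPair x0 y) (differential sc Model MM ?U (\<lambda>x. VPair x y) x0 (Vec x))"
    by (rule differential_comp[OF pair smooth_mu im x0]) simp
  also have "differential sc Model MM ?U (\<lambda>x. VPair x y) x0 (Vec x) = VPair (Vec x) O0"
    using differential_VPair[OF smooth_on_linear[OF continuous_linear_id sub] smooth_on_const[OF sub shape_C[OF y]] x0, of "Vec x"]
      differential_linear[OF continuous_linear_id sub x0, of "Vec x"] differential_const[OF sub x0 _ shape_C[OF y], of "Vec x"]
    by simp
  finally show ?thesis using 1 by simp
qed

text \<open>The derivative at the unit in the direction \<open>z\<close> of $y \mapsto d\mu(e,y)(v,0)$ is the mixed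
  second differential; here the symmetry of the second differential restores the order of the
  arguments.\<close>

lemma differential_right_invariant:
  "differential sc Model Model C (\<lambda>y. vsnd (coords c0 (right_invariant sc G (tv x) (cinv c0 y)))) x0 (Vec z) = Vec (mixed x z)"
proof -
  have sh: "shape_of (VPair (Vec x) O0) = MM" by simp
  have 1: "(\<lambda>y. VPair x0 y) ` C \<subseteq> Dm" using mu_x0 by auto
  note sm = smooth_on_differential_dir[OF smooth_mu sh]
  note sm' = smooth_on_comp[OF smooth_diag(2) sm 1]
  have "differential sc Model Model C (\<lambda>y. vsnd (coords c0 (right_invariant sc G (tv x) (cinv c0 y)))) x0 (Vec z) =
      differential sc Model Model C (\<lambda>y. Dmu (VPair x0 y) (VPair (Vec x) O0)) x0 (Vec z)"
    by (rule differential_cong[OF sm' _ C(3), symmetric]) (simp_all add: right_invariant_coords)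
  also have "\<dots> = differential sc MM Model Dm (\<lambda>p. Dmu p (VPair (Vec x) O0)) (VPair x0 x0)
      (differential sc Model MM C (\<lambda>y. VPair x0 y) x0 (Vec z))"
    by (rule differential_comp[OF smooth_diag(2) sm 1 C(3)]) simp
  also have "\<dots> = D2mu p0 (VPair O0 (Vec z)) (VPair (Vec x) O0)"
    using differential_diag(2)[OF C(3), of "Vec z"] by (simp add: differential2_def)
  also have "\<dots> = Vec (mixed x z)" by (simp only: Vec_mixed')
  finally show ?thesis .
qed

lemma L_bracket [simp]: "tv x \<otimes>\<^bsub>L\<^esub> tv y = tv (bracket x y)"
proof -
  have chart: "chart_at M \<one>\<^bsub>G\<^esub> = c0" by (simp add: unit_chart_def)
  have at: "vsnd (coords c0 (right_invariant sc G (tv z) (cinv c0 x0))) = Vec z" for z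
    unfolding right_invariant_coords[OF C(3)] using Dmu_p0[of "Vec z" O0] by simp
  have "tv x \<otimes>\<^bsub>L\<^esub> tv y = vf_bracket sc M (right_invariant sc G (tv x)) (right_invariant sc G (tv y)) \<one>\<^bsub>G\<^esub>"
    by (simp add: lie_algebra_def)
  also have "\<dots> = Tk_class sc 1 M c0 (VPair x0 (vdiff sc (Vec (mixed x y)) (Vec (mixed y x))))"
    unfolding vf_bracket_def Let_def chart at model_M differential_right_invariant ..
  also have "vdiff sc (Vec (mixed x y)) (Vec (mixed y x)) = Vec (bracket x y)"
    by (simp add: vdiff_def bracket_def sc_simps)
  finally show ?thesis by (simp add: tv_to_jet to_jet_def)
qed

lemma foldl_bracket: "foldl (\<lambda>a b. a \<otimes>\<^bsub>L\<^esub> b) (tv x) (map (\<lambda>i. tv (w i)) l) = tv (foldl bracket x (map w l))"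
  by (induction l arbitrary: x) auto

lemma foldl_bracket_op:
  "foldl (\<lambda>a b. b \<otimes>\<^bsub>L\<^esub> a) (tv x) (map (\<lambda>i. tv (w i)) l) = tv (foldl (\<lambda>a b. bracket b a) x (map w l))"
  by (induction l arbitrary: x) auto

section \<open>The trivializations\<close>

lemma eps_tv: "eps sc k G \<alpha> (tv x) = eps_elem k \<alpha> x"
  by (simp add: eps_def eps_elem_def to_jet_def single_def base_def)

text \<open>The elements of \<open>E_space\<close>, given by their coordinates in the model module.\<close>

definition lift :: "nat \<Rightarrow> (nat \<Rightarrow> 'v) \<Rightarrow> nat \<Rightarrow> ('g, 'v, 'k) jet" where
  "lift k v = (\<lambda>\<gamma>\<in>{0<..<2 ^ k}. tv (v \<gamma>))"

lemma lift_E_space [simp]: "lift k v \<in> E_space sc k G"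
  by (auto simp: lift_def E_space_def)

lemma E_space_lift: "v \<in> E_space sc k G \<Longrightarrow> \<exists>v'. v = lift k v'"
proof -
  assume v: "v \<in> E_space sc k G"
  then have "v \<gamma> = tv (vec (principal_part G (v \<gamma>)))" if "\<gamma> \<in> {0<..<2 ^ k}" for \<gamma>
  proof -
    have "v \<gamma> \<in> range tv" using v that by (simp add: E_space_def carrier_L PiE_iff)
    then obtain x where "v \<gamma> = tv x" by (rule rangeE)
    then show ?thesis by simp
  qed
  moreover have "v \<gamma> = undefined" if "\<gamma> \<notin> {0<..<2 ^ k}" for \<gamma>
    using that v by (auto simp: E_space_def PiE_iff extensional_def)
  ultimately have "v = lift k (\<lambda>\<gamma>. vec (principal_part G (v \<gamma>)))"
    by (auto simp: lift_def fun_eq_iff restrict_def)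
  then show ?thesis by blast
qed

lemma lift_cong: "(\<And>\<gamma>. 0 < \<gamma> \<Longrightarrow> \<gamma> < 2 ^ k \<Longrightarrow> v \<gamma> = w \<gamma>) \<Longrightarrow> lift k v = lift k w"
  by (auto simp: lift_def fun_eq_iff restrict_def)

lemma Psi_lift:
  "Psi_L sc k G (lift k v) = filtered_group.ordered_prod (UF k) (eps_elem k) [1..<2 ^ k] v"
  "Psi_R sc k G (lift k v) = filtered_group.ordered_prod (UF k) (eps_elem k) (rev [1..<2 ^ k]) v"
proof -
  interpret F: filtered_group "UF k" k "eps_elem k" bracket "\<lambda>\<gamma> \<xi>. leaf k \<gamma> (coords c0 \<xi>)"
    by (rule filtered_group_UF)
  have m: "map (\<lambda>\<alpha>. eps sc k G \<alpha> (lift k v \<alpha>)) l = map (\<lambda>\<alpha>. eps_elem k \<alpha> (v \<alpha>)) l" if "set l \<subseteq> {0<..<2 ^ k}" for l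
    using that by (auto simp: lift_def eps_tv)
  have "set [1..<2 ^ k] \<subseteq> {0<..<2 ^ k}" "set (rev [1..<2 ^ k]) \<subseteq> {0<..<2 ^ k}" by auto
  note m[OF this(1)] m[OF this(2)]
  then show "Psi_L sc k G (lift k v) = F.ordered_prod [1..<2 ^ k] v"
    "Psi_R sc k G (lift k v) = F.ordered_prod (rev [1..<2 ^ k]) v"
    unfolding Psi_L_def Psi_R_def F.ordered_prod_def by (simp_all only:)
qed

lemma the_lift:
  assumes "g = P (lift k z)" "\<And>z'. P (lift k z) = P (lift k z') \<Longrightarrow> lift k z' = lift k z"
  shows "(THE z. z \<in> E_space sc k G \<and> g = P z) = lift k z"
proof (rule the_equality)
  fix y assume y: "y \<in> E_space sc k G \<and> g = P y"
  then obtain y' where "y = lift k y'" using E_space_lift by blast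
  then show "y = lift k z" using assms y by metis
qed (use assms(1) in simp)

lemma lift_eq_restrict: "(\<And>\<gamma>. \<gamma> \<in> {0<..<2 ^ k} \<Longrightarrow> tv (f \<gamma>) = h \<gamma>) \<Longrightarrow> lift k f = restrict h {0<..<2 ^ k}"
  unfolding lift_def by (rule restrict_ext)

abbreviation left_coords :: "nat \<Rightarrow> (nat \<Rightarrow> 'v) \<Rightarrow> (nat \<Rightarrow> 'v) \<Rightarrow> nat \<Rightarrow> 'v" where
  "left_coords k v w \<equiv> (\<lambda>\<gamma>. v \<gamma> + w \<gamma> +
     (\<Sum>m\<in>{2..weight k \<gamma>}. \<Sum>l\<in>partitions k m \<gamma>. foldl bracket (v (last l)) (map w (butlast l))))"

abbreviation inverse_coords :: "nat \<Rightarrow> (nat \<Rightarrow> 'v) \<Rightarrow> nat \<Rightarrow> 'v" where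
  "inverse_coords k v \<equiv> (\<lambda>\<gamma>. - v \<gamma> +
     (\<Sum>m\<in>{2..weight k \<gamma>}. \<Sum>l\<in>partitions k m \<gamma>.
       if even m then foldl bracket (v (last l)) (map v (rev (butlast l)))
       else - foldl bracket (v (last l)) (map v (rev (butlast l)))))"

abbreviation right_coords :: "nat \<Rightarrow> (nat \<Rightarrow> 'v) \<Rightarrow> (nat \<Rightarrow> 'v) \<Rightarrow> nat \<Rightarrow> 'v" where
  "right_coords k v w \<equiv> (\<lambda>\<gamma>. v \<gamma> + w \<gamma> +
     (\<Sum>m\<in>{2..weight k \<gamma>}. \<Sum>l\<in>partitions k m \<gamma>.
       foldl (\<lambda>x y. bracket y x) (w (last l)) (map v (butlast l))))"

text \<open>The formulas in coordinates. The operations are well-defined because an ordered product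
  determines its entries.\<close>

lemma operations_lift:
  "left_product sc k G (lift k v) (lift k w) = lift k (left_coords k v w)"
  "left_inversion sc k G (lift k v) = lift k (inverse_coords k v)"
  "right_product sc k G (lift k v) (lift k w) = lift k (right_coords k v w)"
proof -
  interpret F: filtered_group "UF k" k "eps_elem k" bracket "\<lambda>\<gamma> \<xi>. leaf k \<gamma> (coords c0 \<xi>)"
    by (rule filtered_group_UF)
  have injL: "lift k z' = lift k z" if "Psi_L sc k G (lift k z) = Psi_L sc k G (lift k z')" for z z'
    using that F.ordered_prod_inj[of z z'] unfolding Psi_lift by (intro lift_cong) simp
  have injR: "lift k z' = lift k z" if "Psi_R sc k G (lift k z) = Psi_R sc k G (lift k z')" for z z'
    using that F.ordered_prod_rev_inj[of z z'] unfolding Psi_lift by (intro lift_cong) simp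
  show "left_product sc k G (lift k v) (lift k w) = lift k (left_coords k v w)"
    unfolding left_product_def
    by (rule the_lift[where P = "Psi_L sc k G"])
      (unfold Psi_lift, rule F.left_product_formula[unfolded F.bracket_left_def], fold Psi_lift, rule injL)
  show "left_inversion sc k G (lift k v) = lift k (inverse_coords k v)"
    unfolding left_inversion_def
    by (rule the_lift[where P = "Psi_L sc k G"])
      (unfold Psi_lift, rule F.left_inversion_formula[unfolded F.bracket_inv_def], fold Psi_lift, rule injL)
  show "right_product sc k G (lift k v) (lift k w) = lift k (right_coords k v w)"
    unfolding right_product_def
    by (rule the_lift[where P = "Psi_R sc k G"])
      (unfold Psi_lift, rule F.right_product_formula, fold Psi_lift, rule injR)
qed

lemma partitions_entries:
  assumes "l \<in> partitions k m \<gamma>" "2 \<le> m"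
  shows "last l \<in> {0<..<2 ^ k}" "set (butlast l) \<subseteq> {0<..<2 ^ k}"
proof -
  have "l \<noteq> []" "set l \<subseteq> {0<..<2 ^ k}" using assms by (auto simp: partitions_def)
  then show "last l \<in> {0<..<2 ^ k}" "set (butlast l) \<subseteq> {0<..<2 ^ k}"
    using last_in_set in_set_butlastD by (metis subsetD, metis subsetD subsetI)
qed

lemma map_lift: "set l \<subseteq> {0<..<2 ^ k} \<Longrightarrow> map (lift k v) l = map (\<lambda>i. tv (v i)) l"
  by (auto simp: lift_def)

lemma lift_eq: "\<gamma> \<in> {0<..<2 ^ k} \<Longrightarrow> lift k v \<gamma> = tv (v \<gamma>)"
  by (simp add: lift_def)

lemma finsum_partitions:
  assumes "\<And>m l. m \<in> {2..weight k \<gamma>} \<Longrightarrow> l \<in> partitions k m \<gamma> \<Longrightarrow> f m l = tv (g m l)"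
  shows "(\<Oplus>\<^bsub>L\<^esub>m\<in>{2..weight k \<gamma>}. \<Oplus>\<^bsub>L\<^esub>l\<in>partitions k m \<gamma>. f m l) =
    tv (\<Sum>m\<in>{2..weight k \<gamma>}. \<Sum>l\<in>partitions k m \<gamma>. g m l)"
  by (intro L_finsum finite_partitions assms) auto

lemma sc_power: "sc ((- 1) ^ m) x = (if even m then x else - x)"
  by (simp add: sc_simps)

lemma formulas_lift:
  shows "left_product sc k G (lift k v) (lift k w) =
      (\<lambda>\<gamma>\<in>{0<..<2 ^ k}. lift k v \<gamma> \<oplus>\<^bsub>L\<^esub> lift k w \<gamma> \<oplus>\<^bsub>L\<^esub>
         (\<Oplus>\<^bsub>L\<^esub>m\<in>{2..weight k \<gamma>}. \<Oplus>\<^bsub>L\<^esub>l\<in>partitions k m \<gamma>.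
            foldl (\<lambda>x y. x \<otimes>\<^bsub>L\<^esub> y) (lift k v (last l)) (map (lift k w) (butlast l))))" (is ?left)
    and "left_inversion sc k G (lift k v) =
      (\<lambda>\<gamma>\<in>{0<..<2 ^ k}. \<ominus>\<^bsub>L\<^esub> lift k v \<gamma> \<oplus>\<^bsub>L\<^esub>
         (\<Oplus>\<^bsub>L\<^esub>m\<in>{2..weight k \<gamma>}. (- 1) ^ m \<odot>\<^bsub>L\<^esub>
            (\<Oplus>\<^bsub>L\<^esub>l\<in>partitions k m \<gamma>.
               foldl (\<lambda>x y. x \<otimes>\<^bsub>L\<^esub> y) (lift k v (last l)) (map (lift k v) (rev (butlast l))))))" (is ?inverse)
    and "right_product sc k G (lift k v) (lift k w) =
      (\<lambda>\<gamma>\<in>{0<..<2 ^ k}. lift k v \<gamma> \<oplus>\<^bsub>L\<^esub> lift k w \<gamma> \<oplus>\<^bsub>L\<^esub>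
         (\<Oplus>\<^bsub>L\<^esub>m\<in>{2..weight k \<gamma>}. \<Oplus>\<^bsub>L\<^esub>l\<in>partitions k m \<gamma>.
            foldl (\<lambda>x y. y \<otimes>\<^bsub>L\<^esub> x) (lift k w (last l)) (map (lift k v) (butlast l))))" (is ?right)
proof -
  have "(\<Oplus>\<^bsub>L\<^esub>m\<in>{2..weight k \<gamma>}. \<Oplus>\<^bsub>L\<^esub>l\<in>partitions k m \<gamma>.
          foldl (\<lambda>x y. x \<otimes>\<^bsub>L\<^esub> y) (lift k v (last l)) (map (lift k w) (butlast l))) =
        tv (\<Sum>m\<in>{2..weight k \<gamma>}. \<Sum>l\<in>partitions k m \<gamma>. foldl bracket (v (last l)) (map w (butlast l)))" for \<gamma>
    by (rule finsum_partitions) (use partitions_entries in \<open>simp add: map_lift lift_eq foldl_bracket\<close>)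
  then show ?left unfolding operations_lift by (intro lift_eq_restrict) (simp add: lift_eq)
  have "(\<Oplus>\<^bsub>L\<^esub>m\<in>{2..weight k \<gamma>}. \<Oplus>\<^bsub>L\<^esub>l\<in>partitions k m \<gamma>.
          foldl (\<lambda>x y. y \<otimes>\<^bsub>L\<^esub> x) (lift k w (last l)) (map (lift k v) (butlast l))) =
        tv (\<Sum>m\<in>{2..weight k \<gamma>}. \<Sum>l\<in>partitions k m \<gamma>. foldl (\<lambda>x y. bracket y x) (w (last l)) (map v (butlast l)))" for \<gamma>
    by (rule finsum_partitions) (use partitions_entries in \<open>simp add: map_lift lift_eq foldl_bracket_op\<close>)
  then show ?right unfolding operations_lift by (intro lift_eq_restrict) (simp add: lift_eq)
  let ?F = "\<lambda>l. foldl bracket (v (last l)) (map v (rev (butlast l)))"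
  have "(\<Oplus>\<^bsub>L\<^esub>m\<in>{2..weight k \<gamma>}. (- 1) ^ m \<odot>\<^bsub>L\<^esub>
          (\<Oplus>\<^bsub>L\<^esub>l\<in>partitions k m \<gamma>.
             foldl (\<lambda>x y. x \<otimes>\<^bsub>L\<^esub> y) (lift k v (last l)) (map (lift k v) (rev (butlast l))))) =
      tv (\<Sum>m\<in>{2..weight k \<gamma>}. \<Sum>l\<in>partitions k m \<gamma>. if even m then ?F l else - ?F l)" for \<gamma>
  proof (rule L_finsum)
    fix m assume m: "m \<in> {2..weight k \<gamma>}"
    have "(\<Oplus>\<^bsub>L\<^esub>l\<in>partitions k m \<gamma>. foldl (\<lambda>x y. x \<otimes>\<^bsub>L\<^esub> y) (lift k v (last l)) (map (lift k v) (rev (butlast l)))) =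
        tv (\<Sum>l\<in>partitions k m \<gamma>. ?F l)"
      by (rule L_finsum[OF finite_partitions])
        (use partitions_entries m in \<open>simp add: map_lift lift_eq foldl_bracket\<close>)
    then show "(- 1) ^ m \<odot>\<^bsub>L\<^esub>
          (\<Oplus>\<^bsub>L\<^esub>l\<in>partitions k m \<gamma>. foldl (\<lambda>x y. x \<otimes>\<^bsub>L\<^esub> y) (lift k v (last l)) (map (lift k v) (rev (butlast l)))) =
        tv (\<Sum>l\<in>partitions k m \<gamma>. if even m then ?F l else - ?F l)"
      by (simp add: sc_power sum_negf)
  qed simp
  then show ?inverse unfolding operations_lift by (intro lift_eq_restrict) (simp add: lift_eq)
qed

end

theorem theorem24p7:
  fixes sc :: "'k::hausdorff_ring \<Rightarrow> 'v::{topological_ab_group_add, t2_space} \<Rightarrow> 'v"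
    and G :: "('g, 'v, 'k) lie_structure"
    and L :: "('k, ('g, 'v, 'k) jet) module" (structure)
    and k :: nat
    and v w :: "nat \<Rightarrow> ('g, 'v, 'k) jet"
  assumes "good_base_ring TYPE('k)"
    and "lie_group sc G"
    and "L = lie_algebra sc G"
    and "k \<ge> 1"
    and "v \<in> E_space sc k G"
    and "w \<in> E_space sc k G"
  shows "left_product sc k G v w =
      (\<lambda>\<gamma>\<in>{0<..<2 ^ k}. v \<gamma> \<oplus> w \<gamma> \<oplus>
         (\<Oplus>m\<in>{2..weight k \<gamma>}. \<Oplus>l\<in>partitions k m \<gamma>.
            foldl (\<lambda>x y. x \<otimes> y) (v (last l)) (map w (butlast l)))) \<and>
    left_inversion sc k G v =
      (\<lambda>\<gamma>\<in>{0<..<2 ^ k}. \<ominus> v \<gamma> \<oplus>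
         (\<Oplus>m\<in>{2..weight k \<gamma>}. (- 1) ^ m \<odot>
            (\<Oplus>l\<in>partitions k m \<gamma>.
               foldl (\<lambda>x y. x \<otimes> y) (v (last l)) (map v (rev (butlast l)))))) \<and>
    right_product sc k G v w =
      (\<lambda>\<gamma>\<in>{0<..<2 ^ k}. v \<gamma> \<oplus> w \<gamma> \<oplus>
         (\<Oplus>m\<in>{2..weight k \<gamma>}. \<Oplus>l\<in>partitions k m \<gamma>.
            foldl (\<lambda>x y. y \<otimes> x) (w (last l)) (map v (butlast l))))"
proof -
  interpret lie_group_over sc G
    using assms(1,2) by unfold_locales (simp_all add: lie_group_def)
  obtain v' w' where "v = lift k v'" "w = lift k w'" using assms(5,6) E_space_lift by blast
  then show ?thesis unfolding assms(3) by (intro conjI) (simp_all only: formulas_lift)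
qed

end
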